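(* Let $\chi(a)=\left(\frac{a}{17}\right)$ denote the Legendre symbol modulo $17$. Then $\mathfrak{p}(n,\chi)=0$ for all positive integers $n \equiv 17,19,25,27 \pmod{34}$. Equivalently, $\mathfrak{p}(n,\chi)=0$ whenever $n$ is odd and $1-24n$ is congruent to a quartic residue modulo $17$.
   Context: For $f:\mathbb{N}\to\{0,\pm1\}$ and a positive integer $n$, the $f$-signed partition number is \[\mathfrak{p}(n,f)=\sum_{\substack{x_1+\cdots+x_k=n\\ x_1\ge\cdots\ge x_k>0\\ k\ge1}} f(x_1)f(x_2)\cdots f(x_k),\] i.e. the sum over all partitions of $n$ of the product of the values of $f$ at the parts; equivalently $\prod_{m\ge1}(1-f(m)x^m)^{-1}=1+\sum_{n\ge1}\mathfrak{p}(n,f)x^n$ for $|x|<1$. For a prime $p>2$, $\left(\frac{a}{p}\right)$ is $1$ if $p\nmid a$ and $a$ is a square mod $p$, $-1$ if $p\nmid a$ and $a$ is not a square mod $p$, and $0$ if $p\mid a$. *)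

theory Defs
  imports "HOL-Number_Theory.Number_Theory"
begin

text \<open>
  A partition of \<open>n\<close> is the weakly decreasing list of its parts. The values of \<open>f\<close> at
  positive arguments are meant to lie in \<open>{-1, 0, 1}\<close>, but the definition does not need this.
  The index set of the sum is finite, so the sum is not subject to the convention
  that sums over infinite sets vanish.
\<close>

definition partitions_of :: "nat \<Rightarrow> nat list set" where
  "partitions_of n =
     {xs. xs \<noteq> [] \<and> sorted_wrt (\<ge>) xs \<and> (\<forall>x\<in>set xs. x > 0) \<and> sum_list xs = n}"

definition signed_partition_number :: "nat \<Rightarrow> (nat \<Rightarrow> int) \<Rightarrow> int" where
  "signed_partition_number n f = (\<Sum>xs\<in>partitions_of n. prod_list (map f xs))"

lemma finite_partitions_of: "finite (partitions_of n)"
proof (rule finite_subset)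
  have len: "length xs \<le> sum_list xs" if "\<forall>x\<in>set xs. x > 0" for xs :: "nat list"
    using that by (induction xs) auto
  show "partitions_of n \<subseteq> {xs. set xs \<subseteq> {..n} \<and> length xs \<le> n}"
    using len by (auto simp: partitions_of_def intro: member_le_sum_list)
  show "finite {xs. set xs \<subseteq> {..n} \<and> length xs \<le> n}"
    by (rule finite_lists_length_le) simp
qed

text \<open>As for quadratic residues in the Legendre symbol, the class of 0 is excluded.\<close>

definition quartic_residue :: "int \<Rightarrow> int \<Rightarrow> bool" where
  "quartic_residue p a \<longleftrightarrow> \<not> [a = 0] (mod p) \<and> (\<exists>y. [y ^ 4 = a] (mod p))"

end

theory Submission
  imports "HOL-Complex_Analysis.Complex_Analysis" "HOL-Library.Landau_Symbols" Defs
begin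

text \<open>
  Write \<open>1 / (1 + x^m) = (1 - x^m) / (1 - x^(2 * m))\<close> in the factors belonging to nonresidues. As 2 is a residue
  modulo 17, the generating function becomes a quotient of theta functions at the 34-division points of
  the lattice spanned by 1 and \<open>\<tau>\<close>, where \<open>x = exp (2 * pi * \<i> * \<tau> / 34)\<close>. Up to roots of unity and a common
  factor, the modular group permutes the quotients attached to the different division points.

  The part of the generating function with indices in one of the four classes modulo 34 is a finite sum of
  such quotients. At every cusp the principal parts of this sum cancel: relative to a common
  normalisation they only involve the exponents 6 and 10 in \<open>x\<close>, whose coefficients are vanishing sums of roots
  of unity, and constant terms, which agree up to sign. After multiplication by a
  product of theta constants one has finitely many holomorphic functions on the upper half plane whose
  absolute values are permuted by the modular group and which tend to 0 at infinity, so that they vanish by the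
  maximum modulus principle.
\<close>

unbundle no vec_syntax

section \<open>Theta functions\<close>

text \<open>The threshold behind all estimates is the order 1/3 in
  \<open>exp (2 * pi * \<i> * \<tau>)\<close>. Under \<open>- 1 / \<tau>\<close> a quotient
  \<open>kquot\<close> acquires the factor \<open>1 / k ^ 4\<close> and \<open>klein_half\<close> a
  factor of absolute value \<open>norm k ^ 3\<close>, with the same \<open>k\<close>. So third
  powers of the sums are paired with fourth powers of \<open>klein_half\<close>, and the latter cost
  one order. A quotient has order at least 12/34, just above 1/3, unless its first index is
  divisible by 17 (order 0) or is an even residue (order 6/34). Only these terms have to cancel.
  Modulo 17 the exponents 3, 5, -3, -5 form the coset of 3 by the quartic residues. Quartic residues
  enter because an even residue \<open>a\<close> acts on the exponents 6 and 10 through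
  \<open>a ^ 2\<close>: at the cusps with \<open>c\<close> congruent to 17 a term could survive only
  if \<open>e\<close> were congruent to \<open>- 6 / a ^ 2\<close> or \<open>- 10 / a ^ 2\<close>,
  that is, to 6, 7, 10 or 11, which is a different coset. At the cusps with \<open>c\<close> prime
  to 34 these terms cancel in pairs, because multiplication of both indices by 9 changes the sign of
  a quotient.\<close>

definition qpoch :: "complex \<Rightarrow> complex \<Rightarrow> complex" where
  "qpoch a q = (\<Prod>n. 1 - a * q ^ n)"

lemma qpoch_abs_convergent:
  fixes q :: complex
  assumes "norm q < 1"
  shows "abs_convergent_prod (\<lambda>n. 1 - a * q ^ n)"
proof -
  have "summable (\<lambda>n. norm (- a * q ^ n))"
    using assms by (simp add: norm_mult norm_power summable_mult summable_geometric)
  hence "summable (\<lambda>n. norm ((1 - a * q ^ n) - 1))" by simp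
  thus ?thesis by (rule summable_imp_abs_convergent_prod)
qed

lemma qpoch_convergent:
  fixes q :: complex
  assumes "norm q < 1"
  shows "convergent_prod (\<lambda>n. 1 - a * q ^ n)"
  using qpoch_abs_convergent[OF assms] by (rule abs_convergent_prod_imp_convergent_prod)

lemma qpoch_LIMSEQ:
  assumes "norm q < 1"
  shows "(\<lambda>N. \<Prod>n<N. 1 - a * q ^ n) \<longlonglongrightarrow> qpoch a q"
proof -
  have "(\<lambda>N. \<Prod>n\<le>N. 1 - a * q ^ n) \<longlonglongrightarrow> qpoch a q"
    unfolding qpoch_def by (rule convergent_prod_LIMSEQ[OF qpoch_convergent[OF assms]])
  hence "(\<lambda>N. \<Prod>n<Suc N. 1 - a * q ^ n) \<longlonglongrightarrow> qpoch a q"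
    by (simp only: lessThan_Suc_atMost)
  thus ?thesis by (rule LIMSEQ_imp_Suc)
qed

text \<open>The argument and the nome vary together because at a division point both depend on
  \<open>\<tau>\<close>. On a compact set one geometric series in \<open>norm (q t1)\<close>
  majorises all factors.\<close>

lemma qpoch_uniform_limit:
  fixes a q :: "complex \<Rightarrow> complex"
  assumes "compact A" "continuous_on A a" "continuous_on A q" "\<And>t. t \<in> A \<Longrightarrow> norm (q t) < 1"
  shows "uniform_limit A (\<lambda>N t. \<Prod>n<N. 1 - a t * q t ^ n) (\<lambda>t. qpoch (a t) (q t)) sequentially"
proof (cases "A = {}")
  case False
  have "compact ((\<lambda>t. norm (a t)) ` A)" "compact ((\<lambda>t. norm (q t)) ` A)"
    using assms by (auto intro!: compact_continuous_image continuous_intros)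
  then obtain t1 where t1: "t1 \<in> A" "\<And>t. t \<in> A \<Longrightarrow> norm (q t) \<le> norm (q t1)"
    using compact_attains_sup[of "(\<lambda>t. norm (q t)) ` A"] False by (auto simp: image_iff)
  obtain C where C: "\<And>t. t \<in> A \<Longrightarrow> norm (a t) \<le> C"
    using compact_imp_bounded[OF \<open>compact ((\<lambda>t. norm (a t)) ` A)\<close>]
    by (auto simp: bounded_iff)
  have "uniformly_convergent_on A (\<lambda>N t. \<Prod>n<N. 1 - a t * q t ^ n)"
  proof (rule uniformly_convergent_on_prod')
    show "uniformly_convergent_on A (\<lambda>N t. \<Sum>n<N. norm (1 - a t * q t ^ n - 1))"
    proof (rule Weierstrass_m_test')
      fix n t assume t: "t \<in> A"
      have "0 \<le> C" using C[OF t] norm_ge_zero[of "a t"] by linarith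
      hence "norm (a t) * norm (q t) ^ n \<le> C * norm (q t1) ^ n"
        by (intro mult_mono power_mono C t1 t) auto
      thus "norm (norm (1 - a t * q t ^ n - 1)) \<le> C * norm (q t1) ^ n"
        by (simp add: norm_mult norm_power)
    next
      show "summable (\<lambda>n. C * norm (q t1) ^ n)"
        using assms(4)[OF t1(1)] by (intro summable_mult summable_geometric) auto
    qed
  qed (use assms in \<open>auto intro!: continuous_intros\<close>)
  then obtain g where g: "uniform_limit A (\<lambda>N t. \<Prod>n<N. 1 - a t * q t ^ n) g sequentially"
    by (auto simp: uniformly_convergent_on_def)
  also have "?this \<longleftrightarrow> ?thesis"
  proof (intro uniform_limit_cong)
    fix t assume t: "t \<in> A"
    show "g t = qpoch (a t) (q t)"
      using tendsto_uniform_limitI[OF g t] qpoch_LIMSEQ[OF assms(4)[OF t]] LIMSEQ_unique by blast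
  qed auto
  finally show ?thesis .
qed auto

lemma holomorphic_on_qpoch:
  assumes A: "open A" and a: "a holomorphic_on A" and q: "q holomorphic_on A"
    and "\<And>t. t \<in> A \<Longrightarrow> norm (q t) < 1"
  shows "(\<lambda>t. qpoch (a t) (q t)) holomorphic_on A"
proof (rule holomorphic_uniform_sequence[OF A])
  show "(\<lambda>t. \<Prod>n<N. 1 - a t * q t ^ n) holomorphic_on A" for N
    using a q by (intro holomorphic_intros)
  fix z assume "z \<in> A"
  then obtain d where d: "d > 0" "cball z d \<subseteq> A" using A open_contains_cball by blast
  have "continuous_on (cball z d) a" "continuous_on (cball z d) q"
    using a q d(2) by (auto intro: holomorphic_on_imp_continuous_on holomorphic_on_subset)
  hence "uniform_limit (cball z d) (\<lambda>N t. \<Prod>n<N. 1 - a t * q t ^ n) (\<lambda>t. qpoch (a t) (q t)) sequentially"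
    using assms(4) d(2) by (intro qpoch_uniform_limit) auto
  thus "\<exists>d>0. cball z d \<subseteq> A \<and> uniform_limit (cball z d) (\<lambda>N t. \<Prod>n<N. 1 - a t * q t ^ n) (\<lambda>t. qpoch (a t) (q t)) sequentially"
    using d by blast
qed

lemma qpoch_rec:
  assumes "norm q < 1"
  shows "qpoch a q = (1 - a) * qpoch (a * q) q"
proof -
  have "(\<lambda>N. \<Prod>n<Suc N. 1 - a * q ^ n) \<longlonglongrightarrow> qpoch a q"
    using qpoch_LIMSEQ[OF assms] by (rule LIMSEQ_Suc)
  moreover have "(\<lambda>N. (1 - a) * (\<Prod>n<N. 1 - (a * q) * q ^ n)) \<longlonglongrightarrow> (1 - a) * qpoch (a * q) q"
    by (intro tendsto_intros qpoch_LIMSEQ assms)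
  moreover have "(\<Prod>n<Suc N. 1 - a * q ^ n) = (1 - a) * (\<Prod>n<N. 1 - (a * q) * q ^ n)" for N
    by (subst prod.lessThan_Suc_shift) (simp add: mult_ac)
  ultimately show ?thesis using LIMSEQ_unique by simp
qed

lemma qpoch_eq_0_iff:
  assumes "norm q < 1"
  shows "qpoch a q = 0 \<longleftrightarrow> (\<exists>n. a * q ^ n = 1)"
proof
  assume "qpoch a q = 0"
  thus "\<exists>n. a * q ^ n = 1"
    using prodinf_nonzero[OF qpoch_convergent[OF assms, of a]] by (force simp: qpoch_def)
next
  assume "\<exists>n. a * q ^ n = 1"
  then obtain n where n: "a * q ^ n = 1" by blast
  have "eventually (\<lambda>N. (\<Prod>n<N. 1 - a * q ^ n) = 0) sequentially"
    using eventually_gt_at_top[of n] by eventually_elim (use n in \<open>auto intro!: prod_zero\<close>)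
  hence "(\<lambda>N. \<Prod>n<N. 1 - a * q ^ n) \<longlonglongrightarrow> 0" by (rule tendsto_eventually)
  thus "qpoch a q = 0" using LIMSEQ_unique[OF qpoch_LIMSEQ[OF assms]] by blast
qed

text \<open>Uniform in both arguments and linear in \<open>a\<close>; this lets
  \<open>near1_qpoch\<close> turn the order of the argument into the order of the deviation from
  1.\<close>

lemma qpoch_minus1_bound:
  obtains C where "\<And>a q. norm q \<le> 1/2 \<Longrightarrow> norm a \<le> 1 \<Longrightarrow> norm (qpoch a q - 1) \<le> C * norm a"
proof -
  have "norm (qpoch a q - 1) \<le> (exp 2) * norm a" if q: "norm q \<le> 1/2" and a: "norm a \<le> 1" for a q :: complex
  proof -
    have q1: "norm q < 1" using q by linarith
    have bd: "norm ((\<Prod>n<N. 1 - a * q ^ n) - 1) \<le> exp 2 * norm a" for N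
    proof -
      have "norm ((\<Prod>n<N. 1 + (- a * q ^ n)) - 1) \<le> (\<Prod>n<N. 1 + norm (- a * q ^ n)) - 1"
        by (rule norm_prod_minus1_le_prod_minus1)
      also have "(\<Prod>n<N. 1 + norm (- a * q ^ n)) \<le> exp (\<Sum>n<N. norm (- a * q ^ n))"
        by (rule prod_le_exp_sum) auto
      also have "(\<Sum>n<N. norm (- a * q ^ n)) \<le> (\<Sum>n<N. norm a * (1/2) ^ n)"
        by (intro sum_mono) (auto simp: norm_mult norm_power intro!: mult_left_mono power_mono q)
      also have "\<dots> = norm a * (\<Sum>n<N. (1/2) ^ n)" by (simp add: sum_distrib_left)
      also have "(\<Sum>n<N. (1/2::real) ^ n) \<le> 2" by (simp add: sum_gp_strict)
      finally have "norm ((\<Prod>n<N. 1 + (- a * q ^ n)) - 1) \<le> exp (norm a * 2) - 1"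
        by (simp add: mult_left_mono)
      \<comment> \<open>On [0, 2] the graph of \<open>exp\<close> lies below its chord, which makes
        the bound linear for \<open>norm a \<le> 1\<close>.\<close>
      also have "exp (norm a * 2) - 1 \<le> exp 2 * norm a"
      proof -
        have "convex_on UNIV (exp :: real \<Rightarrow> real)" by (rule exp_convex)
        from convex_onD[OF this, of "norm a" 0 2] a
        have "exp (norm a * 2) \<le> (1 - norm a) * 1 + norm a * exp 2" by simp
        thus ?thesis by (simp add: algebra_simps) (use norm_ge_zero[of a] in linarith)
      qed
      finally show ?thesis by simp
    qed
    have "(\<lambda>N. norm ((\<Prod>n<N. 1 - a * q ^ n) - 1)) \<longlonglongrightarrow> norm (qpoch a q - 1)"
      by (intro tendsto_intros qpoch_LIMSEQ q1)
    thus ?thesis by (rule tendsto_upperbound) (use bd in auto)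
  qed
  thus ?thesis using that by blast
qed

text \<open>Even and odd \<open>n\<close> are separated. Together with
  \<open>qpoch_mult_minus\<close> this turns the products modulo 17 in \<open>chi_euler\<close> into
  products modulo 34.\<close>

lemma qpoch_double:
  assumes "norm q < 1"
  shows "qpoch a q = qpoch a (q\<^sup>2) * qpoch (a * q) (q\<^sup>2)"
proof -
  have q2: "norm (q\<^sup>2) < 1" using assms by (simp add: norm_power power_less_one_iff)
  have "(\<lambda>N. \<Prod>n<2*N. 1 - a * q ^ n) \<longlonglongrightarrow> qpoch a q"
    by (rule filterlim_compose[OF qpoch_LIMSEQ[OF assms]])
       (auto intro!: filterlim_subseq simp: strict_mono_def)
  moreover have "(\<lambda>N. (\<Prod>n<N. 1 - a * (q\<^sup>2) ^ n) * (\<Prod>n<N. 1 - (a * q) * (q\<^sup>2) ^ n)) \<longlonglongrightarrow>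
     qpoch a (q\<^sup>2) * qpoch (a * q) (q\<^sup>2)"
    by (intro tendsto_intros qpoch_LIMSEQ q2)
  moreover have "(\<Prod>n<2*N. 1 - a * q ^ n) =
     (\<Prod>n<N. 1 - a * (q\<^sup>2) ^ n) * (\<Prod>n<N. 1 - (a * q) * (q\<^sup>2) ^ n)" for N
    by (induction N) (simp_all add: power_mult[symmetric] mult_ac)
  ultimately show ?thesis using LIMSEQ_unique by simp
qed

lemma qpoch_mult_minus:
  assumes "norm q < 1"
  shows "qpoch a q * qpoch (-a) q = qpoch (a\<^sup>2) (q\<^sup>2)"
proof -
  have q2: "norm (q\<^sup>2) < 1" using assms by (simp add: norm_power power_less_one_iff)
  have "(\<lambda>N. (\<Prod>n<N. 1 - a * q ^ n) * (\<Prod>n<N. 1 - (-a) * q ^ n)) \<longlonglongrightarrow> qpoch a q * qpoch (-a) q"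
    by (intro tendsto_intros qpoch_LIMSEQ assms)
  moreover have "(\<Prod>n<N. 1 - a * q ^ n) * (\<Prod>n<N. 1 - (-a) * q ^ n) = (\<Prod>n<N. 1 - a\<^sup>2 * (q\<^sup>2) ^ n)" for N
    by (subst prod.distrib[symmetric], rule prod.cong) 
       (auto simp: algebra_simps power2_eq_square power_mult_distrib)
  ultimately show ?thesis using LIMSEQ_unique[OF _ qpoch_LIMSEQ[OF q2, of "a\<^sup>2"]] by simp
qed

definition theta :: "complex \<Rightarrow> complex \<Rightarrow> complex" where
  "theta w q = qpoch w q * qpoch (q / w) q"

lemma theta_mult_q:
  assumes "norm q < 1" "q \<noteq> 0" "w \<noteq> 0"
  shows "theta (q * w) q = - theta w q / w"
proof -
  have "qpoch (1 / w) q = (1 - 1 / w) * qpoch (q / w) q"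
    using qpoch_rec[OF assms(1), of "1 / w"] by simp
  moreover have "qpoch w q = (1 - w) * qpoch (q * w) q"
    using qpoch_rec[OF assms(1), of w] by (simp add: mult.commute)
  ultimately have *: "theta (q * w) q = qpoch (q * w) q * ((1 - 1 / w) * qpoch (q / w) q)"
    "theta w q = (1 - w) * qpoch (q * w) q * qpoch (q / w) q"
    using assms by (simp_all add: theta_def)
  show ?thesis unfolding * using assms by (simp add: field_simps)
qed

lemma theta_inverse:
  assumes "norm q < 1" "w \<noteq> 0"
  shows "theta (1 / w) q = - theta w q / w"
proof -
  have "qpoch (1 / w) q = (1 - 1 / w) * qpoch (q / w) q"
    using qpoch_rec[OF assms(1), of "1 / w"] by simp
  moreover have "qpoch w q = (1 - w) * qpoch (q * w) q"
    using qpoch_rec[OF assms(1), of w] by (simp add: mult.commute)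
  ultimately have *: "theta (1 / w) q = qpoch (q * w) q * ((1 - 1 / w) * qpoch (q / w) q)"
    "theta w q = (1 - w) * qpoch (q * w) q * qpoch (q / w) q"
    using assms by (simp_all add: theta_def)
  show ?thesis unfolding * using assms by (simp add: field_simps)
qed

text \<open>The factor \<open>qpoch w q\<close> accounts for the exponents \<open>n \<le> 0\<close>,
  the factor \<open>qpoch (q / w) q\<close> for \<open>n > 0\<close>.\<close>

lemma theta_eq_0_iff:
  assumes "norm q < 1" "q \<noteq> 0" "w \<noteq> 0"
  shows "theta w q = 0 \<longleftrightarrow> (\<exists>n::int. w = q powi n)"
proof -
  have "(\<exists>n::nat. w * q ^ n = 1) \<longleftrightarrow> (\<exists>n::int. n \<le> 0 \<and> w = q powi n)"
  proof safe
    fix n :: nat assume "w * q ^ n = 1"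
    thus "\<exists>n::int. n \<le> 0 \<and> w = q powi n"
      using assms by (intro exI[of _ "- int n"]) (auto simp: power_int_minus field_simps)
  next
    fix n :: int assume "n \<le> 0" "w = q powi n"
    thus "\<exists>na. q powi n * q ^ na = 1"
      using assms by (intro exI[of _ "nat (-n)"]) (auto simp: power_int_def field_simps)
  qed
  moreover have "(\<exists>n::nat. q / w * q ^ n = 1) \<longleftrightarrow> (\<exists>n::int. n > 0 \<and> w = q powi n)"
  proof safe
    fix n :: nat assume *: "q / w * q ^ n = 1"
    have "w = q powi (int (Suc n))" using * assms by (simp add: field_simps del: of_nat_Suc)
    thus "\<exists>n::int. n > 0 \<and> w = q powi n" by (metis of_nat_0_less_iff zero_less_Suc)
  next
    fix n :: int assume n: "n > 0" "w = q powi n"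
    have "q powi n = q ^ Suc (nat (n - 1))" using n by (simp add: power_int_def Suc_nat_eq_nat_zadd1)
    thus "\<exists>na. q / q powi n * q ^ na = 1"
      using assms by (intro exI[of _ "nat (n - 1)"]) auto
  qed
  ultimately have "theta w q = 0 \<longleftrightarrow> (\<exists>n::int. n \<le> 0 \<and> w = q powi n) \<or> (\<exists>n::int. n > 0 \<and> w = q powi n)"
    using assms by (simp add: theta_def qpoch_eq_0_iff)
  thus ?thesis by (metis not_le)
qed

section \<open>The theta function in the additive variable, and its inversion formula\<close>

definition ee :: "complex \<Rightarrow> complex" where "ee z = exp (2 * pi * \<i> * z)"

lemma ee_0 [simp]: "ee 0 = 1" by (simp add: ee_def)
lemma ee_nonzero [simp]: "ee z \<noteq> 0" by (simp add: ee_def)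
lemma ee_add: "ee (a + b) = ee a * ee b" by (simp add: ee_def exp_add ring_distribs)
lemma ee_diff: "ee (a - b) = ee a / ee b" by (simp add: ee_def exp_diff ring_distribs)
lemma ee_minus: "ee (- a) = 1 / ee a" using ee_diff[of 0 a] by simp
lemma norm_ee: "norm (ee z) = exp (- (2 * pi * Im z))" by (simp add: ee_def)
lemma ee_of_int [simp]: "ee (of_int n) = 1"
  using exp_integer_2pi[of "of_int n"] by (simp add: ee_def mult_ac)
lemma ee_1 [simp]: "ee 1 = 1" using ee_of_int[of 1] by simp
lemma ee_numeral [simp]: "ee (numeral n) = 1" using ee_of_int[of "numeral n"] by simp
lemma ee_half: "ee (1/2) = -1" by (simp add: ee_def mult.commute)
lemma ee_power: "ee z ^ n = ee (of_nat n * z)"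
  by (simp add: ee_def exp_of_nat_mult[symmetric] mult_ac)
lemma ee_powi: "ee z powi n = ee (of_int n * z)"
proof (cases "n \<ge> 0")
  case True
  thus ?thesis by (simp add: power_int_def ee_power)
next
  case False
  hence "of_int n * z = - (of_nat (nat (-n)) * z)" by (simp add: of_nat_nat)
  thus ?thesis using False by (simp only: ee_minus) (simp add: power_int_def ee_power field_simps)
qed
lemma ee_eq_1_iff: "ee z = 1 \<longleftrightarrow> (\<exists>n::int. z = of_int n)"
  unfolding ee_def exp_eq_1 by (auto simp: complex_eq_iff)
lemma ee_eq_iff: "ee z = ee w \<longleftrightarrow> (\<exists>n::int. z = w + of_int n)"
  using ee_eq_1_iff[of "z - w"] by (auto simp: ee_diff algebra_simps)
lemma norm_ee_lt_1: "Im z > 0 \<Longrightarrow> norm (ee z) < 1" by (simp add: norm_ee)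
lemma holomorphic_on_ee [holomorphic_intros]: "f holomorphic_on A \<Longrightarrow> (\<lambda>z. ee (f z)) holomorphic_on A"
  unfolding ee_def by (intro holomorphic_intros)
text \<open>Jacobi's theta_1 up to a factor depending only on \<open>\<tau>\<close>. The factor
  \<open>ee (- z / 2)\<close> makes it odd in \<open>z\<close>, at the cost of a sign under
  \<open>z + 1\<close>.\<close>

definition jtheta :: "complex \<Rightarrow> complex \<Rightarrow> complex" where
  "jtheta \<tau> z = ee (- z / 2) * theta (ee z) (ee \<tau>)"

context
  fixes \<tau> :: complex assumes tau: "Im \<tau> > 0"
begin

lemma jtheta_add_1: "jtheta \<tau> (z + 1) = - jtheta \<tau> z"
proof -
  have "ee (- (z + 1) / 2) = ee (- z / 2) * ee (- (1/2))"
    unfolding ee_add[symmetric] by (simp add: field_simps)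
  also have "ee (- (1/2)) = -1" by (simp add: ee_minus ee_half)
  finally show ?thesis by (simp add: jtheta_def ee_add)
qed

lemma jtheta_add_tau: "jtheta \<tau> (z + \<tau>) = - ee (- \<tau> / 2 - z) * jtheta \<tau> z"
proof -
  have "theta (ee (z + \<tau>)) (ee \<tau>) = - theta (ee z) (ee \<tau>) / ee z"
    using theta_mult_q[of "ee \<tau>" "ee z"] norm_ee_lt_1[OF tau] by (simp add: ee_add mult.commute)
  moreover have "ee (- (z + \<tau>) / 2) = ee (- z / 2) * ee (- \<tau> / 2)"
    unfolding ee_add[symmetric] by (simp add: field_simps)
  ultimately show ?thesis by (simp add: jtheta_def ee_diff)
qed

lemma jtheta_eq_0_iff: "jtheta \<tau> z = 0 \<longleftrightarrow> (\<exists>m n :: int. z = of_int m + of_int n * \<tau>)"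
  unfolding jtheta_def using norm_ee_lt_1[OF tau]
  by (auto simp: theta_eq_0_iff ee_powi ee_eq_iff) (metis add.commute)+

lemma jtheta_holomorphic: "jtheta \<tau> holomorphic_on UNIV"
  unfolding jtheta_def theta_def using norm_ee_lt_1[OF tau]
  by (intro holomorphic_intros holomorphic_on_qpoch) auto

text \<open>Isolates the simple zero at \<open>z = 0\<close>: the remaining product does not vanish
  there, so the limit of a quotient of two such functions at 0 can be read off.\<close>

lemma jtheta_factor: "jtheta \<tau> z = ee (- z / 2) * (1 - ee z) * (qpoch (ee \<tau> * ee z) (ee \<tau>) * qpoch (ee \<tau> / ee z) (ee \<tau>))"
  using qpoch_rec[OF norm_ee_lt_1[OF tau], of "ee z"] by (simp add: jtheta_def theta_def mult_ac)

end

text \<open>Both sides have the same quasi-periods and the same simple zeros in \<open>z\<close>, so that their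
  quotient extends to a bounded entire function.\<close>

lemma jtheta_inversion:
  assumes tau: "Im \<tau> > 0"
  obtains k where "k \<noteq> 0" "\<And>z. jtheta (- 1 / \<tau>) (z / \<tau>) = k * ee (z\<^sup>2 / (2 * \<tau>)) * jtheta \<tau> z"
proof -
  have tau0: "\<tau> \<noteq> 0" using tau by auto
  define \<sigma> where "\<sigma> = - 1 / \<tau>"
  have sigma: "Im \<sigma> > 0" using tau tau0 by (simp add: \<sigma>_def Im_divide complex_neq_0 power2_eq_square)
  \<comment> \<open>The Gaussian factor is chosen so that \<open>G\<close> has the same multipliers
    as \<open>g\<close> under both periods.\<close>
  define G where "G = (\<lambda>z. ee (- z\<^sup>2 / (2 * \<tau>)) * jtheta \<sigma> (z / \<tau>))"
  define g where "g = jtheta \<tau>"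
  define lat where "lat = {z. g z = 0}"
  have lat_eq: "lat = {z. \<exists>m n :: int. z = of_int m + of_int n * \<tau>}"
    by (auto simp: lat_def g_def jtheta_eq_0_iff[OF tau])
  have G_hol: "G holomorphic_on UNIV"
  proof -
    have "(jtheta \<sigma> \<circ> (\<lambda>z. z / \<tau>)) holomorphic_on UNIV"
      by (intro holomorphic_on_compose_gen[OF _ jtheta_holomorphic[OF sigma]] holomorphic_intros) (use tau0 in auto)
    thus ?thesis unfolding G_def o_def using tau0 by (intro holomorphic_intros) auto
  qed
  have g_hol: "g holomorphic_on UNIV" unfolding g_def by (rule jtheta_holomorphic[OF tau])
  have g1: "g (z + 1) = - g z" for z unfolding g_def by (rule jtheta_add_1[OF tau])
  have gt: "g (z + \<tau>) = - ee (- \<tau> / 2 - z) * g z" for z unfolding g_def by (rule jtheta_add_tau[OF tau])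
  have G0: "G z = 0 \<longleftrightarrow> z \<in> lat" for z
  proof
    assume "G z = 0"
    then obtain m n :: int where "z / \<tau> = of_int m + of_int n * \<sigma>"
      by (auto simp: G_def jtheta_eq_0_iff[OF sigma])
    hence "z = of_int (- n) + of_int m * \<tau>" using tau0 by (simp add: \<sigma>_def field_simps)
    thus "z \<in> lat" unfolding lat_eq by blast
  next
    assume "z \<in> lat"
    then obtain m n :: int where "z = of_int m + of_int n * \<tau>" unfolding lat_eq by blast
    hence "z / \<tau> = of_int n + of_int (- m) * \<sigma>" using tau0 by (simp add: \<sigma>_def field_simps)
    thus "G z = 0" by (auto simp: G_def jtheta_eq_0_iff[OF sigma] simp del: of_int_minus)
  qed
  have Gt: "G (z + \<tau>) = - ee (- \<tau> / 2 - z) * G z" for z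
  proof -
    have "jtheta \<sigma> ((z + \<tau>) / \<tau>) = - jtheta \<sigma> (z / \<tau>)"
      using jtheta_add_1[OF sigma, of "z / \<tau>"] tau0 by (simp add: add_divide_distrib)
    moreover have "ee (- (z + \<tau>)\<^sup>2 / (2 * \<tau>)) = ee (- z\<^sup>2 / (2 * \<tau>)) * ee (- \<tau> / 2 - z)"
      unfolding ee_add[symmetric] using tau0 by (intro arg_cong[of _ _ ee]) (simp add: field_simps power2_eq_square)
    ultimately show ?thesis by (simp add: G_def)
  qed
  have G1: "G (z + 1) = - G z" for z
  proof -
    have *: "(z + 1) / \<tau> + \<sigma> = z / \<tau>" by (simp add: \<sigma>_def add_divide_distrib)
    have "jtheta \<sigma> (z / \<tau>) = - ee (- \<sigma> / 2 - (z + 1) / \<tau>) * jtheta \<sigma> ((z + 1) / \<tau>)"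
      using jtheta_add_tau[OF sigma, of "(z + 1) / \<tau>"] unfolding * .
    moreover have "ee (- z\<^sup>2 / (2 * \<tau>)) * ee (- \<sigma> / 2 - (z + 1) / \<tau>) = ee (- (z + 1)\<^sup>2 / (2 * \<tau>))"
      unfolding ee_add[symmetric] \<sigma>_def using tau0 by (intro arg_cong[of _ _ ee]) (simp add: field_simps power2_eq_square)
    ultimately show ?thesis by (simp add: G_def mult_ac)
  qed
  define h where "h = (\<lambda>z. G z / g z)"
  have h1: "h (z + 1) = h z" and ht: "h (z + \<tau>) = h z" for z
    by (simp_all add: h_def g1 gt G1 Gt)
  have hm: "h (z + of_int m) = h z" for z and m :: int
  proof (induction m rule: int_induct[of _ 0])
    case (step1 i) thus ?case using h1[of "z + of_int i"] by (simp add: add_ac)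
  next
    case (step2 i) thus ?case using h1[of "z + of_int (i - 1)"] by (simp add: add_ac)
  qed auto
  have hn: "h (z + of_int n * \<tau>) = h z" for z and n :: int
  proof (induction n rule: int_induct[of _ 0])
    case (step1 i) thus ?case using ht[of "z + of_int i * \<tau>"] by (simp add: algebra_simps)
  next
    case (step2 i) thus ?case using ht[of "z + of_int (i - 1) * \<tau>"] by (simp add: algebra_simps)
  qed auto
  have h_per: "h (z + w) = h z" if "w \<in> lat" for z w
    using that hm hn unfolding lat_eq by (auto simp: add.assoc[symmetric])
  have lat_add: "z + w \<in> lat \<longleftrightarrow> z \<in> lat" if "w \<in> lat" for z w
  proof -
    have "u + v \<in> lat" if "u \<in> lat" "v \<in> lat" for u v
    proof -
      from that obtain m n m' n' :: int where "u = of_int m + of_int n * \<tau>" "v = of_int m' + of_int n' * \<tau>"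
        unfolding lat_eq by blast
      hence "u + v = of_int (m + m') + of_int (n + n') * \<tau>" by (simp add: algebra_simps)
      thus ?thesis unfolding lat_eq by blast
    qed note add = this
    have "- u \<in> lat" if "u \<in> lat" for u
    proof -
      from that obtain m n :: int where "u = of_int m + of_int n * \<tau>" unfolding lat_eq by blast
      hence "- u = of_int (- m) + of_int (- n) * \<tau>" by simp
      thus ?thesis unfolding lat_eq by blast
    qed
    from add[of "z + w" "- w"] add[of z w] this[of w] that show ?thesis by auto
  qed
  define g' where "g' = (\<lambda>z. qpoch (ee \<tau> * ee z) (ee \<tau>) * qpoch (ee \<tau> / ee z) (ee \<tau>))"
  define G' where "G' = (\<lambda>z. qpoch (ee \<sigma> * ee (z/\<tau>)) (ee \<sigma>) * qpoch (ee \<sigma> / ee (z/\<tau>)) (ee \<sigma>))"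
  have g'_hol: "g' holomorphic_on UNIV" unfolding g'_def
    by (intro holomorphic_intros holomorphic_on_qpoch) (use norm_ee_lt_1[OF tau] in auto)
  have G'_hol: "G' holomorphic_on UNIV" unfolding G'_def
    by (intro holomorphic_intros holomorphic_on_qpoch) (use norm_ee_lt_1[OF sigma] tau0 in auto)
  have g'0: "g' 0 \<noteq> 0"
  proof -
    have "ee \<tau> * ee \<tau> ^ n \<noteq> 1" for n
      using norm_ee_lt_1[OF tau] by (metis norm_one norm_power power_Suc power_less_one_iff less_irrefl norm_ge_zero zero_less_Suc)
    thus ?thesis using norm_ee_lt_1[OF tau] by (simp add: g'_def qpoch_eq_0_iff)
  qed
  \<comment> \<open>Both simple zeros, divided by \<open>z\<close>, become difference quotients at
    0.\<close>
  have lim_quot: "((\<lambda>z. (1 - ee (z / \<tau>)) / (1 - ee z)) \<longlongrightarrow> 1 / \<tau>) (at 0)"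
  proof -
    have d: "((\<lambda>z. 1 - ee (z * c)) has_field_derivative (- (2 * pi * \<i> * c))) (at 0)" for c
      unfolding ee_def by (auto intro!: derivative_eq_intros)
    have "((\<lambda>z. ((1 - ee (z * (1 / \<tau>))) / z) / ((1 - ee (z * 1)) / z)) \<longlongrightarrow>
        (- (2 * pi * \<i> * (1 / \<tau>))) / (- (2 * pi * \<i> * 1))) (at 0)"
      using d[of "1/\<tau>"] d[of 1] by (intro tendsto_divide) (simp_all add: has_field_derivative_iff)
    moreover have "eventually (\<lambda>z. ((1 - ee (z * (1 / \<tau>))) / z) / ((1 - ee (z * 1)) / z) = 
         (1 - ee (z / \<tau>)) / (1 - ee z)) (at (0::complex))"
      by (auto simp: eventually_at_filter)
    ultimately have "((\<lambda>z. (1 - ee (z / \<tau>)) / (1 - ee z)) \<longlongrightarrow> (- (2 * pi * \<i> * (1 / \<tau>))) / (- (2 * pi * \<i> * 1))) (at 0)"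
      by (rule Lim_transform_eventually)
    thus ?thesis by simp
  qed
  define l where "l = 1 / \<tau> * (G' 0 / g' 0)"
  have h_eq: "h z = (1 - ee (z / \<tau>)) / (1 - ee z) * 
      (ee (- z\<^sup>2 / (2 * \<tau>)) * ee (- (z / \<tau>) / 2) * G' z / (ee (- z / 2) * g' z))" for z
    unfolding h_def G_def g_def jtheta_factor[OF tau] jtheta_factor[OF sigma] g'_def G'_def
    by (simp add: mult_ac)
  have "isCont g' 0" "isCont G' 0"
    using g'_hol G'_hol by (metis UNIV_I continuous_on_eq_continuous_at holomorphic_on_imp_continuous_on open_UNIV)+
  hence hlim: "(h \<longlongrightarrow> l) (at 0)"
    unfolding h_eq l_def using g'0 tau0 
    by (intro tendsto_mult lim_quot) (auto intro!: tendsto_eq_intros simp: isCont_def ee_def)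
  \<comment> \<open>At lattice points \<open>h\<close> is 0 by division by zero; \<open>H\<close>
    takes the limit there instead.\<close>
  define H where "H = (\<lambda>z. if z \<in> lat then l else h z)"
  have H_per: "H (z + w) = H z" if "w \<in> lat" for z w
    using h_per[OF that] lat_add[OF that] by (simp add: H_def)
  have open_nlat: "open (- lat)"
  proof -
    have "closed (g -` {0})"
      using holomorphic_on_imp_continuous_on[OF g_hol] by (intro closed_vimage) (auto simp: continuous_on_eq_continuous_within)
    thus ?thesis by (auto simp: lat_def vimage_def closed_def)
  qed
  have H_hol1: "H holomorphic_on (- lat)"
  proof -
    have "h holomorphic_on (- lat)" unfolding h_def
      by (intro holomorphic_intros holomorphic_on_subset[OF G_hol] holomorphic_on_subset[OF g_hol]) (auto simp: lat_def)
    thus ?thesis by (rule holomorphic_transform) (auto simp: H_def)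
  qed
  have "0 \<in> lat" unfolding lat_eq by (auto intro!: exI[of _ 0])
  have ev: "eventually (\<lambda>z. z \<notin> lat) (at 0)"
  proof -
    have "eventually (\<lambda>z. g' z \<noteq> 0) (at 0)"
      using \<open>isCont g' 0\<close> g'0 by (metis isCont_def tendsto_imp_eventually_ne)
    moreover have "eventually (\<lambda>z. (1 - ee (z * 1)) / z \<noteq> 0) (at (0::complex))"
    proof (rule tendsto_imp_eventually_ne)
      have "((\<lambda>z. 1 - ee (z * 1)) has_field_derivative (- (2 * pi * \<i>))) (at 0)"
        unfolding ee_def by (auto intro!: derivative_eq_intros)
      thus "((\<lambda>z. (1 - ee (z * 1)) / z) \<longlongrightarrow> - (2 * pi * \<i>)) (at 0)"
        by (simp add: has_field_derivative_iff)
    qed auto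
    ultimately show ?thesis
      by eventually_elim (auto simp: lat_def g_def jtheta_factor[OF tau] g'_def)
  qed
  then obtain r where r: "r > 0" "\<And>z. z \<in> ball 0 r \<Longrightarrow> z \<noteq> 0 \<Longrightarrow> z \<notin> lat"
    by (auto simp: eventually_at dist_commute)
  have H_hol0: "H holomorphic_on ball 0 r"
  proof (rule no_isolated_singularity')
    show "(H \<longlongrightarrow> H z) (at z within ball 0 r)" if "z \<in> {0}" for z
    proof -
      have "(H \<longlongrightarrow> l) (at 0)"
        by (rule Lim_transform_eventually[OF hlim]) (use ev in eventually_elim, auto simp: H_def)
      thus ?thesis using that \<open>0 \<in> lat\<close> by (auto simp: H_def intro: tendsto_within_subset)
    qed
    show "H holomorphic_on ball 0 r - {0}"
      by (rule holomorphic_on_subset[OF H_hol1]) (use r(2) in auto)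
  qed auto
  have "H field_differentiable at z" for z
  proof (cases "z \<in> lat")
    case False
    thus ?thesis using H_hol1 open_nlat by (auto simp: holomorphic_on_open field_differentiable_def)
  next
    case True
    \<comment> \<open>Periodicity carries the removable singularity at 0 to every lattice
      point.\<close>
    have "(H \<circ> (\<lambda>w. w - z)) holomorphic_on ball z r"
      by (intro holomorphic_on_compose_gen[OF _ H_hol0] holomorphic_intros) (auto simp: dist_norm norm_minus_commute)
    moreover have "(H \<circ> (\<lambda>w. w - z)) w = H w" for w
      using H_per[OF True, of "w - z"] by simp
    ultimately have "H holomorphic_on ball z r" by (simp add: o_def)
    thus ?thesis using r(1) by (auto simp: holomorphic_on_open field_differentiable_def)
  qed
  hence H_hol: "H holomorphic_on UNIV" by (auto simp: holomorphic_on_def intro: field_differentiable_at_within)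
  have "bounded (range H)"
  proof -
    have "compact ((\<lambda>p. of_real (fst p) + of_real (snd p) * \<tau>) ` ({0..1} \<times> {0..1::real}))"
      by (intro compact_continuous_image compact_Times continuous_intros) auto
    hence "compact (H ` (\<lambda>p. of_real (fst p) + of_real (snd p) * \<tau>) ` ({0..1} \<times> {0..1::real}))"
      by (rule compact_continuous_image[OF holomorphic_on_imp_continuous_on[OF holomorphic_on_subset[OF H_hol subset_UNIV]]])
    moreover have "range H \<subseteq> H ` (\<lambda>p. of_real (fst p) + of_real (snd p) * \<tau>) ` ({0..1} \<times> {0..1::real})"
    proof safe
      fix z :: complex
      define t where "t = Im z / Im \<tau>"
      define s where "s = Re z - t * Re \<tau>"
      have z: "z = of_real s + of_real t * \<tau>" using tau by (simp add: complex_eq_iff s_def t_def)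
      have "H z = H ((of_real (frac s) + of_real (frac t) * \<tau>) + (of_int \<lfloor>s\<rfloor> + of_int \<lfloor>t\<rfloor> * \<tau>))"
        by (simp add: z frac_def algebra_simps)
      also have "\<dots> = H (of_real (frac s) + of_real (frac t) * \<tau>)"
        by (rule H_per) (unfold lat_eq, blast)
      finally show "H z \<in> H ` (\<lambda>p. of_real (fst p) + of_real (snd p) * \<tau>) ` ({0..1} \<times> {0..1::real})"
        by (intro image_eqI[where x = "of_real (frac s) + of_real (frac t) * \<tau>"] image_eqI[where x = "(frac s, frac t)"])
           (auto intro: less_imp_le[OF frac_lt_1])
    qed
    ultimately show ?thesis using compact_imp_bounded bounded_subset by blast
  qed
  with H_hol have "H constant_on UNIV" by (rule Liouville_theorem)
  then obtain k where k: "\<And>z. H z = k" by (auto simp: constant_on_def)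
  have Gk: "G z = k * g z" for z
  proof (cases "z \<in> lat")
    case True thus ?thesis using G0[of z] by (simp add: lat_def)
  next
    case False thus ?thesis using k[of z] by (simp add: H_def h_def lat_def field_simps)
  qed
  obtain z0 where "z0 \<notin> lat"
    using r(2)[of "of_real (r / 2)"] r(1) by (auto simp: dist_norm norm_divide)
  hence "k \<noteq> 0" using Gk[of z0] G0[of z0] by auto
  moreover have "jtheta (- 1 / \<tau>) (z / \<tau>) = k * ee (z\<^sup>2 / (2 * \<tau>)) * jtheta \<tau> z" for z
  proof -
    have "jtheta \<sigma> (z / \<tau>) = ee (z\<^sup>2 / (2 * \<tau>)) * G z"
      by (simp add: G_def mult.assoc[symmetric] ee_add[symmetric])
    thus ?thesis by (simp add: Gk g_def \<sigma>_def)
  qed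
  ultimately show ?thesis using that by blast
qed

lemma ee_cong: "x = y + of_int k \<Longrightarrow> ee x = ee y"
  by (auto simp: ee_eq_iff)

lemma ee_sum: "(\<Prod>s\<in>A. ee (f s)) = ee (\<Sum>s\<in>A. f s)"
  by (induction A rule: infinite_finite_induct) (simp_all add: ee_add)

lemma jtheta_shift:
  assumes tau: "Im \<tau> > 0"
  shows "jtheta \<tau> (z + of_int l + of_int j * \<tau>) =
    ee ((of_int l + of_int j) / 2 - (of_int j)\<^sup>2 * \<tau> / 2 - of_int j * z) * jtheta \<tau> z"
proof -
  have 1: "jtheta \<tau> (z + of_int l) = ee (of_int l / 2) * jtheta \<tau> z" for l
  proof (induction l rule: int_induct[of _ 0])
    case (step1 i)
    have "ee (of_int (i + 1) / 2) = - ee (of_int i / 2)"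
      using ee_add[of "of_int i / 2" "1/2"] by (simp add: ee_half add_divide_distrib)
    thus ?case using step1 jtheta_add_1[OF tau, of "z + of_int i"] by (simp add: add_ac)
  next
    case (step2 i)
    have "ee (of_int i / 2) = - ee (of_int (i - 1) / 2)"
      using ee_add[of "of_int (i - 1) / 2" "1/2"] by (simp add: ee_half diff_divide_distrib)
    thus ?case using step2 jtheta_add_1[OF tau, of "z + of_int (i - 1)"] by (simp add: add_ac)
  qed auto
  have step: "jtheta \<tau> (w + of_int (i + 1) * \<tau>) = ee (1/2 - \<tau>/2 - w - of_int i * \<tau>) * jtheta \<tau> (w + of_int i * \<tau>)" for i w
  proof -
    have "ee (1/2 - \<tau>/2 - w - of_int i * \<tau>) = ee (1/2 + (- \<tau> / 2 - (w + of_int i * \<tau>)))"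
      by (simp add: algebra_simps)
    also have "\<dots> = - ee (- \<tau> / 2 - (w + of_int i * \<tau>))" by (simp only: ee_add ee_half) simp
    finally show ?thesis using jtheta_add_tau[OF tau, of "w + of_int i * \<tau>"] by (simp add: algebra_simps)
  qed
  have 2: "jtheta \<tau> (w + of_int j * \<tau>) = ee (of_int j / 2 - (of_int j)\<^sup>2 * \<tau> / 2 - of_int j * w) * jtheta \<tau> w" for j w
  proof (induction j rule: int_induct[of _ 0])
    case (step1 i)
    have "jtheta \<tau> (w + of_int (i + 1) * \<tau>) = 
      (ee (1/2 - \<tau>/2 - w - of_int i * \<tau>) * ee (of_int i / 2 - (of_int i)\<^sup>2 * \<tau> / 2 - of_int i * w)) * jtheta \<tau> w"
      unfolding step step1 by simp
    also have "ee (1/2 - \<tau>/2 - w - of_int i * \<tau>) * ee (of_int i / 2 - (of_int i)\<^sup>2 * \<tau> / 2 - of_int i * w) =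
       ee (of_int (i + 1) / 2 - (of_int (i + 1))\<^sup>2 * \<tau> / 2 - of_int (i + 1) * w)"
      unfolding ee_add[symmetric] by (intro arg_cong[of _ _ ee]) (simp add: field_simps power2_eq_square)
    finally show ?case .
  next
    case (step2 i)
    have "ee (1/2 - \<tau>/2 - w - of_int (i - 1) * \<tau>) * jtheta \<tau> (w + of_int (i - 1) * \<tau>) = 
       ee (of_int i / 2 - (of_int i)\<^sup>2 * \<tau> / 2 - of_int i * w) * jtheta \<tau> w"
      using step[of w "i - 1"] step2 by simp
    also have "ee (of_int i / 2 - (of_int i)\<^sup>2 * \<tau> / 2 - of_int i * w) =
       ee (1/2 - \<tau>/2 - w - of_int (i - 1) * \<tau>) * ee (of_int (i - 1) / 2 - (of_int (i - 1))\<^sup>2 * \<tau> / 2 - of_int (i - 1) * w)"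
      unfolding ee_add[symmetric] by (intro arg_cong[of _ _ ee]) (simp add: field_simps power2_eq_square)
    finally show ?case by simp
  qed auto
  have "ee (of_int j / 2 - (of_int j)\<^sup>2 * \<tau> / 2 - of_int j * (z + of_int l)) * ee (of_int l / 2) = 
    ee ((of_int l + of_int j) / 2 - (of_int j)\<^sup>2 * \<tau> / 2 - of_int j * z)"
    \<comment> \<open>The cross term of the two shifts is the integer \<open>- (j * l)\<close> and
      disappears.\<close>
    unfolding ee_add[symmetric] by (rule ee_cong[of _ _ "- (j * l)"]) (simp add: field_simps)
  thus ?thesis unfolding 2 1 by (simp add: mult.assoc[symmetric])
qed

lemma jtheta_minus:
  assumes "Im \<tau> > 0"
  shows "jtheta \<tau> (- z) = - jtheta \<tau> z"
proof -
  have "ee z = ee (z / 2) * ee (z / 2)" unfolding ee_add[symmetric] by simp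
  thus ?thesis using theta_inverse[OF norm_ee_lt_1[OF assms], of "ee z"]
    by (simp add: jtheta_def ee_minus)
qed

section \<open>Klein forms at 34-division points\<close>

text \<open>A Klein form up to a factor that depends only on \<open>\<tau>\<close>. This factor is chosen so that \<open>\<tau> + 1\<close>
  produces no root of unity; under \<open>- 1 / \<tau>\<close> it contributes the same unknown constant to all of them.\<close>

definition klein :: "real \<Rightarrow> real \<Rightarrow> complex \<Rightarrow> complex" where
  "klein a b \<tau> = ee (of_real a * (of_real a * \<tau> + of_real b) / 2) * jtheta \<tau> (of_real a * \<tau> + of_real b)"

lemma klein_T: "klein a b (\<tau> + 1) = klein a (a + b) \<tau>"
  by (simp add: klein_def jtheta_def ee_add algebra_simps)

lemma klein_S:
  assumes tau: "Im \<tau> > 0"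
  obtains k where "k \<noteq> 0" "\<And>a b. klein a b (- 1 / \<tau>) = k * klein b (- a) \<tau>"
proof -
  have tau0: "\<tau> \<noteq> 0" using tau by auto
  obtain k where k: "k \<noteq> 0" "\<And>z. jtheta (- 1 / \<tau>) (z / \<tau>) = k * ee (z\<^sup>2 / (2 * \<tau>)) * jtheta \<tau> z"
    using jtheta_inversion[OF tau] by metis
  have "klein a b (- 1 / \<tau>) = k * klein b (- a) \<tau>" for a b
  proof -
    define z where "z = of_real b * \<tau> + of_real (- a)"
    have z: "of_real a * (- 1 / \<tau>) + of_real b = z / \<tau>" using tau0 by (simp add: z_def field_simps)
    \<comment> \<open>As \<open>z = b * \<tau> - a\<close>, the exponents add up to
      \<open>z * (a + z) / (2 * \<tau>) = b * z / 2\<close>.\<close>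
    have "ee (of_real a * (z / \<tau>) / 2) * ee (z\<^sup>2 / (2 * \<tau>)) = ee (of_real b * z / 2)"
      unfolding ee_add[symmetric] z_def using tau0 by (intro arg_cong[of _ _ ee]) (simp add: field_simps power2_eq_square)
    thus ?thesis unfolding klein_def z k(2) unfolding z_def[symmetric] by (simp add: mult_ac)
  qed
  with k(1) show ?thesis using that by blast
qed

lemma klein_minus: "Im \<tau> > 0 \<Longrightarrow> klein (- a) (- b) \<tau> = - klein a b \<tau>"
  using jtheta_minus[of \<tau> "of_real a * \<tau> + of_real b"] by (simp add: klein_def algebra_simps)

text \<open>The exponential prefactor of \<open>klein\<close> absorbs the part of the multiplier of
  \<open>jtheta\<close> that depends on \<open>\<tau>\<close>; what remains has absolute value
  1.\<close>

lemma klein_shift: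
  assumes tau: "Im \<tau> > 0"
  shows "klein (a + of_int j) (b + of_int l) \<tau> = 
     ee (of_real (of_int (j + l + j * l) + of_int l * a - of_int j * b) / 2) * klein a b \<tau>"
proof -
  define z where "z = of_real a * \<tau> + of_real b"
  have *: "of_real (a + of_int j) * \<tau> + of_real (b + of_int l) = z + of_int l + of_int j * \<tau>"
    by (simp add: z_def algebra_simps)
  have "ee (of_real (a + of_int j) * (z + of_int l + of_int j * \<tau>) / 2) *
    ee ((of_int l + of_int j) / 2 - (of_int j)\<^sup>2 * \<tau> / 2 - of_int j * z) =
    ee (of_real (of_int (j + l + j * l) + of_int l * a - of_int j * b) / 2) * ee (of_real a * z / 2)"
    unfolding ee_add[symmetric] z_def by (intro arg_cong[of _ _ ee]) (simp add: field_simps power2_eq_square)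
  thus ?thesis unfolding klein_def * jtheta_shift[OF tau]
    unfolding z_def[symmetric] by (simp add: mult.assoc[symmetric])
qed

lemma klein_eq_0_iff:
  assumes tau: "Im \<tau> > 0"
  shows "klein a b \<tau> = 0 \<longleftrightarrow> a \<in> \<int> \<and> b \<in> \<int>"
proof -
  have "of_real a * \<tau> + of_real b = of_int m + of_int n * \<tau> \<longleftrightarrow> a = of_int n \<and> b = of_int m" for m n :: int
    using tau by (auto simp: complex_eq_iff)
  thus ?thesis by (auto simp: klein_def jtheta_eq_0_iff[OF tau] Ints_def)
qed

lemma klein_holomorphic: "klein a b holomorphic_on {\<tau>. Im \<tau> > 0}"
  unfolding klein_def jtheta_def theta_def
  by (intro holomorphic_intros holomorphic_on_qpoch) (auto simp: open_halfspace_Im_gt norm_ee_lt_1)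

definition klein34 :: "int \<Rightarrow> int \<Rightarrow> int \<Rightarrow> complex \<Rightarrow> complex" where
  "klein34 s m n = klein (of_int (s * m) / 34) (of_int (s * n) / 34)"

text \<open>The numerator runs over the odd nonresidues modulo 17 below 17, the denominator over the residues.
  Since the squares of the elements of the two sets differ in sum by \<open>18 * 34\<close>, the quotient
  depends only on \<open>m\<close> and \<open>n\<close> modulo 34.\<close>

definition num_set :: "int set" where "num_set = {3, 5, 7, 11}"
definition den_set :: "int set" where "den_set = {1, 9, 13, 15, 2, 4, 8, 16}"

definition kquot :: "int \<Rightarrow> int \<Rightarrow> complex \<Rightarrow> complex" where
  "kquot m n \<tau> = (\<Prod>s\<in>num_set. klein34 s m n \<tau>) / (\<Prod>s\<in>den_set. klein34 s m n \<tau>)"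

lemma klein34_T: "klein34 s m n (\<tau> + 1) = klein34 s m (m + n) \<tau>"
  unfolding klein34_def klein_T by (simp add: add_divide_distrib ring_distribs)

lemma kquot_T: "kquot m n (\<tau> + 1) = kquot m (m + n) \<tau>"
  by (simp add: kquot_def klein34_T)

lemma kquot_T_int: "kquot m n (\<tau> + of_int k) = kquot m (n + k * m) \<tau>"
proof (induction k arbitrary: n rule: int_induct[of _ 0])
  case (step1 i)
  show ?case using step1(2)[of "m + n"] kquot_T[of m n "\<tau> + of_int i"] by (simp add: algebra_simps)
next
  case (step2 i)
  show ?case using step2(2)[of "n - m"] kquot_T[of m "n - m" "\<tau> + of_int (i - 1)"] by (simp add: algebra_simps)
qed auto

lemma klein34_S:
  assumes "\<And>a b. klein a b (- 1 / \<tau>) = k * klein b (- a) \<tau>"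
  shows "klein34 s m n (- 1 / \<tau>) = k * klein34 s n (- m) \<tau>"
  using assms by (simp add: klein34_def)

text \<open>Four Klein forms above stand against eight below, each contributing one factor
  \<open>k\<close>.\<close>

lemma kquot_S:
  assumes "k \<noteq> 0" "\<And>a b. klein a b (- 1 / \<tau>) = k * klein b (- a) \<tau>"
  shows "kquot m n (- 1 / \<tau>) = kquot n (- m) \<tau> / k ^ 4"
  unfolding kquot_def klein34_S[OF assms(2)] using assms(1) 
  by (simp add: num_set_def den_set_def field_simps power_numeral_reduce)

lemma klein34_minus: "Im \<tau> > 0 \<Longrightarrow> klein34 (- s) m n \<tau> = - klein34 s m n \<tau>"
  using klein_minus[of \<tau> "of_int (s * m) / 34" "of_int (s * n) / 34"] by (simp add: klein34_def)

lemma kquot_minus: "Im \<tau> > 0 \<Longrightarrow> kquot (- m) (- n) \<tau> = kquot m n \<tau>"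
  using klein34_minus[of \<tau> _ m n] by (simp add: kquot_def num_set_def den_set_def klein34_def)

lemma klein34_period:
  assumes "Im \<tau> > 0"
  shows "klein34 s (m + 34) n \<tau> = ee (of_int s / 2 - of_int (s * s * n) / 68) * klein34 s m n \<tau>"
    and "klein34 s m (n + 34) \<tau> = ee (of_int s / 2 + of_int (s * s * m) / 68) * klein34 s m n \<tau>"
proof -
  have *: "of_int (s * (m + 34)) / 34 = of_int (s * m) / 34 + (of_int s :: real)" for m
    by (simp add: field_simps)
  show "klein34 s (m + 34) n \<tau> = ee (of_int s / 2 - of_int (s * s * n) / 68) * klein34 s m n \<tau>"
    unfolding klein34_def * using klein_shift[OF assms, of "of_int (s * m) / 34" s "of_int (s * n) / 34" 0]
    by (simp add: field_simps)
  show "klein34 s m (n + 34) \<tau> = ee (of_int s / 2 + of_int (s * s * m) / 68) * klein34 s m n \<tau>"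
    unfolding klein34_def * using klein_shift[OF assms, of "of_int (s * m) / 34" 0 "of_int (s * n) / 34" s]
    by (simp add: field_simps)
qed

lemma kquot_period:
  assumes "Im \<tau> > 0"
  shows "kquot (m + 34) n \<tau> = kquot m n \<tau>" and "kquot m (n + 34) \<tau> = kquot m n \<tau>"
proof -
  \<comment> \<open>The two sets have the sums 26 and 68 and the sums of squares 204 and 816, whence
    the integers \<open>(26 - 68) / 2 = -21\<close> and \<open>(816 - 204) / 68 = 9\<close>.\<close>
  have "ee (\<Sum>s\<in>num_set. of_int s / 2 - of_int (s * s * n) / 68) = ee (\<Sum>s\<in>den_set. of_int s / 2 - of_int (s * s * n) / 68)"
    by (rule ee_cong[of _ _ "9 * n - 21"]) (simp add: num_set_def den_set_def field_simps)
  thus "kquot (m + 34) n \<tau> = kquot m n \<tau>" by (simp add: kquot_def klein34_period[OF assms] prod.distrib ee_sum)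
  have "ee (\<Sum>s\<in>num_set. of_int s / 2 + of_int (s * s * m) / 68) = ee (\<Sum>s\<in>den_set. of_int s / 2 + of_int (s * s * m) / 68)"
    by (rule ee_cong[of _ _ "- 9 * m - 21"]) (simp add: num_set_def den_set_def field_simps)
  thus "kquot m (n + 34) \<tau> = kquot m n \<tau>" by (simp add: kquot_def klein34_period[OF assms] prod.distrib ee_sum)
qed

lemma kquot_cong:
  assumes "Im \<tau> > 0" "[m = m'] (mod 34)" "[n = n'] (mod 34)"
  shows "kquot m n \<tau> = kquot m' n' \<tau>"
proof -
  have 1: "kquot (m + 34 * k) n \<tau> = kquot m n \<tau>" for m n k
  proof (induction k rule: int_induct[of _ 0])
    case (step1 i) thus ?case using kquot_period(1)[OF assms(1), of "m + 34 * i"] by (simp add: algebra_simps)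
  next
    case (step2 i) thus ?case using kquot_period(1)[OF assms(1), of "m + 34 * (i - 1)"] by (simp add: algebra_simps)
  qed auto
  have 2: "kquot m (n + 34 * k) \<tau> = kquot m n \<tau>" for m n k
  proof (induction k rule: int_induct[of _ 0])
    case (step1 i) thus ?case using kquot_period(2)[OF assms(1), of _ "n + 34 * i"] by (simp add: algebra_simps)
  next
    case (step2 i) thus ?case using kquot_period(2)[OF assms(1), of _ "n + 34 * (i - 1)"] by (simp add: algebra_simps)
  qed auto
  obtain k l where "m' = m + 34 * k" "n' = n + 34 * l"
    using assms(2,3) by (metis cong_iff_lin)
  thus ?thesis using 1 2 by simp
qed

text \<open>The multiplier in \<open>klein_shift\<close> is quadratic in \<open>j\<close>, but
  \<open>j * j\<close> and \<open>j\<close> have the same parity, so only the \<open>j\<close>-th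
  power of a fixed sign is left.\<close>

lemma klein34_shift:
  assumes "Im \<tau> > 0"
  shows "klein34 (s + 34 * j) m n \<tau> = ee (of_int (j * (m + n + m * n)) / 2) * klein34 s m n \<tau>"
proof -
  have *: "of_int ((s + 34 * j) * m) / 34 = of_int (s * m) / 34 + (of_int (j * m) :: real)" for m
    by (simp add: field_simps)
  have "even (j * (j - 1))" by simp
  then obtain i where "j * (j - 1) = 2 * i" by (elim evenE)
  hence i: "j * j - j = 2 * i" by (simp add: right_diff_distrib)
  have "of_real (of_int (j * m + j * n + (j * m) * (j * n)) + of_int (j * n) * (of_int (s * m) / 34) - 
      of_int (j * m) * (of_int (s * n) / 34)) / 2 = (of_int (j * m + j * n + j * j * (m * n)) / 2 :: complex)"
    by (simp add: mult_ac)
  note klein_shift[OF assms, of "of_int (s * m) / 34" "j * m" "of_int (s * n) / 34" "j * n", unfolded this]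
  hence "klein34 (s + 34 * j) m n \<tau> = ee (of_int (j * m + j * n + j * j * (m * n)) / 2) * klein34 s m n \<tau>"
    unfolding klein34_def * .
  also have "j * m + j * n + j * j * (m * n) = j * (m + n + m * n) + (j * j - j) * (m * n)"
    by (simp add: algebra_simps)
  also have "ee (of_int \<dots> / 2) = ee (of_int (j * (m + n + m * n)) / 2)"
    unfolding i by (rule ee_cong[of _ _ "i * (m * n)"]) (simp add: field_simps)
  finally show ?thesis .
qed

text \<open>Modulo 34 the powers of 9 are the odd residues, so multiplication by 9 permutes each of
  the two sets up to sign. The factors \<open>E\<close> occur three times above and three times
  below, while the oddness of the Klein form is applied three times above and twice below, which
  leaves the minus sign.\<close>

lemma kquot_9:
  assumes tau: "Im \<tau> > 0"
  shows "kquot (9 * m) (9 * n) \<tau> = - kquot m n \<tau>"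
proof -
  define E where "E = ee (of_int (m + n + m * n) / 2)"
  define K where "K = (\<lambda>s. klein34 s m n \<tau>)"
  have "ee (of_int k / 2) * ee (of_int k / 2) = 1" for k unfolding ee_add[symmetric] by simp
  hence E2: "E * E = 1" unfolding E_def .
  have j: "K (s + 34) = E * K s" "K (s + 68) = K s" "K (s + 102) = E * K s" "K (s + 136) = K s" for s
  proof -
    define k where "k = m + n + m * n"
    have js: "K (s + 34 * c) = ee (of_int (c * k) / 2) * K s" for c
      using klein34_shift[OF tau, of s c m n] by (simp only: K_def k_def)
    have "ee (of_int (2 * k) / 2) = ee 0" by (rule ee_cong[of _ _ k]) simp
    moreover have "ee (of_int (4 * k) / 2) = ee 0" by (rule ee_cong[of _ _ "2 * k"]) simp
    moreover have "ee (of_int (3 * k) / 2) = ee (of_int k / 2)"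
      by (rule ee_cong[of _ _ k]) (simp add: field_simps)
    ultimately show "K (s + 34) = E * K s" "K (s + 68) = K s" "K (s + 102) = E * K s" "K (s + 136) = K s"
      using js[of 1] js[of 2] js[of 3] js[of 4] by (simp_all only: E_def k_def[symmetric]) simp_all
  qed
  have neg: "K (- s) = - K s" for s using klein34_minus[OF tau] by (simp add: K_def)
  have 9: "klein34 s (9 * m) (9 * n) \<tau> = K (9 * s)" for s by (simp add: K_def klein34_def mult_ac)
  have 10: "K 27 = - E * K 7" "K 45 = E * K 11" "K 63 = - K 5" "K 99 = - E * K 3"
    "K 81 = K 13" "K 117 = E * K 15" "K 135 = - K 1" "K 18 = - E * K 16" "K 36 = E * K 2"
    "K 72 = K 4" "K 144 = K 8"
    using j(1)[of "-7"] j(1)[of 11] j(2)[of "-5"] j(3)[of "-3"] j(2)[of 13] j(3)[of 15] j(4)[of "-1"]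
      j(1)[of "-16"] j(1)[of 2] j(2)[of 4] j(4)[of 8] by (simp_all add: neg)
  have "E \<noteq> 0" by (simp add: E_def)
  have n: "(\<Prod>s\<in>num_set. klein34 s (9 * m) (9 * n) \<tau>) = - (E * E) * E * (\<Prod>s\<in>num_set. K s)"
    unfolding 9 num_set_def by (simp add: 10)
  have d: "(\<Prod>s\<in>den_set. klein34 s (9 * m) (9 * n) \<tau>) = (E * E) * E * (\<Prod>s\<in>den_set. K s)"
    unfolding 9 den_set_def by (simp add: 10)
  show ?thesis unfolding kquot_def n d E2 using \<open>E \<noteq> 0\<close> by (simp add: K_def)
qed

lemma of_int_div_34_Ints: "of_int k / 34 \<in> (\<int> :: real set) \<longleftrightarrow> 34 dvd k"
proof
  assume "of_int k / 34 \<in> (\<int> :: real set)"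
  then obtain l where "of_int k / 34 = (of_int l :: real)" by (auto elim: Ints_cases)
  hence "of_int k = (of_int (34 * l) :: real)" by simp
  hence "k = 34 * l" by (simp only: of_int_eq_iff)
  thus "34 dvd k" by simp
qed (auto elim!: dvdE)

lemma klein34_eq_0_iff:
  assumes "Im \<tau> > 0"
  shows "klein34 s m n \<tau> = 0 \<longleftrightarrow> 34 dvd s * m \<and> 34 dvd s * n"
  by (simp add: klein34_def klein_eq_0_iff[OF assms] of_int_div_34_Ints del: of_int_mult)

lemma dvd_17_of_dvd_34:
  fixes s k :: int
  assumes "s \<in> num_set \<union> den_set" "34 dvd s * k"
  shows "17 dvd k"
proof -
  have "17 dvd s * k" using assms(2) by (rule dvd_trans[rotated]) simp
  moreover have "prime (17::int)" by simp
  moreover have "\<not> 17 dvd s" using assms(1) by (auto simp: den_set_def num_set_def)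
  ultimately show ?thesis using prime_dvd_mult_iff by blast
qed

lemma den_nonzero:
  assumes "Im \<tau> > 0" "\<not> (17 dvd m \<and> 17 dvd n)" "s \<in> den_set"
  shows "klein34 s m n \<tau> \<noteq> 0"
  using assms(2,3) dvd_17_of_dvd_34[of s] by (auto simp: klein34_eq_0_iff[OF assms(1)])

lemma klein34_holomorphic: "klein34 s m n holomorphic_on {\<tau>. Im \<tau> > 0}"
  unfolding klein34_def by (rule klein_holomorphic)

lemma kquot_holomorphic:
  assumes "\<not> (17 dvd m \<and> 17 dvd n)"
  shows "kquot m n holomorphic_on {\<tau>. Im \<tau> > 0}"
  unfolding kquot_def using den_nonzero[OF _ assms]
  by (intro holomorphic_intros klein34_holomorphic) (auto simp: den_set_def)

section \<open>Expansions at the cusp\<close>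

abbreviation ioo :: "complex filter" where "ioo \<equiv> filtercomap Im at_top"

text \<open>Order at least \<open>t\<close> at infinity in \<open>ee \<tau>\<close>, uniformly in
  the real part, since the filter only looks at \<open>Im\<close>. Real \<open>t\<close> are needed
  for the fractional exponents.\<close>

definition bigq :: "real \<Rightarrow> (complex \<Rightarrow> complex) set" where
  "bigq t = O[ioo](\<lambda>\<tau>. ee (of_real t * \<tau>))"

lemma eventually_ioo: "eventually (\<lambda>\<tau>. Im \<tau> > c) ioo"
  by (rule eventually_filtercomapI) (rule eventually_gt_at_top)

lemma norm_ee_mult: "norm (ee (of_real t * \<tau>)) = exp (- (2 * pi * t * Im \<tau>))"
  by (simp add: norm_ee)

lemma bigq_I:
  assumes "eventually (\<lambda>\<tau>. norm (f \<tau>) \<le> C * exp (- (2 * pi * t * Im \<tau>))) ioo"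
  shows "f \<in> bigq t"
  unfolding bigq_def by (rule bigoI[of _ C]) (use assms in \<open>simp add: norm_ee_mult\<close>)

lemma bigq_mono: assumes "s \<le> t" "f \<in> bigq t" shows "f \<in> bigq s"
proof -
  have "(\<lambda>\<tau>. ee (of_real t * \<tau>)) \<in> bigq s"
  proof (rule bigq_I[where C = 1])
    show "\<forall>\<^sub>F \<tau> in ioo. norm (ee (of_real t * \<tau>)) \<le> 1 * exp (- (2 * pi * s * Im \<tau>))"
      using eventually_ioo[of 0] by eventually_elim (use assms(1) in \<open>simp add: norm_ee_mult mult_mono\<close>)
  qed
  thus ?thesis using assms(2) landau_o.big_trans unfolding bigq_def by blast
qed

lemma bigq_mult: "f \<in> bigq s \<Longrightarrow> g \<in> bigq t \<Longrightarrow> (\<lambda>\<tau>. f \<tau> * g \<tau>) \<in> bigq (s + t)"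
  using landau_o.big.mult[of f ioo _ g] by (simp add: bigq_def ee_add ring_distribs)

lemma bigq_prod: "finite A \<Longrightarrow> (\<And>s. s \<in> A \<Longrightarrow> f s \<in> bigq (t s)) \<Longrightarrow> (\<lambda>\<tau>. \<Prod>s\<in>A. f s \<tau>) \<in> bigq (\<Sum>s\<in>A. t s)"
proof (induction A rule: finite_induct)
  case empty
  show ?case by (rule bigq_I[of _ 1]) auto
qed (auto intro: bigq_mult)

lemma bigq_add: "f \<in> bigq t \<Longrightarrow> g \<in> bigq t \<Longrightarrow> (\<lambda>\<tau>. f \<tau> + g \<tau>) \<in> bigq t"
  and bigq_diff: "f \<in> bigq t \<Longrightarrow> g \<in> bigq t \<Longrightarrow> (\<lambda>\<tau>. f \<tau> - g \<tau>) \<in> bigq t"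
  and bigq_cmult: "f \<in> bigq t \<Longrightarrow> (\<lambda>\<tau>. c * f \<tau>) \<in> bigq t"
  by (auto simp: bigq_def intro: sum_in_bigo)

lemma bigq_minus: "f \<in> bigq t \<Longrightarrow> (\<lambda>\<tau>. - f \<tau>) \<in> bigq t"
  by (simp add: bigq_def)

lemma bigq_sum: "(\<And>i. i \<in> A \<Longrightarrow> f i \<in> bigq t) \<Longrightarrow> (\<lambda>\<tau>. \<Sum>i\<in>A. f i \<tau>) \<in> bigq t"
  unfolding bigq_def by (rule big_sum_in_bigo)

lemma bigq_zero [simp]: "(\<lambda>_. 0) \<in> bigq t"
  by (simp add: bigq_def)

lemma bigq_cong: "f \<in> bigq t \<Longrightarrow> eventually (\<lambda>\<tau>. f \<tau> = g \<tau>) ioo \<Longrightarrow> g \<in> bigq t"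
  unfolding bigq_def using landau_o.big.in_cong by blast

lemma bigq_ee: "(\<lambda>\<tau>. ee (of_real t * \<tau> + of_real c)) \<in> bigq t"
  by (rule bigq_I[of _ 1]) (simp add: norm_ee)

lemma bigq_tendsto:
  assumes "t > 0" "f \<in> bigq t"
  shows "(f \<longlongrightarrow> 0) ioo"
proof -
  obtain C where C: "eventually (\<lambda>\<tau>. norm (f \<tau>) \<le> C * exp (- (2 * pi * t * Im \<tau>))) ioo"
    using assms(2) unfolding bigq_def by (auto simp: norm_ee_mult elim: landau_o.bigE)
  have "((\<lambda>y. C * exp (- (2 * pi * t * y))) \<longlongrightarrow> C * 0) at_top"
    using assms(1) by (intro tendsto_mult tendsto_const filterlim_compose[OF exp_at_bot])
      (simp add: filterlim_uminus_at_bot, intro filterlim_tendsto_pos_mult_at_top[OF tendsto_const] filterlim_ident, auto)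
  hence "((\<lambda>\<tau>. C * exp (- (2 * pi * t * Im \<tau>))) \<longlongrightarrow> 0) ioo"
    using filterlim_compose[OF _ filterlim_filtercomap] by fastforce
  thus ?thesis using C by (rule Lim_null_comparison[rotated])
qed

text \<open>Stable under products and quotients, yet it records how fast the limit 1 is approached;
  this error has to be compared with the threshold 12/34.\<close>

definition near1 :: "real \<Rightarrow> (complex \<Rightarrow> complex) \<Rightarrow> bool" where
  "near1 t f \<longleftrightarrow> (\<lambda>\<tau>. f \<tau> - 1) \<in> bigq t"

lemma near1_tendsto: "t > 0 \<Longrightarrow> near1 t f \<Longrightarrow> (f \<longlongrightarrow> 1) ioo"
  using bigq_tendsto[of t "\<lambda>\<tau>. f \<tau> - 1"] by (simp add: near1_def LIM_zero_iff)

lemma tendsto_bigq0: "(f \<longlongrightarrow> c) ioo \<Longrightarrow> f \<in> bigq 0"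
  unfolding bigq_def using bigoI_tendsto[of f "\<lambda>_. 1" c ioo] by simp

lemma near1_bigq0: "t > 0 \<Longrightarrow> near1 t f \<Longrightarrow> f \<in> bigq 0"
  by (rule tendsto_bigq0[OF near1_tendsto])

lemma near1_mono: "s \<le> t \<Longrightarrow> near1 t f \<Longrightarrow> near1 s f"
  unfolding near1_def by (rule bigq_mono)

lemma near1_mult:
  assumes "t > 0" "near1 t f" "near1 t g"
  shows "near1 t (\<lambda>\<tau>. f \<tau> * g \<tau>)"
proof -
  have "(\<lambda>\<tau>. f \<tau> * (g \<tau> - 1) + (f \<tau> - 1)) \<in> bigq t"
    using bigq_mult[OF near1_bigq0[OF assms(1,2)], of "\<lambda>\<tau>. g \<tau> - 1" t] assms
    by (intro bigq_add) (auto simp: near1_def)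
  thus ?thesis by (simp add: near1_def algebra_simps)
qed

lemma near1_1 [simp]: "near1 t (\<lambda>_. 1)" by (simp add: near1_def)

lemma near1_prod:
  assumes "t > 0" "\<And>s. s \<in> A \<Longrightarrow> near1 t (f s)"
  shows "near1 t (\<lambda>\<tau>. \<Prod>s\<in>A. f s \<tau>)"
  using assms(2)
proof (induction A rule: infinite_finite_induct)
  case (insert x F)
  thus ?case using near1_mult[OF assms(1), of "f x"] by simp
qed auto

lemma near1_inverse:
  assumes "t > 0" "near1 t f"
  shows "near1 t (\<lambda>\<tau>. 1 / f \<tau>)"
proof -
  have lim: "(f \<longlongrightarrow> 1) ioo" by (rule near1_tendsto[OF assms])
  have "(\<lambda>\<tau>. 1 / f \<tau>) \<in> bigq 0" by (rule tendsto_bigq0[of _ "1 / 1"]) (intro tendsto_intros lim, simp)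
  hence "(\<lambda>\<tau>. 1 / f \<tau> * (- (f \<tau> - 1))) \<in> bigq (0 + t)"
    using assms(2) by (intro bigq_mult bigq_minus) (auto simp: near1_def)
  hence "(\<lambda>\<tau>. 1 / f \<tau> * (- (f \<tau> - 1))) \<in> bigq t" by simp
  thus ?thesis unfolding near1_def
  proof (rule bigq_cong)
    have "eventually (\<lambda>\<tau>. f \<tau> \<noteq> 0) ioo" using lim by (rule tendsto_imp_eventually_ne) auto
    thus "\<forall>\<^sub>F \<tau> in ioo. 1 / f \<tau> * (- (f \<tau> - 1)) = 1 / f \<tau> - 1"
      by eventually_elim (simp add: field_simps)
  qed
qed

lemma near1_divide: "t > 0 \<Longrightarrow> near1 t f \<Longrightarrow> near1 t g \<Longrightarrow> near1 t (\<lambda>\<tau>. f \<tau> / g \<tau>)"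
  using near1_mult[of t f "\<lambda>\<tau>. 1 / g \<tau>"] near1_inverse[of t g] by simp

lemma near1_qpoch:
  assumes "t > 0" "f \<in> bigq t"
  shows "near1 t (\<lambda>\<tau>. qpoch (f \<tau>) (ee \<tau>))"
proof -
  obtain C where C: "\<And>a q. norm q \<le> 1/2 \<Longrightarrow> norm a \<le> 1 \<Longrightarrow> norm (qpoch a q - 1) \<le> C * norm a"
    using qpoch_minus1_bound by metis
  have "(\<lambda>\<tau>. qpoch (f \<tau>) (ee \<tau>) - 1) \<in> O[ioo](f)"
  proof (rule bigoI[of _ C])
    have "eventually (\<lambda>\<tau>. norm (f \<tau>) < 1) ioo"
      using bigq_tendsto[OF assms] by (rule order_tendstoD(2)[OF tendsto_norm_zero]) auto
    moreover have "((\<lambda>\<tau>. ee (of_real 1 * \<tau> + of_real 0)) \<longlongrightarrow> 0) ioo"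
      using bigq_ee[of 1 0] by (rule bigq_tendsto[rotated]) auto
    hence "eventually (\<lambda>\<tau>. norm (ee \<tau>) < 1/2) ioo"
      by (intro order_tendstoD(2)[OF tendsto_norm_zero]) auto
    ultimately show "\<forall>\<^sub>F \<tau> in ioo. norm (qpoch (f \<tau>) (ee \<tau>) - 1) \<le> C * norm (f \<tau>)"
      by eventually_elim (rule C, auto)
  qed
  thus ?thesis using assms(2) landau_o.big_trans unfolding near1_def bigq_def by blast
qed

text \<open>The two factors of \<open>theta\<close> have arguments of orders \<open>t\<close> and
  \<open>1 - t\<close>; the smaller one limits the error.\<close>

lemma near1_theta:
  assumes "0 < s" "s \<le> t" "s \<le> 1 - t"
  shows "near1 s (\<lambda>\<tau>. theta (ee (of_real t * \<tau> + of_real c)) (ee \<tau>))"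
proof -
  have "ee \<tau> / ee (of_real t * \<tau> + of_real c) = ee (of_real (1 - t) * \<tau> + of_real (- c))" for \<tau>
    unfolding ee_diff[symmetric] by (simp add: algebra_simps)
  hence "(\<lambda>\<tau>. ee \<tau> / ee (of_real t * \<tau> + of_real c)) \<in> bigq (1 - t)"
    using bigq_ee[of "1 - t" "- c"] by simp
  thus ?thesis unfolding theta_def using assms
    by (intro near1_mult near1_qpoch bigq_mono[OF _ bigq_ee[of t c]]) (auto intro: bigq_mono)
qed

lemma theta_factor:
  assumes "norm q < 1"
  shows "theta w q = (1 - w) * (qpoch (q * w) q * qpoch (q / w) q)"
  using qpoch_rec[OF assms, of w] by (simp add: theta_def mult_ac)

text \<open>With a constant argument the factor \<open>1 - w\<close> does not tend to 1 and has to
  be split off.\<close>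

lemma theta_const_near1:
  "\<exists>f. near1 1 f \<and> (\<forall>\<tau>. Im \<tau> > 0 \<longrightarrow> theta (ee (of_real c)) (ee \<tau>) = (1 - ee (of_real c)) * f \<tau>)"
proof (intro exI conjI allI impI)
  have "(\<lambda>\<tau>. ee \<tau> * ee (of_real c)) \<in> bigq 1" "(\<lambda>\<tau>. ee \<tau> / ee (of_real c)) \<in> bigq 1"
    using bigq_ee[of 1 c] bigq_ee[of 1 "- c"] by (simp_all add: ee_add ee_diff)
  thus "near1 1 (\<lambda>\<tau>. qpoch (ee \<tau> * ee (of_real c)) (ee \<tau>) * qpoch (ee \<tau> / ee (of_real c)) (ee \<tau>))"
    by (intro near1_mult near1_qpoch) auto
qed (use theta_factor[OF norm_ee_lt_1] in simp)

section \<open>Orders of the Klein forms and their quotients at infinity\<close>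

lemma klein_theta: "klein a b \<tau> = ee ((of_real a - 1) * (of_real a * \<tau> + of_real b) / 2) * theta (ee (of_real a * \<tau> + of_real b)) (ee \<tau>)"
proof -
  have "ee (of_real a * z / 2) * ee (- z / 2) = ee ((of_real a - 1) * z / 2)" for z
    unfolding ee_add[symmetric] by (intro arg_cong[of _ _ ee]) (simp add: field_simps)
  from this[of "of_real a * \<tau> + of_real b"] show ?thesis
    unfolding klein_def jtheta_def by (simp only: mult.assoc[symmetric])
qed

text \<open>Minus the order of \<open>klein a b\<close> at infinity. Up to an additive constant,
  \<open>- klein_ord a\<close> is half the second Bernoulli polynomial at
  \<open>frac a\<close>.\<close>

definition klein_ord :: "real \<Rightarrow> real" where "klein_ord a = frac a * (1 - frac a) / 2"

lemma klein_bigo_aux: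
  assumes "0 \<le> a" "a < 1" "a \<noteq> 0 \<or> b \<notin> \<int>"
  shows "klein a b \<in> bigq (- (a * (1 - a) / 2))" "(\<lambda>\<tau>. 1 / klein a b \<tau>) \<in> bigq (a * (1 - a) / 2)"
proof -
  have *: "\<exists>f c. c \<noteq> 0 \<and> (f \<longlongrightarrow> c) ioo \<and> (\<forall>\<tau>. Im \<tau> > 0 \<longrightarrow> theta (ee (of_real a * \<tau> + of_real b)) (ee \<tau>) = f \<tau>)"
  proof (cases "a = 0")
    case True
    have "ee (of_real b) \<noteq> 1"
    proof
      assume "ee (of_real b) = 1"
      then obtain n :: int where "complex_of_real b = of_int n" by (auto simp: ee_eq_1_iff)
      hence "b = of_int n" by (metis of_real_eq_iff of_real_of_int_eq)
      thus False using True assms(3) by auto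
    qed
    moreover obtain f where f: "near1 1 f" "\<forall>\<tau>. Im \<tau> > 0 \<longrightarrow> theta (ee (of_real b)) (ee \<tau>) = (1 - ee (of_real b)) * f \<tau>"
      using theta_const_near1 by blast
    moreover have "((\<lambda>\<tau>. (1 - ee (of_real b)) * f \<tau>) \<longlongrightarrow> (1 - ee (of_real b)) * 1) ioo"
      using near1_tendsto[OF _ f(1)] by (intro tendsto_intros) auto
    ultimately show ?thesis using True
      by (intro exI[of _ "\<lambda>\<tau>. (1 - ee (of_real b)) * f \<tau>"] exI[of _ "(1 - ee (of_real b))"]) auto
  next
    case False
    have "((\<lambda>\<tau>. theta (ee (of_real a * \<tau> + of_real b)) (ee \<tau>)) \<longlongrightarrow> 1) ioo"
      by (rule near1_tendsto[OF _ near1_theta[of "min a (1 - a)"]]) (use assms False in auto)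
    thus ?thesis by (intro exI[of _ "\<lambda>\<tau>. theta (ee (of_real a * \<tau> + of_real b)) (ee \<tau>)"] exI[of _ 1]) auto
  qed
  then obtain f c where fc: "c \<noteq> 0" "(f \<longlongrightarrow> c) ioo" 
    "\<And>\<tau>. Im \<tau> > 0 \<Longrightarrow> theta (ee (of_real a * \<tau> + of_real b)) (ee \<tau>) = f \<tau>" by blast
  have e: "ee ((of_real a - 1) * (of_real a * \<tau> + of_real b) / 2) = 
       ee (of_real (- (a * (1 - a) / 2)) * \<tau> + of_real ((a - 1) * b / 2))" for \<tau>
    by (intro arg_cong[of _ _ ee]) (simp add: field_simps)
  have "(\<lambda>\<tau>. ee (of_real (- (a * (1 - a) / 2)) * \<tau> + of_real ((a - 1) * b / 2)) * f \<tau>) \<in> bigq (- (a * (1 - a) / 2) + 0)"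
    by (intro bigq_mult bigq_ee tendsto_bigq0[OF fc(2)])
  hence "(\<lambda>\<tau>. ee (of_real (- (a * (1 - a) / 2)) * \<tau> + of_real ((a - 1) * b / 2)) * f \<tau>) \<in> bigq (- (a * (1 - a) / 2))" by simp
  thus "klein a b \<in> bigq (- (a * (1 - a) / 2))"
    by (rule bigq_cong) (use eventually_ioo[of 0] in eventually_elim, simp only: klein_theta e fc(3))
  have "(\<lambda>\<tau>. ee (of_real (a * (1 - a) / 2) * \<tau> + of_real (- ((a - 1) * b / 2))) * (1 / f \<tau>)) \<in> bigq (a * (1 - a) / 2 + 0)"
    by (intro bigq_mult bigq_ee tendsto_bigq0[of _ "1 / c"] tendsto_intros fc)
  hence "(\<lambda>\<tau>. ee (of_real (a * (1 - a) / 2) * \<tau> + of_real (- ((a - 1) * b / 2))) * (1 / f \<tau>)) \<in> bigq (a * (1 - a) / 2)" by simp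
  moreover have "ee (of_real (a * (1 - a) / 2) * \<tau> + of_real (- ((a - 1) * b / 2))) = 
     1 / ee (of_real (- (a * (1 - a) / 2)) * \<tau> + of_real ((a - 1) * b / 2))" for \<tau>
    unfolding ee_minus[symmetric] by (intro arg_cong[of _ _ ee]) simp
  ultimately show "(\<lambda>\<tau>. 1 / klein a b \<tau>) \<in> bigq (a * (1 - a) / 2)"
    by (elim bigq_cong) (use eventually_ioo[of 0] in eventually_elim, simp only: klein_theta e fc(3) times_divide_times_eq mult_1)
qed

lemma klein_bigo:
  assumes "a \<notin> \<int> \<or> b \<notin> \<int>"
  shows "klein a b \<in> bigq (- klein_ord a)" "(\<lambda>\<tau>. 1 / klein a b \<tau>) \<in> bigq (klein_ord a)"
proof -
  define c where "c = ee (of_real (of_int \<lfloor>a\<rfloor> - of_int \<lfloor>a\<rfloor> * b) / 2)"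
  have eq: "klein a b \<tau> = c * klein (frac a) b \<tau>" if "Im \<tau> > 0" for \<tau>
    using klein_shift[OF that, of "frac a" "\<lfloor>a\<rfloor>" b 0] by (simp add: c_def frac_def)
  have aux: "0 \<le> frac a" "frac a < 1" "frac a \<noteq> 0 \<or> b \<notin> \<int>"
    using assms by (auto simp: frac_lt_1)
  have "(\<lambda>\<tau>. c * klein (frac a) b \<tau>) \<in> bigq (- klein_ord a)"
    using bigq_cmult[OF klein_bigo_aux(1)[OF aux], of c] by (simp add: klein_ord_def)
  thus "klein a b \<in> bigq (- klein_ord a)"
    by (rule bigq_cong) (use eventually_ioo[of 0] in eventually_elim, simp add: eq)
  have "(\<lambda>\<tau>. (1 / c) * (1 / klein (frac a) b \<tau>)) \<in> bigq (klein_ord a)"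
    using bigq_cmult[OF klein_bigo_aux(2)[OF aux], of "1 / c"] by (simp add: klein_ord_def)
  thus "(\<lambda>\<tau>. 1 / klein a b \<tau>) \<in> bigq (klein_ord a)"
    by (rule bigq_cong) (use eventually_ioo[of 0] in eventually_elim, simp add: eq)
qed

lemma frac_of_int_div: "frac (of_int k / 34 :: real) = of_int (k mod 34) / 34"
proof -
  have "k = 34 * (k div 34) + k mod 34" by simp
  hence "real_of_int k = real_of_int (34 * (k div 34) + k mod 34)" by (rule arg_cong)
  hence k: "real_of_int k = 34 * real_of_int (k div 34) + real_of_int (k mod 34)"
    by (simp only: of_int_add of_int_mult of_int_numeral)
  have "\<lfloor>of_int k / 34 :: real\<rfloor> = k div 34"
    using floor_divide_of_int_eq[of k 34, where ?'a = real] by simp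
  thus ?thesis unfolding frac_def by (simp add: k field_simps)
qed

lemma klein_ord_of_int_div: "klein_ord (of_int k / 34) = of_int (k mod 34 * (34 - k mod 34)) / 2312"
  unfolding klein_ord_def frac_of_int_div by (simp add: field_simps)

text \<open>The order of \<open>kquot m n\<close> at infinity multiplied by
  \<open>2 * 34 ^ 2 = 2312\<close>, so that it can be evaluated class by class in the
  integers.\<close>

definition kquot_ord :: "int \<Rightarrow> int" where
  "kquot_ord m = (\<Sum>s\<in>den_set. (s * m mod 34) * (34 - s * m mod 34)) - (\<Sum>s\<in>num_set. (s * m mod 34) * (34 - s * m mod 34))"

lemma division_point_notin_lattice:
  assumes "\<not> (17 dvd m \<and> 17 dvd n)" "s \<in> num_set \<union> den_set"
  shows "(of_int (s * m) / 34 :: real) \<notin> \<int> \<or> (of_int (s * n) / 34 :: real) \<notin> \<int>"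
  unfolding of_int_div_34_Ints using assms dvd_17_of_dvd_34 by blast

lemma kquot_bigo:
  assumes "\<not> (17 dvd m \<and> 17 dvd n)"
  shows "kquot m n \<in> bigq (of_int (kquot_ord m) / 2312)"
proof -
  have fin: "finite num_set" "finite den_set" by (auto simp: num_set_def den_set_def)
  have 1: "(\<lambda>\<tau>. \<Prod>s\<in>num_set. klein34 s m n \<tau>) \<in> bigq (\<Sum>s\<in>num_set. - klein_ord (of_int (s * m) / 34))"
    unfolding klein34_def by (intro bigq_prod fin klein_bigo division_point_notin_lattice[OF assms]) auto
  have 2: "(\<lambda>\<tau>. \<Prod>s\<in>den_set. 1 / klein34 s m n \<tau>) \<in> bigq (\<Sum>s\<in>den_set. klein_ord (of_int (s * m) / 34))"
    unfolding klein34_def by (intro bigq_prod fin klein_bigo division_point_notin_lattice[OF assms]) auto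
  have "(\<lambda>\<tau>. (\<Prod>s\<in>num_set. klein34 s m n \<tau>) * (\<Prod>s\<in>den_set. 1 / klein34 s m n \<tau>)) \<in> bigq ((\<Sum>s\<in>num_set. - klein_ord (of_int (s * m) / 34)) + (\<Sum>s\<in>den_set. klein_ord (of_int (s * m) / 34)))"
    by (rule bigq_mult[OF 1 2])
  also have "(\<lambda>\<tau>. (\<Prod>s\<in>num_set. klein34 s m n \<tau>) * (\<Prod>s\<in>den_set. 1 / klein34 s m n \<tau>)) = kquot m n"
    by (simp add: kquot_def fun_eq_iff prod_dividef)
  also have "(\<Sum>s\<in>num_set. - klein_ord (of_int (s * m) / 34)) + (\<Sum>s\<in>den_set. klein_ord (of_int (s * m) / 34)) = of_int (kquot_ord m) / 2312"
    unfolding klein_ord_of_int_div kquot_ord_def by (simp add: sum_negf sum_divide_distrib[symmetric] diff_divide_distrib del: of_int_mult)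
  finally show ?thesis .
qed

text \<open>These are 2 times the powers of 9 modulo 34, the classes in which
  \<open>kquot_ord\<close> is only 408, which corresponds to the order 6/34.\<close>

definition even_QR :: "int set" where "even_QR = {2, 4, 8, 16, 18, 26, 30, 32}"

text \<open>816 corresponds to the order 12/34. By periodicity it suffices to evaluate the remaining
  24 classes modulo 34.\<close>

lemma kquot_ord_ge:
  assumes "\<not> 17 dvd m" "m mod 34 \<notin> even_QR"
  shows "kquot_ord m \<ge> 816"
proof -
  define r where "r = m mod 34"
  have "17 dvd m \<longleftrightarrow> 17 dvd r"
    unfolding r_def by (rule dvd_mod_iff[symmetric]) simp
  moreover have "r \<in> set [0..33]" by (simp add: r_def)
  hence "r \<in> {0,1,2,3,4,5,6,7,8,9,10,11,12,13,14,15,16,17,18,19,20,21,22,23,24,25,26,27,28,29,30,31,32,33}"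
    by (simp add: upto.simps)
  ultimately have "r \<in> {1,3,5,7,9,11,13,15,19,21,23,25,27,29,31,33,6,10,12,14,20,22,24,28}"
    using assms unfolding r_def[symmetric] by (auto simp: even_QR_def)
  hence "kquot_ord r \<ge> 816" by (auto simp: kquot_ord_def num_set_def den_set_def)
  moreover have "kquot_ord r = kquot_ord m" by (simp add: kquot_ord_def r_def mod_mult_right_eq)
  ultimately show ?thesis by simp
qed

lemma kquot_bigo_12:
  assumes "\<not> 17 dvd m" "m mod 34 \<notin> even_QR"
  shows "kquot m n \<in> bigq (12 / 34)"
  by (rule bigq_mono[OF _ kquot_bigo]) (use assms kquot_ord_ge[OF assms] in auto)

section \<open>Expansions of the quotients of low order\<close>

lemma klein34_theta:
  "klein34 s m n \<tau> = ee (of_int (s * (s * m - 34)) / 68 * ((of_int m * \<tau> + of_int n) / 34)) *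
     theta (ee (of_int s * ((of_int m * \<tau> + of_int n) / 34))) (ee \<tau>)"
proof -
  have "(of_real (of_int (s * m) / 34) * \<tau> + of_real (of_int (s * n) / 34) :: complex) = of_int s * ((of_int m * \<tau> + of_int n) / 34)"
    by (simp add: field_simps)
  moreover have "(of_real (of_int (s * m) / 34) - 1) * (of_int s * ((of_int m * \<tau> + of_int n) / 34)) / 2 =
      of_int (s * (s * m - 34)) / 68 * ((of_int m * \<tau> + of_int n) / 34)"
    by (simp add: field_simps)
  ultimately show ?thesis unfolding klein34_def klein_theta by (simp only:)
qed

text \<open>As in \<open>kquot_period\<close>, 21 is half the difference of the sums of the two sets
  and 9 is the difference of the sums of squares divided by 68.\<close>

lemma kquot_theta:
  "kquot m n \<tau> = ee (of_int (21 - 9 * m) * ((of_int m * \<tau> + of_int n) / 34)) *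
     (\<Prod>s\<in>num_set. theta (ee (of_int s * ((of_int m * \<tau> + of_int n) / 34))) (ee \<tau>)) /
     (\<Prod>s\<in>den_set. theta (ee (of_int s * ((of_int m * \<tau> + of_int n) / 34))) (ee \<tau>))"
proof -
  define z where "z = (of_int m * \<tau> + of_int n) / 34"
  have "ee (\<Sum>s\<in>num_set. of_int (s * (s * m - 34)) / 68 * z) / ee (\<Sum>s\<in>den_set. of_int (s * (s * m - 34)) / 68 * z) = 
     ee (of_int (21 - 9 * m) * z)"
    unfolding ee_diff[symmetric] by (intro arg_cong[of _ _ ee]) (simp add: num_set_def den_set_def field_simps)
  thus ?thesis unfolding kquot_def klein34_theta z_def[symmetric] by (simp add: prod.distrib ee_sum) 
      (simp add: field_simps)
qed

lemma theta_reflect: "w \<noteq> 0 \<Longrightarrow> q \<noteq> 0 \<Longrightarrow> theta (q / w) q = theta w q"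
  by (simp add: theta_def mult.commute)

lemma near1_theta_factor:
  assumes "0 < s" "s \<le> 1 - t" "s \<le> 1 + t"
  shows "\<exists>g. near1 s g \<and> (\<forall>\<tau>. Im \<tau> > 0 \<longrightarrow> theta (ee (of_real t * \<tau> + of_real c)) (ee \<tau>) = 
           (1 - ee (of_real t * \<tau> + of_real c)) * g \<tau>)"
proof (intro exI conjI allI impI)
  have "ee \<tau> * ee (of_real t * \<tau> + of_real c) = ee (of_real (1 + t) * \<tau> + of_real c)"
       "ee \<tau> / ee (of_real t * \<tau> + of_real c) = ee (of_real (1 - t) * \<tau> + of_real (- c))" for \<tau>
    unfolding ee_add[symmetric] ee_diff[symmetric] by (simp_all add: algebra_simps)
  hence "(\<lambda>\<tau>. ee \<tau> * ee (of_real t * \<tau> + of_real c)) \<in> bigq (1 + t)"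
        "(\<lambda>\<tau>. ee \<tau> / ee (of_real t * \<tau> + of_real c)) \<in> bigq (1 - t)"
    using bigq_ee[of "1 + t" c] bigq_ee[of "1 - t" "- c"] by simp_all
  thus "near1 s (\<lambda>\<tau>. qpoch (ee \<tau> * ee (of_real t * \<tau> + of_real c)) (ee \<tau>) * 
      qpoch (ee \<tau> / ee (of_real t * \<tau> + of_real c)) (ee \<tau>))"
    using assms by (intro near1_mult near1_qpoch) (auto intro: bigq_mono)
qed (use theta_factor[OF norm_ee_lt_1] in simp)

text \<open>With \<open>u = ee (2 * z)\<close>, the theta factors that deviate from 1 in an order
  below 6/34 contribute \<open>1 / ((1 - u) * (1 - u ^ 2))\<close>, and
  \<open>(1 + u) * ((1 - u) * (1 - u ^ 2)) = (1 - u ^ 2) ^ 2\<close> shows that this is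
  \<open>1 + u\<close> up to the order 8/34 of \<open>u ^ 2\<close>. The prefactor
  \<open>ee (3 * z)\<close> raises all errors by 6/34.\<close>

lemma kquot_2_asymp:
  assumes "odd n"
  shows "(\<lambda>\<tau>. kquot 2 n \<tau> - (ee (3 * ((2 * \<tau> + of_int n) / 34)) + ee (5 * ((2 * \<tau> + of_int n) / 34)))) \<in> bigq (12 / 34)"
proof -
  define z :: "complex \<Rightarrow> complex" where "z = (\<lambda>\<tau>. (2 * \<tau> + of_int n) / 34)"
  define th where "th = (\<lambda>s \<tau>. theta (ee (of_int s * z \<tau>)) (ee \<tau>))"
  have sz: "of_int s * z \<tau> = of_real (2 * of_int s / 34) * \<tau> + of_real (of_int (s * n) / 34)" for s \<tau>
    by (simp add: z_def field_simps)
  have th1: "near1 (6/34) (th s)" if "s \<in> num_set \<union> {9, 13, 4, 8}" for s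
    unfolding th_def sz using that by (intro near1_theta) (auto simp: num_set_def)
  have ev: "\<exists>g. near1 (6/34) g \<and> (\<forall>\<tau>. Im \<tau> > 0 \<longrightarrow> th s \<tau> = (1 - ee (of_int s * z \<tau>)) * g \<tau>)"
    if "s \<in> {1, 2}" for s
    unfolding th_def sz using that by (intro near1_theta_factor) auto
  obtain g1 where g1: "near1 (6/34) g1" "\<And>\<tau>. Im \<tau> > 0 \<Longrightarrow> th 1 \<tau> = (1 - ee (z \<tau>)) * g1 \<tau>"
    using ev[of 1] by auto
  obtain g2 where g2: "near1 (6/34) g2" "\<And>\<tau>. Im \<tau> > 0 \<Longrightarrow> th 2 \<tau> = (1 - ee (2 * z \<tau>)) * g2 \<tau>"
    using ev[of 2] by auto
  have n2: "ee (of_int n / 2) = -1"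
  proof -
    obtain k where "n = 2 * k + 1" using assms by (elim oddE)
    hence "ee (of_int n / 2) = ee (1 / 2)" by (intro ee_cong[of _ _ k]) (simp add: field_simps)
    thus ?thesis by (simp add: ee_half)
  qed
  \<comment> \<open>Here \<open>17 * z = \<tau> + n / 2\<close>, so reflection replaces
    \<open>s\<close> by \<open>17 - s\<close>, with a minus sign since \<open>n\<close> is
    odd.\<close>
  have refl: "th s \<tau> = theta (- ee (of_int (17 - s) * z \<tau>)) (ee \<tau>)" for s \<tau>
  proof -
    have "ee \<tau> / ee (of_int s * z \<tau>) = ee (of_int (17 - s) * z \<tau>) / ee (of_int n / 2)"
      unfolding ee_diff[symmetric] by (intro arg_cong[of _ _ ee]) (simp add: z_def field_simps)
    thus ?thesis unfolding th_def by (subst theta_reflect[symmetric]) (simp_all add: n2)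
  qed
  have ev': "\<exists>g. near1 (6/34) g \<and> (\<forall>\<tau>. Im \<tau> > 0 \<longrightarrow> th (17 - s) \<tau> = (1 + ee (of_int s * z \<tau>)) * g \<tau>)"
    if "s \<in> {1, 2}" for s
  proof -
    have *: "- ee (of_int s * z \<tau>) = ee (of_real (2 * of_int s / 34) * \<tau> + of_real (of_int (s * n) / 34 + 1 / 2))" for \<tau>
    proof -
      have "ee (of_real (2 * of_int s / 34) * \<tau> + of_real (of_int (s * n) / 34 + 1 / 2)) = ee (of_int s * z \<tau> + 1 / 2)"
        unfolding sz by (simp add: add.assoc)
      thus ?thesis by (simp add: ee_add ee_half)
    qed
    have "\<exists>g. near1 (6/34) g \<and> (\<forall>\<tau>. Im \<tau> > 0 \<longrightarrow> theta (- ee (of_int s * z \<tau>)) (ee \<tau>) = (1 - (- ee (of_int s * z \<tau>))) * g \<tau>)"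
      unfolding * using that by (intro near1_theta_factor) auto
    thus ?thesis by (simp add: refl)
  qed
  obtain g16 where g16: "near1 (6/34) g16" "\<And>\<tau>. Im \<tau> > 0 \<Longrightarrow> th 16 \<tau> = (1 + ee (z \<tau>)) * g16 \<tau>"
    using ev'[of 1] by auto
  obtain g15 where g15: "near1 (6/34) g15" "\<And>\<tau>. Im \<tau> > 0 \<Longrightarrow> th 15 \<tau> = (1 + ee (2 * z \<tau>)) * g15 \<tau>"
    using ev'[of 2] by auto
  define N where "N = (\<lambda>\<tau>. (th 3 \<tau> * th 5 \<tau> * th 7 \<tau> * th 11 \<tau>) / 
      (th 9 \<tau> * th 13 \<tau> * th 4 \<tau> * th 8 \<tau> * g1 \<tau> * g2 \<tau> * g16 \<tau> * g15 \<tau>))"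
  have N: "near1 (6/34) N" unfolding N_def
    by (intro near1_divide near1_mult th1 g1 g2 g15 g16) (auto simp: num_set_def)
  define U where "U = (\<lambda>\<tau>. (1 - ee (2 * z \<tau>)) * (1 - ee (4 * z \<tau>)))"
  have kquot: "kquot 2 n \<tau> = ee (3 * z \<tau>) * N \<tau> / U \<tau>" if "Im \<tau> > 0" for \<tau>
  proof -
    have e: "ee (2 * z \<tau>) = ee (z \<tau>) * ee (z \<tau>)" "ee (4 * z \<tau>) = ee (2 * z \<tau>) * ee (2 * z \<tau>)"
      unfolding ee_add[symmetric] by simp_all
    have U: "U \<tau> = (1 - ee (z \<tau>)) * (1 + ee (z \<tau>)) * (1 - ee (2 * z \<tau>)) * (1 + ee (2 * z \<tau>))"
      unfolding U_def e by (simp add: algebra_simps)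
    have "kquot 2 n \<tau> = ee (3 * z \<tau>) * (\<Prod>s\<in>num_set. th s \<tau>) / (\<Prod>s\<in>den_set. th s \<tau>)"
      unfolding kquot_theta by (simp add: th_def z_def)
    also have "(\<Prod>s\<in>num_set. th s \<tau>) = th 3 \<tau> * th 5 \<tau> * th 7 \<tau> * th 11 \<tau>"
      by (simp add: num_set_def mult_ac)
    also have "(\<Prod>s\<in>den_set. th s \<tau>) = U \<tau> * (th 9 \<tau> * th 13 \<tau> * th 4 \<tau> * th 8 \<tau> * g1 \<tau> * g2 \<tau> * g16 \<tau> * g15 \<tau>)"
      unfolding U by (simp add: den_set_def g1(2)[OF that] g2(2)[OF that] g15(2)[OF that] g16(2)[OF that] mult_ac)
    finally show ?thesis by (simp add: N_def)
  qed
  have ez: "(\<lambda>\<tau>. ee (of_int k * z \<tau>)) \<in> bigq (2 * of_int k / 34)" for k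
    unfolding sz by (rule bigq_ee)
  have lim: "((\<lambda>\<tau>. ee (of_int k * z \<tau>)) \<longlongrightarrow> 0) ioo" if "k > 0" for k
    by (rule bigq_tendsto[OF _ ez]) (use that in auto)
  have U1: "(U \<longlongrightarrow> (1 - 0) * (1 - 0)) ioo"
    unfolding U_def using lim[of 2] lim[of 4] by (intro tendsto_intros) auto
  have V: "(\<lambda>\<tau>. (N \<tau> - 1) + ee (of_int 4 * z \<tau>) * (2 - ee (of_int 4 * z \<tau>))) \<in> bigq (6/34)"
  proof (rule bigq_add)
    show "(\<lambda>\<tau>. N \<tau> - 1) \<in> bigq (6 / 34)" using N by (simp add: near1_def)
    have "(\<lambda>\<tau>. ee (of_int 4 * z \<tau>) * (2 - ee (of_int 4 * z \<tau>))) \<in> bigq (2 * of_int 4 / 34 + 0)"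
      by (intro bigq_mult ez tendsto_bigq0[of _ "2 - 0"] tendsto_intros lim) auto
    thus "(\<lambda>\<tau>. ee (of_int 4 * z \<tau>) * (2 - ee (of_int 4 * z \<tau>))) \<in> bigq (6 / 34)"
      by (rule bigq_mono[rotated]) simp
  qed
  have "(\<lambda>\<tau>. ee (of_int 3 * z \<tau>) * (((N \<tau> - 1) + ee (of_int 4 * z \<tau>) * (2 - ee (of_int 4 * z \<tau>))) * (1 / U \<tau>))) \<in>
     bigq (2 * of_int 3 / 34 + (6 / 34 + 0))"
    by (intro bigq_mult ez V tendsto_bigq0[of _ "1 / ((1 - 0) * (1 - 0))"] tendsto_divide U1 tendsto_const) simp
  hence "(\<lambda>\<tau>. ee (of_int 3 * z \<tau>) * (((N \<tau> - 1) + ee (of_int 4 * z \<tau>) * (2 - ee (of_int 4 * z \<tau>))) * (1 / U \<tau>))) \<in>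
     bigq (12 / 34)" by simp
  thus ?thesis
  proof (rule bigq_cong)
    have "eventually (\<lambda>\<tau>. U \<tau> \<noteq> 0) ioo" using U1 by (rule tendsto_imp_eventually_ne) auto
    thus "\<forall>\<^sub>F \<tau> in ioo. ee (of_int 3 * z \<tau>) * (((N \<tau> - 1) + ee (of_int 4 * z \<tau>) * (2 - ee (of_int 4 * z \<tau>))) * (1 / U \<tau>)) =
       kquot 2 n \<tau> - (ee (3 * ((2 * \<tau> + of_int n) / 34)) + ee (5 * ((2 * \<tau> + of_int n) / 34)))"
      using eventually_ioo[of 0]
    proof eventually_elim
      case (elim \<tau>)
      have e: "ee (5 * z \<tau>) = ee (3 * z \<tau>) * ee (2 * z \<tau>)" "ee (4 * z \<tau>) = ee (2 * z \<tau>) * ee (2 * z \<tau>)"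
        unfolding ee_add[symmetric] by simp_all
      have "(1 + ee (2 * z \<tau>)) * U \<tau> = 1 - ee (4 * z \<tau>) * (2 - ee (4 * z \<tau>))"
        unfolding U_def e by (simp add: algebra_simps)
      hence "(N \<tau> - 1 + ee (4 * z \<tau>) * (2 - ee (4 * z \<tau>))) * (1 / U \<tau>) = N \<tau> / U \<tau> - (1 + ee (2 * z \<tau>))"
        using elim(1) by (simp add: field_simps)
      hence "ee (3 * z \<tau>) * ((N \<tau> - 1 + ee (4 * z \<tau>) * (2 - ee (4 * z \<tau>))) * (1 / U \<tau>)) = 
          ee (3 * z \<tau>) * N \<tau> / U \<tau> - (ee (3 * z \<tau>) + ee (5 * z \<tau>))"
        by (simp only: e(1)) (simp add: right_diff_distrib distrib_left)
      thus ?case using kquot[OF elim(2)] by (simp add: z_def)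
    qed
  qed
qed

text \<open>The common leading coefficient of \<open>kquot 17 n\<close> and, for odd \<open>n\<close> prime to 17, of \<open>kquot 0 n\<close>. That
  they coincide and only depend on \<open>n\<close> modulo 17 cancels the constant terms at the cusps.\<close>

definition kquot_17_const :: "int \<Rightarrow> complex" where
  "kquot_17_const n = - ee (- of_int n / 17) / (\<Prod>l\<in>{1, 2, 4, 8}. 1 - ee (of_int (l * n) / 17))"

lemma kquot_17_const_cong: "[n = n'] (mod 17) \<Longrightarrow> kquot_17_const n = kquot_17_const n'"
proof -
  assume "[n = n'] (mod 17)"
  then obtain k where k: "n' = n + 17 * k" by (metis cong_iff_lin)
  have 1: "ee (of_int (l * n') / 17) = ee (of_int (l * n) / 17)" for l
    by (rule ee_cong[of _ _ "l * k"]) (simp add: k field_simps)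
  have 2: "ee (- of_int n' / 17) = ee (- of_int n / 17)"
    by (rule ee_cong[of _ _ "- k"]) (simp add: k field_simps)
  show ?thesis by (simp only: kquot_17_const_def 1 2)
qed

text \<open>The first coordinate \<open>s / 2\<close> is a half-integer for odd \<open>s\<close> and
  an integer for even \<open>s\<close>. Both sets contain four odd elements, so the factors
  \<open>ee (- \<tau> / 8)\<close> cancel and a constant remains: \<open>p\<close> on the even
  elements together with the phases \<open>c\<close>.\<close>

lemma kquot_17_asymp: "(\<lambda>\<tau>. kquot 17 n \<tau> - kquot_17_const n) \<in> bigq (12 / 34)"
proof -
  define c where "c = (\<lambda>s::int. if odd s then ee (of_int (34 * (s - 1) - s * s * n) / 136 ) 
     else ee (of_int (34 * s - s * s * n - 2 * s * n) / 136))"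
  define p where "p = (\<lambda>(s::int) \<tau>. if odd s then ee (- \<tau> / 8) else 1 - ee (of_int (s * n) / 34))"
  have "\<exists>g. near1 (1/2) g \<and> (\<forall>\<tau>. Im \<tau> > 0 \<longrightarrow> klein34 s 17 n \<tau> = p s \<tau> * c s * g \<tau>)" for s
  proof (cases "odd s")
    case True
    then obtain l where l: "s = 2 * l + 1" by (elim oddE)
    define b where "b = (of_int (s * n) / 34 :: real)"
    have near: "near1 (1/2) (\<lambda>\<tau>. theta (ee (of_real (1/2) * \<tau> + of_real b)) (ee \<tau>))"
      by (rule near1_theta) auto
    moreover have "klein34 s 17 n \<tau> = p s \<tau> * c s * theta (ee (of_real (1/2) * \<tau> + of_real b)) (ee \<tau>)" if "Im \<tau> > 0" for \<tau>
    proof -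
      have "klein34 s 17 n \<tau> = klein (1/2 + of_int l) (b + of_int 0) \<tau>"
      proof -
        have "of_int (s * 17) / 34 = (1/2 + of_int l :: real)" by (simp add: l field_simps)
        thus ?thesis by (simp only: klein34_def b_def of_int_0 add_0_right)
      qed
      also have "\<dots> = (ee (of_real (of_int l - of_int l * b) / 2) * ee ((of_real (1/2) - 1) * (of_real (1/2) * \<tau> + of_real b) / 2)) *
         theta (ee (of_real (1/2) * \<tau> + of_real b)) (ee \<tau>)"
        using klein_shift[OF that, of "1/2" l b 0] by (simp add: klein_theta)
      also have "ee (of_real (of_int l - of_int l * b) / 2) * ee ((of_real (1/2) - 1) * (of_real (1/2) * \<tau> + of_real b) / 2) = 
         p s \<tau> * c s"
        using True unfolding p_def c_def b_def by (simp only: if_True not_False_eq_True ee_add[symmetric])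
          (intro arg_cong[of _ _ ee], simp add: l field_simps)
      finally show ?thesis .
    qed
    ultimately show ?thesis by blast
  next
    case False
    then obtain l where l: "s = 2 * l" by auto
    define b where "b = (of_int (s * n) / 34 :: real)"
    obtain g where g: "near1 1 g" "\<And>\<tau>. Im \<tau> > 0 \<Longrightarrow> theta (ee (of_real b)) (ee \<tau>) = (1 - ee (of_real b)) * g \<tau>"
      using theta_const_near1[of b] by blast
    moreover have "klein34 s 17 n \<tau> = p s \<tau> * c s * g \<tau>" if "Im \<tau> > 0" for \<tau>
    proof -
      have "klein34 s 17 n \<tau> = klein (0 + of_int l) (b + of_int 0) \<tau>"
        by (simp add: klein34_def b_def l field_simps)
      also have "\<dots> = (ee (of_real (of_int l - of_int l * b) / 2) * ee (- of_real b / 2)) * theta (ee (of_real b)) (ee \<tau>)"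
        using klein_shift[OF that, of 0 l b 0] by (simp add: klein_theta)
      also have "ee (of_real (of_int l - of_int l * b) / 2) * ee (- of_real b / 2) = c s"
        using False unfolding c_def b_def by (simp only: if_False ee_add[symmetric])
          (intro arg_cong[of _ _ ee], simp add: l field_simps)
      finally show ?thesis unfolding g(2)[OF that] using False by (simp add: p_def b_def)
    qed
    ultimately show ?thesis using near1_mono[of "1/2" 1 g] by auto
  qed
  then obtain g where g: "\<And>s. near1 (1/2) (g s)" "\<And>s \<tau>. Im \<tau> > 0 \<Longrightarrow> klein34 s 17 n \<tau> = p s \<tau> * c s * g s \<tau>"
    by metis
  define G where "G = (\<lambda>\<tau>. (\<Prod>s\<in>num_set. g s \<tau>) / (\<Prod>s\<in>den_set. g s \<tau>))"
  have G: "near1 (1/2) G" unfolding G_def by (intro near1_divide near1_prod g) auto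
  have kquot: "kquot 17 n \<tau> = kquot_17_const n * G \<tau>" if "Im \<tau> > 0" for \<tau>
  proof -
    define w where "w = (\<Prod>l\<in>{1, 2, 4, 8}. 1 - ee (of_int (l * n) / 17))"
    have pn: "(\<Prod>s\<in>num_set. p s \<tau>) = ee (- \<tau> / 8) ^ 4"
      by (simp add: num_set_def p_def power_numeral_reduce)
    have pd: "(\<Prod>s\<in>den_set. p s \<tau>) = ee (- \<tau> / 8) ^ 4 * w"
      by (simp add: den_set_def p_def w_def power_numeral_reduce)
    \<comment> \<open>Over \<open>num_set\<close> the sums of \<open>s - 1\<close> and
      \<open>s * s\<close> are 22 and 204. In \<open>B\<close> they are 34 and 476 for the odd
      elements of \<open>den_set\<close>; the even ones give the sums 30, 340 and 60 of
      \<open>s\<close>, \<open>s * s\<close> and \<open>2 * s\<close>.\<close>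
    define A where "A = (of_int (34 * 22 - 204 * n) / 136 :: complex)"
    have cn: "(\<Prod>s\<in>num_set. c s) = ee A"
      unfolding A_def by (simp add: num_set_def c_def flip: ee_add) 
         (intro arg_cong[of _ _ ee], simp add: field_simps)
    define B where "B = (of_int (34 * 34 - 476 * n + 34 * 30 - 340 * n - 60 * n) / 136 :: complex)"
    have cd: "(\<Prod>s\<in>den_set. c s) = ee B"
      unfolding B_def by (simp add: den_set_def c_def flip: ee_add) 
         (intro arg_cong[of _ _ ee], simp add: field_simps)
    have "ee A / ee B = ee (1/2 + (- of_int n / 17))"
      unfolding ee_diff[symmetric] A_def B_def
      by (rule ee_cong[of _ _ "- 11 + 5 * n"]) (simp add: field_simps)
    also have "\<dots> = - ee (- of_int n / 17)" by (simp only: ee_add ee_half) simp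
    finally have AB: "ee A / ee B = - ee (- of_int n / 17)" .
    have "kquot 17 n \<tau> = (ee A / ee B) / w * G \<tau>"
      unfolding kquot_def g(2)[OF that] prod.distrib pn pd cn cd G_def by (simp add: field_simps)
    thus ?thesis by (simp add: AB kquot_17_const_def w_def)
  qed
  have "(\<lambda>\<tau>. kquot_17_const n * (G \<tau> - 1)) \<in> bigq (1/2)"
    using G by (intro bigq_cmult) (simp add: near1_def)
  hence "(\<lambda>\<tau>. kquot_17_const n * (G \<tau> - 1)) \<in> bigq (12/34)" by (rule bigq_mono[rotated]) simp
  thus ?thesis by (rule bigq_cong)
    (use eventually_ioo[of 0] in eventually_elim, simp add: kquot algebra_simps)
qed

text \<open>Put \<open>y = - Z\<close>, a 17th root of unity. For odd \<open>s\<close> and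
  \<open>y\<close> other than 1,
  \<open>1 - Z ^ s = 1 + y ^ s = (1 - y ^ (2 * s)) / (1 - y ^ s)\<close> if 17 does not divide
  \<open>s\<close>. Modulo 17 and up to sign, doubling permutes both exponent sets, so each product
  is a power of \<open>y\<close> up to sign. The proof multiplies out and reduces the exponents by
  \<open>Z ^ 17 = -1\<close>.\<close>

lemma kquot_0_const_identity:
  fixes Z :: complex
  assumes "Z ^ 17 = - 1"
  shows "Z ^ 23 * ((1 - Z ^ 3) * (1 - Z ^ 5) * (1 - Z ^ 7) * (1 - Z ^ 11)) = 
     - ((1 - Z) * (1 - Z ^ 9) * (1 - Z ^ 13) * (1 - Z ^ 15))"
proof -
  have r: "Z ^ (17 + k) = - (Z ^ k)" "Z ^ (34 + k) = Z ^ k" for k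
    using assms power_mult[of Z 17 2] by (simp_all add: power_add)
  have "Z ^ 17 = - 1" "Z ^ 20 = - (Z ^ 3)" "Z ^ 22 = - (Z ^ 5)" "Z ^ 23 = - (Z ^ 6)" "Z ^ 24 = - (Z ^ 7)" 
    "Z ^ 26 = - (Z ^ 9)" "Z ^ 28 = - (Z ^ 11)" "Z ^ 29 = - (Z ^ 12)" "Z ^ 37 = Z ^ 3" "Z ^ 38 = Z ^ 4" 
    "Z ^ 18 = - Z" "Z ^ 21 = - (Z ^ 4)" "Z ^ 32 = - (Z ^ 15)"  "Z ^ 25 = - (Z ^ 8)"
    "Z ^ 19 = - (Z ^ 2)" "Z ^ 27 = - (Z ^ 10)"
    using r(1)[of 0] r(1)[of 3] r(1)[of 5] r(1)[of 6] r(1)[of 7] r(1)[of 9] r(1)[of 11] r(1)[of 12] r(2)[of 3] r(2)[of 4] r(1)[of 1]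
     r(1)[of 4] r(1)[of 15] r(1)[of 8] r(1)[of 2] r(1)[of 10] by simp_all
  thus ?thesis by (simp add: algebra_simps flip: power_add power_Suc power_Suc2)
qed

text \<open>All factors have order 0. The identity above removes the odd exponents from the constant
  term, and the even ones 2, 4, 8, 16 give the product in \<open>kquot_17_const\<close>.\<close>

lemma kquot_0_asymp:
  assumes "odd n" and n: "\<not> 17 dvd n"
  shows "(\<lambda>\<tau>. kquot 0 n \<tau> - kquot_17_const n) \<in> bigq (12 / 34)"
proof -
  define Z where "Z = ee (of_int n / 34)"
  have Zp: "Z ^ k = ee (of_int (int k * n) / 34)" for k
    by (simp add: Z_def ee_power)
  have "Z ^ 17 = - 1"
  proof -
    obtain k where "n = 2 * k + 1" using assms by (elim oddE)
    hence "Z ^ 17 = ee (1 / 2)" unfolding Zp by (intro ee_cong[of _ _ k]) (simp add: field_simps)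
    thus ?thesis by (simp add: ee_half)
  qed
  note Zid = kquot_0_const_identity[OF this]
  have Zne: "Z ^ k \<noteq> 1" if "\<not> 17 dvd k" for k
  proof
    assume "Z ^ k = 1"
    then obtain i :: int where "of_int (int k * n) / 34 = (of_int i :: complex)"
      unfolding Zp ee_eq_1_iff by blast
    hence "of_int (int k * n) = (of_int (34 * i) :: complex)" by simp
    hence "int k * n = 34 * i" by (simp only: of_int_eq_iff)
    hence "17 dvd int k * n" by simp
    moreover have "prime (17::int)" by simp
    ultimately have "17 dvd int k \<or> 17 dvd n" using prime_dvd_mult_iff by blast
    thus False using that n int_dvd_int_iff[of 17 k] by auto
  qed
  obtain g where g: "\<And>c. near1 1 (g c)" "\<And>c \<tau>. Im \<tau> > 0 \<Longrightarrow> theta (ee (of_real c)) (ee \<tau>) = (1 - ee (of_real c)) * g c \<tau>"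
    using theta_const_near1 by metis
  define G where "G = (\<lambda>\<tau>. (\<Prod>s\<in>num_set. g (of_int (s * n) / 34) \<tau>) / (\<Prod>s\<in>den_set. g (of_int (s * n) / 34) \<tau>))"
  have G: "near1 1 G" unfolding G_def by (intro near1_divide near1_prod g) auto
  have kquot: "kquot 0 n \<tau> = kquot_17_const n * G \<tau>" if "Im \<tau> > 0" for \<tau>
  proof -
    have th: "theta (ee (of_int s * ((of_int 0 * \<tau> + of_int n) / 34))) (ee \<tau>) = 
        (1 - ee (of_int (s * n) / 34)) * g (of_int (s * n) / 34) \<tau>" for s
      using g(2)[OF that, of "of_int (s * n) / 34"] by simp
    have "kquot 0 n \<tau> = Z ^ 21 * (\<Prod>s\<in>num_set. 1 - ee (of_int (s * n) / 34)) / (\<Prod>s\<in>den_set. 1 - ee (of_int (s * n) / 34)) * G \<tau>"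
      unfolding kquot_theta th prod.distrib G_def Zp by simp
    also have "(\<Prod>s\<in>num_set. 1 - ee (of_int (s * n) / 34)) = (1 - Z ^ 3) * (1 - Z ^ 5) * (1 - Z ^ 7) * (1 - Z ^ 11)"
      by (simp add: num_set_def Zp)
    also have "(\<Prod>s\<in>den_set. 1 - ee (of_int (s * n) / 34)) = 
        ((1 - Z) * (1 - Z ^ 9) * (1 - Z ^ 13) * (1 - Z ^ 15)) * ((1 - Z ^ 2) * (1 - Z ^ 4) * (1 - Z ^ 8) * (1 - Z ^ 16))"
      by (simp add: den_set_def Zp) (simp add: Z_def)
    also have "Z ^ 21 * ((1 - Z ^ 3) * (1 - Z ^ 5) * (1 - Z ^ 7) * (1 - Z ^ 11)) / \<dots> = 
       - (1 / Z ^ 2) / ((1 - Z ^ 2) * (1 - Z ^ 4) * (1 - Z ^ 8) * (1 - Z ^ 16))"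
    proof -
      define D where "D = (1 - Z) * (1 - Z ^ 9) * (1 - Z ^ 13) * (1 - Z ^ 15)"
      have D: "D \<noteq> 0" using Zne[of 1] Zne[of 9] Zne[of 13] Zne[of 15] by (simp add: D_def)
      have "Z \<noteq> 0" by (simp add: Z_def)
      define X where "X = Z ^ 21 * ((1 - Z ^ 3) * (1 - Z ^ 5) * (1 - Z ^ 7) * (1 - Z ^ 11))"
      \<comment> \<open>The prefactor of \<open>kquot_theta\<close> at \<open>m = 0\<close> is
        \<open>Z ^ 21\<close>; the two powers missing from 23 become \<open>ee (- n / 17)\<close> in
        the constant.\<close>
      have "Z ^ 2 * X = - D"
        using Zid by (simp only: mult.assoc[symmetric] power_add[symmetric] D_def X_def) simp
      moreover have "X = (Z ^ 2 * X) / Z ^ 2" using \<open>Z \<noteq> 0\<close> by simp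
      ultimately have "X = - D / Z ^ 2" by simp
      thus ?thesis using D unfolding D_def[symmetric] X_def[symmetric] by simp
    qed
    also have "1 / Z ^ 2 = ee (- of_int n / 17)"
      unfolding Zp ee_minus[symmetric] by simp
    also have "(1 - Z ^ 2) * (1 - Z ^ 4) * (1 - Z ^ 8) * (1 - Z ^ 16) = (\<Prod>l\<in>{1, 2, 4, 8}. 1 - ee (of_int (l * n) / 17))"
      unfolding Zp by (simp add: mult.assoc)
    finally show ?thesis by (simp add: kquot_17_const_def)
  qed
  have "(\<lambda>\<tau>. kquot_17_const n * (G \<tau> - 1)) \<in> bigq 1"
    using G by (intro bigq_cmult) (simp add: near1_def)
  hence "(\<lambda>\<tau>. kquot_17_const n * (G \<tau> - 1)) \<in> bigq (12/34)" by (rule bigq_mono[rotated]) simp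
  thus ?thesis by (rule bigq_cong)
    (use eventually_ioo[of 0] in eventually_elim, simp add: kquot algebra_simps)
qed

section \<open>Cancellation of the poles at all cusps\<close>

lemma sum_periodic_reindex:
  fixes f :: "int \<Rightarrow> 'a :: comm_monoid_add"
  assumes per: "\<And>j j'. [j = j'] (mod 34) \<Longrightarrow> f j = f j'" and c: "coprime c 34"
  shows "(\<Sum>j\<in>{0..<34}. f (c * j + k)) = (\<Sum>j\<in>{0..<34}. f j)"
proof -
  define h where "h = (\<lambda>j. (c * j + k) mod 34)"
  have inj: "inj_on h {0..<34}"
  proof (rule inj_onI)
    fix x y assume xy: "x \<in> {0..<34}" "y \<in> {0..<34}" "h x = h y"
    hence "[c * x + k = c * y + k] (mod 34)" by (simp add: h_def cong_def)
    hence "[c * x = c * y] (mod 34)" by (simp add: cong_add_rcancel)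
    hence "[x = y] (mod 34)" using c by (simp add: cong_mult_lcancel)
    thus "x = y" using xy by (simp add: cong_def)
  qed
  have "h ` {0..<34} \<subseteq> {0..<34}" by (auto simp: h_def)
  hence "h ` {0..<34} = {0..<34}" by (rule endo_inj_surj[OF finite_atLeastLessThan_int _ inj])
  hence "bij_betw h {0..<34} {0..<34}" using inj by (simp add: bij_betw_def)
  hence "(\<Sum>j\<in>{0..<34}. f (h j)) = (\<Sum>j\<in>{0..<34}. f j)" by (rule sum.reindex_bij_betw)
  moreover have "f (h j) = f (c * j + k)" for j by (rule per) (simp add: h_def)
  ultimately show ?thesis by simp
qed

text \<open>The image of \<open>coset_sum e 1 0 0 1\<close> under the modular substitution with rows \<open>(a, b)\<close> and \<open>(c, d)\<close>.
  The original selects the terms with index \<open>22 - e\<close> modulo 34 of the generating function.\<close>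

definition coset_sum :: "int \<Rightarrow> int \<Rightarrow> int \<Rightarrow> int \<Rightarrow> int \<Rightarrow> complex \<Rightarrow> complex" where
  "coset_sum e a b c d \<tau> = (\<Sum>j\<in>{0..<34}. ee (of_int (e * j) / 34) * kquot (a + j * c) (b + j * d) \<tau>)"

lemma ee_34_cong: "[k = l] (mod 34) \<Longrightarrow> ee (of_int k / 34) = ee (of_int l / 34)"
proof -
  assume "[k = l] (mod 34)"
  then obtain i where "l = k + 34 * i" by (metis cong_iff_lin)
  thus ?thesis by (intro ee_cong[of _ _ "- i"]) (simp add: field_simps)
qed

lemma coset_sum_cong:
  assumes "Im \<tau> > 0" "[a = a'] (mod 34)" "[b = b'] (mod 34)" "[c = c'] (mod 34)" "[d = d'] (mod 34)"
  shows "coset_sum e a b c d \<tau> = coset_sum e a' b' c' d' \<tau>"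
  unfolding coset_sum_def
proof (intro sum.cong refl arg_cong2[of _ _ _ _ "(*)"])
  fix j :: int
  show "kquot (a + j * c) (b + j * d) \<tau> = kquot (a' + j * c') (b' + j * d') \<tau>"
    by (intro kquot_cong assms cong_add cong_mult cong_refl)
qed

text \<open>Re-indexing \<open>j\<close> absorbs a multiple of the second row added to the first, at
  the cost of a root of unity. So \<open>a\<close> can be normalised at each cusp.\<close>

lemma coset_sum_shift:
  assumes "Im \<tau> > 0"
  shows "coset_sum e (a + k * c) (b + k * d) c d \<tau> = ee (of_int (- e * k) / 34) * coset_sum e a b c d \<tau>"
proof -
  define f where "f = (\<lambda>j. ee (of_int (e * j) / 34) * kquot (a + j * c) (b + j * d) \<tau>)"
  have per: "f j = f j'" if "[j = j'] (mod 34)" for j j'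
    unfolding f_def using that
    by (intro arg_cong2[of _ _ _ _ "(*)"] kquot_cong assms ee_34_cong cong_add cong_mult cong_refl)
  have "ee (of_int (- e * k) / 34) * coset_sum e a b c d \<tau> = ee (of_int (- e * k) / 34) * (\<Sum>j\<in>{0..<34}. f (1 * j + k))"
    by (subst sum_periodic_reindex[OF per]) (simp_all add: coset_sum_def f_def)
  also have "\<dots> = (\<Sum>j\<in>{0..<34}. ee (of_int (- e * k) / 34) * f (1 * j + k))" by (rule sum_distrib_left)
  also have "\<dots> = coset_sum e (a + k * c) (b + k * d) c d \<tau>"
    unfolding coset_sum_def
  proof (intro sum.cong refl)
    fix j :: int
    have "ee (of_int (- e * k) / 34) * ee (of_int (e * (1 * j + k)) / 34) = ee (of_int (e * j) / 34)"
      unfolding ee_add[symmetric] by (intro arg_cong[of _ _ ee]) (simp add: field_simps)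
    thus "ee (of_int (- e * k) / 34) * f (1 * j + k) = ee (of_int (e * j) / 34) * kquot (a + k * c + j * c) (b + k * d + j * d) \<tau>"
      by (simp add: f_def mult.assoc[symmetric]) (simp add: algebra_simps)
  qed
  finally show ?thesis ..
qed

lemma coset_sum_shift_bigo:
  assumes "coset_sum e (a + k * c) (b + k * d) c d \<in> bigq t"
  shows "coset_sum e a b c d \<in> bigq t"
proof -
  have 1: "ee (of_int (e * k) / 34) * ee (of_int (- e * k) / 34) = 1" by (simp add: ee_add[symmetric])
  have "(\<lambda>\<tau>. ee (of_int (e * k) / 34) * coset_sum e (a + k * c) (b + k * d) c d \<tau>) \<in> bigq t"
    by (rule bigq_cmult[OF assms])
  thus ?thesis
    by (rule bigq_cong)
       (use eventually_ioo[of 0] in eventually_elim, simp only: coset_sum_shift mult.assoc[symmetric] 1 mult_1)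
qed

lemma coset_sum_T: "coset_sum e a b c d (\<tau> + of_int k) = coset_sum e a (b + k * a) c (d + k * c) \<tau>"
  by (simp add: coset_sum_def kquot_T_int algebra_simps)

lemma coset_sum_S:
  assumes "k \<noteq> 0" "\<And>a b. klein a b (- 1 / \<tau>) = k * klein b (- a) \<tau>"
  shows "coset_sum e a b c d (- 1 / \<tau>) = coset_sum e b (- a) d (- c) \<tau> / k ^ 4"
  unfolding coset_sum_def kquot_S[OF assms] by (simp add: sum_divide_distrib)

text \<open>The representative of \<open>2 / m\<close> modulo 34 that is up to sign a power of 9, so that
  \<open>kquot_9\<close> relates \<open>kquot m\<close> to \<open>kquot 2\<close>. Only used for \<open>m\<close> in \<open>even_QR\<close>.\<close>

definition two_div :: "int \<Rightarrow> int" where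
  "two_div m = (let r = m mod 34 in if r = 2 then 1 else if r = 4 then 9 else if r = 8 then 13 else if r = 16 then 15
     else if r = 32 then -1 else if r = 30 then -9 else if r = 26 then -13 else -15)"

text \<open>The sign \<open>(-1) ^ i\<close>, where \<open>two_div m\<close> is up to sign
  \<open>9 ^ i\<close> modulo 34 with \<open>i\<close> from 0 to 3; each application of
  \<open>kquot_9\<close> contributes one factor.\<close>

definition two_div_sign :: "int \<Rightarrow> complex" where
  "two_div_sign m = (if m mod 34 \<in> {2, 8, 26, 32} then 1 else -1)"

lemma kquot_two_div:
  assumes tau: "Im \<tau> > 0" and m: "m mod 34 \<in> even_QR"
  shows "kquot m n \<tau> = two_div_sign m * kquot 2 (two_div m * n) \<tau>"
proof -
  have 9: "kquot m' n' \<tau> = - kquot m n \<tau>" if "[9 * m = m'] (mod 34)" "[9 * n = n'] (mod 34)" for m n m' n'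
    using kquot_9[OF tau, of m n] kquot_cong[OF tau that] by simp
  have F4: "kquot 4 n \<tau> = - kquot 2 (9 * n) \<tau>" for n using 9[of 4 2 n "9 * n"] by (simp add: cong_def)
  have c2: "kquot 2 n \<tau> = kquot 2 n' \<tau>" if "[n = n'] (mod 34)" for n n'
    by (rule kquot_cong[OF tau cong_refl that])
  have F8: "kquot 8 n \<tau> = kquot 2 (13 * n) \<tau>" for n
  proof -
    have "kquot 4 (9 * n) \<tau> = - kquot 8 n \<tau>" by (rule 9) (simp_all add: cong_def)
    moreover have "kquot 2 (9 * (9 * n)) \<tau> = kquot 2 (13 * n) \<tau>" by (rule c2) (simp add: cong_iff_dvd_diff)
    ultimately show ?thesis using F4[of "9 * n"] by simp
  qed
  have F16: "kquot 16 n \<tau> = - kquot 2 (15 * n) \<tau>" for n 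
  proof -
    have "kquot 8 (9 * n) \<tau> = - kquot 16 n \<tau>" by (rule 9) (simp_all add: cong_def)
    moreover have "kquot 2 (13 * (9 * n)) \<tau> = kquot 2 (15 * n) \<tau>" by (rule c2) (simp add: cong_iff_dvd_diff)
    ultimately have "- kquot 16 n \<tau> = kquot 2 (15 * n) \<tau>" using F8[of "9 * n"] by simp
    thus ?thesis by (metis add.inverse_inverse)
  qed
  have neg: "kquot (34 - k) n \<tau> = kquot k (- n) \<tau>" for k n
  proof -
    have "kquot (34 - k) n \<tau> = kquot (- k) (- (- n)) \<tau>" by (rule kquot_cong[OF tau]) (simp_all add: cong_iff_dvd_diff)
    thus ?thesis by (simp only: kquot_minus[OF tau])
  qed
  have "kquot m n \<tau> = kquot (m mod 34) n \<tau>" by (rule kquot_cong[OF tau]) auto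
  also consider "m mod 34 = 2" | "m mod 34 = 4" | "m mod 34 = 8" | "m mod 34 = 16" |
     "m mod 34 = 18" | "m mod 34 = 26" | "m mod 34 = 30" | "m mod 34 = 32"
    using m unfolding even_QR_def by blast
  hence "kquot (m mod 34) n \<tau> = two_div_sign m * kquot 2 (two_div m * n) \<tau>"
  proof cases
    case 1 thus ?thesis by (simp add: two_div_sign_def two_div_def)
  next
    case 2 thus ?thesis using F4[of n] by (simp add: two_div_sign_def two_div_def)
  next
    case 3 thus ?thesis using F8[of n] by (simp add: two_div_sign_def two_div_def)
  next
    case 4 thus ?thesis using F16[of n] by (simp add: two_div_sign_def two_div_def)
  next
    case 5 thus ?thesis using neg[of 16 n] F16[of "- n"] by (simp add: two_div_sign_def two_div_def)
  next
    case 6 thus ?thesis using neg[of 8 n] F8[of "- n"] by (simp add: two_div_sign_def two_div_def)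
  next
    case 7 thus ?thesis using neg[of 4 n] F4[of "- n"] by (simp add: two_div_sign_def two_div_def)
  next
    case 8 thus ?thesis using neg[of 2 n] by (simp add: two_div_sign_def two_div_def)
  qed
  finally show ?thesis .
qed

text \<open>Principal relative to the threshold: the terms of \<open>kquot m n\<close> of order
  below 12/34, for \<open>m\<close> in \<open>even_QR\<close> and odd \<open>n\<close>, carried over
  from \<open>m = 2\<close>.\<close>

definition princ_part :: "int \<Rightarrow> int \<Rightarrow> complex \<Rightarrow> complex" where
  "princ_part m n \<tau> = two_div_sign m * (ee (6 * \<tau> / 34) * ee (of_int (3 * two_div m * n) / 34) + ee (10 * \<tau> / 34) * ee (of_int (5 * two_div m * n) / 34))"

lemma kquot_princ:
  assumes m: "m mod 34 \<in> even_QR" and n: "odd n"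
  shows "(\<lambda>\<tau>. kquot m n \<tau> - princ_part m n \<tau>) \<in> bigq (12 / 34)"
proof -
  have "odd (two_div m * n)" using n by (auto simp: two_div_def Let_def)
  from bigq_cmult[OF kquot_2_asymp[OF this], of "two_div_sign m"] show ?thesis
  proof (rule bigq_cong)
    show "\<forall>\<^sub>F \<tau> in ioo. two_div_sign m * (kquot 2 (two_div m * n) \<tau> - (ee (3 * ((2 * \<tau> + of_int (two_div m * n)) / 34)) + 
      ee (5 * ((2 * \<tau> + of_int (two_div m * n)) / 34)))) = kquot m n \<tau> - princ_part m n \<tau>"
      using eventually_ioo[of 0]
    proof eventually_elim
      case (elim \<tau>)
      have "ee (3 * ((2 * \<tau> + of_int (two_div m * n)) / 34)) = ee (6 * \<tau> / 34) * ee (of_int (3 * two_div m * n) / 34)"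
        "ee (5 * ((2 * \<tau> + of_int (two_div m * n)) / 34)) = ee (10 * \<tau> / 34) * ee (of_int (5 * two_div m * n) / 34)"
        unfolding ee_add[symmetric] by (intro arg_cong[of _ _ ee]; simp add: field_simps)+
      thus ?case unfolding princ_part_def kquot_two_div[OF elim m] by (simp only: right_diff_distrib)
    qed
  qed
qed

section \<open>Cancellation below order 12/34, cusp by cusp\<close>

lemma sum_roots_17:
  assumes "\<not> 17 dvd t"
  shows "(\<Sum>i\<in>{0..<17::nat}. ee (of_int (int i * t) / 17)) = 0"
proof -
  define w where "w = ee (of_int t / 17)"
  have "w \<noteq> 1"
  proof
    assume "w = 1"
    then obtain i :: int where "of_int t / 17 = (of_int i :: complex)" unfolding w_def ee_eq_1_iff by blast
    hence "of_int t = (of_int (17 * i) :: complex)" by simp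
    hence "t = 17 * i" by (simp only: of_int_eq_iff)
    thus False using assms by simp
  qed
  moreover have "ee (of_int (int i * t) / 17) = w ^ i" for i by (simp add: w_def ee_power)
  moreover have "w ^ 17 = 1" by (simp add: w_def ee_power)
  ultimately show ?thesis by (simp add: atLeast0LessThan geometric_sum)
qed

text \<open>The values \<open>22 - n\<close> for the four classes of \<open>n\<close>. Modulo 17
  they are 3 times the quartic residues 1, 4, 13, 16.\<close>

definition char_exps :: "int set" where "char_exps = {3, 5, -3, -5}"

lemma kquot_term_bigo: 
  assumes "\<not> 17 dvd m" "m mod 34 \<notin> even_QR"
  shows "(\<lambda>\<tau>. c * kquot m n \<tau>) \<in> bigq (12 / 34)"
  by (rule bigq_cmult[OF kquot_bigo_12[OF assms]])

lemma odd_not_even_QR: "odd m \<Longrightarrow> m mod 34 \<notin> even_QR"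
  by (auto simp: even_QR_def) presburger+

text \<open>Nothing has to cancel: every first index \<open>a + j * c\<close> is congruent to
  \<open>a\<close>, which the determinant condition makes prime to 34.\<close>

lemma coset_sum_bigo_34_dvd:
  assumes "[a * d - b * c = 1] (mod 34)" "34 dvd c"
  shows "coset_sum e a b c d \<in> bigq (12 / 34)"
proof -
  obtain c' where c': "c = 34 * c'" using assms(2) by blast
  obtain k where k: "a * d - b * c = 1 + 34 * k" using assms(1) by (metis cong_iff_lin cong_sym)
  have "odd a" using k c' by (metis dvd_diff dvd_mult dvd_mult2 even_mult_iff even_numeral odd_one even_add)
  moreover have "\<not> 17 dvd a" 
  proof
    assume "17 dvd a"
    then obtain a' where "a = 17 * a'" by blast
    hence "17 * (a' * d - b * 2 * c' - 2 * k) = 1" using k c' by (simp add: algebra_simps)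
    thus False by presburger
  qed
  ultimately show ?thesis unfolding coset_sum_def
  proof (intro bigq_sum kquot_term_bigo odd_not_even_QR)
    fix j :: int
    assume a: "odd a" "\<not> 17 dvd a"
    have "a + j * c = a + 17 * (2 * j * c')" by (simp add: c')
    thus "\<not> 17 dvd a + j * c" using a(2) by (metis dvd_add_times_triv_right_iff mult.commute)
    show "odd (a + j * c)" using a(1) by (simp add: c')
  qed
qed

lemma prime_17_int: "prime (17 :: int)" by simp

text \<open>After a shift 17 divides \<open>a\<close>. The determinant condition makes
  \<open>a\<close> and hence all first indices odd, and only \<open>j = 0\<close> and
  \<open>j = 17\<close> give multiples of 17. Their coefficients are 1 and -1, as \<open>e\<close>
  is odd, and their constants agree because the second indices agree modulo 17.\<close>

lemma coset_sum_bigo_even: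
  assumes det: "[a * d - b * c = 1] (mod 34)" and c: "even c" "\<not> 17 dvd c" and e: "odd e"
  shows "coset_sum e a b c d \<in> bigq (12 / 34)"
proof -
  have main: "coset_sum e a b c d \<in> bigq (12 / 34)" if det: "[a * d - b * c = 1] (mod 34)" and a17: "17 dvd a" for a b
  proof -
    obtain k where k: "a * d - b * c = 1 + 34 * k" using det by (metis cong_iff_lin cong_sym)
    obtain c' where c': "c = 2 * c'" using c by blast
    obtain a' where a': "a = 17 * a'" using a17 by blast
    have ad: "odd a \<and> odd d"
    proof (rule ccontr)
      assume "\<not> (odd a \<and> odd d)"
      hence "even (a * d - b * c)" using c by auto
      thus False unfolding k by simp
    qed
    define f where "f = (\<lambda>j \<tau>. ee (of_int (e * j) / 34) * kquot (a + j * c) (b + j * d) \<tau>)"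
    have rest: "f j \<in> bigq (12 / 34)" if "j \<in> {0..<34} - {0, 17}" for j
      unfolding f_def
    proof (intro kquot_term_bigo odd_not_even_QR)
      show "odd (a + j * c)" using ad c by simp
      have "\<not> 17 dvd j" using that by auto
      hence "\<not> 17 dvd j * c" using c prime_dvd_mult_iff[OF prime_17_int] by blast
      thus "\<not> 17 dvd a + j * c" using a17 by (simp add: dvd_add_right_iff)
    qed
    have "coset_sum e a b c d \<tau> = (\<Sum>j\<in>{0..<34} - {0, 17}. f j \<tau>) + (f 0 \<tau> + f 17 \<tau>)" for \<tau>
      unfolding coset_sum_def f_def[symmetric]
      by (subst sum.subset_diff[of "{0, 17}"]) (auto simp: f_def)
    moreover have "(\<lambda>\<tau>. f 0 \<tau> + f 17 \<tau>) \<in> bigq (12 / 34)"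
    proof -
      have "kquot_17_const (b + 17) = kquot_17_const b" by (rule kquot_17_const_cong) (simp add: cong_def)
      with bigq_diff[OF kquot_17_asymp[of b] kquot_17_asymp[of "b + 17"]]
      have "(\<lambda>\<tau>. kquot 17 b \<tau> - kquot 17 (b + 17) \<tau>) \<in> bigq (12 / 34)" by simp
      thus ?thesis
      proof (rule bigq_cong)
        show "\<forall>\<^sub>F \<tau> in ioo. kquot 17 b \<tau> - kquot 17 (b + 17) \<tau> = f 0 \<tau> + f 17 \<tau>"
          using eventually_ioo[of 0]
        proof eventually_elim
          case (elim \<tau>)
          have h1: "[a = 17] (mod 34)"
          proof -
            from ad obtain a'' where "a' = 2 * a'' + 1" unfolding a' by (auto elim: oddE)
            thus ?thesis by (simp add: a' cong_iff_dvd_diff)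
          qed
          have h2: "[a + 17 * c = 17] (mod 34)"
            using cong_add[OF h1, of "17 * c" 0] by (simp add: c' cong_iff_dvd_diff)
          have h3: "[b + 17 * d = b + 17] (mod 34)"
          proof -
            obtain d' where "d = 2 * d' + 1" using ad by (auto elim: oddE)
            thus ?thesis by (simp add: cong_iff_dvd_diff)
          qed
          have h4: "ee (of_int (e * 17) / 34) = - 1"
          proof -
            obtain e' where "e = 2 * e' + 1" using e by (auto elim: oddE)
            hence "ee (of_int (e * 17) / 34) = ee (1 / 2)" by (intro ee_cong[of _ _ e']) (simp add: field_simps)
            thus ?thesis by (simp add: ee_half)
          qed
          have "f 0 \<tau> = kquot 17 b \<tau>" unfolding f_def using kquot_cong[OF elim h1 cong_refl] by simp
          moreover have "f 17 \<tau> = - kquot 17 (b + 17) \<tau>" unfolding f_def h4 using kquot_cong[OF elim h2 h3] by simp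
          ultimately show ?case by simp
        qed
      qed
    qed
    moreover have "(\<lambda>\<tau>. \<Sum>j\<in>{0..<34} - {0, 17}. f j \<tau>) \<in> bigq (12 / 34)"
      by (rule bigq_sum) (rule rest)
    ultimately show ?thesis using bigq_add[of "\<lambda>\<tau>. \<Sum>j\<in>{0..<34} - {0, 17}. f j \<tau>" "12 / 34" "\<lambda>\<tau>. f 0 \<tau> + f 17 \<tau>"]
      by presburger
  qed
  have "coprime c 17" using c(2) prime_imp_coprime[OF prime_17_int] by (simp add: coprime_commute)
  then obtain i where i: "[c * i = 1] (mod 17)" using cong_solve_coprime_int by blast
  define k where "k = - a * i"
  have "[c * i * a = 1 * a] (mod 17)" using i by (intro cong_mult cong_refl)
  hence "17 dvd a + k * c" unfolding k_def by (simp add: cong_iff_dvd_diff algebra_simps) (metis dvd_minus_iff minus_diff_eq)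
  moreover have "(a + k * c) * d - (b + k * d) * c = a * d - b * c" by (simp add: algebra_simps)
  ultimately have "coset_sum e (a + k * c) (b + k * d) c d \<in> bigq (12 / 34)" using det by (intro main) auto
  thus ?thesis by (rule coset_sum_shift_bigo)
qed

text \<open>After a shift \<open>a\<close> is even. Odd \<open>j\<close> give odd first indices
  prime to 17. Even \<open>j\<close> leave the first index fixed modulo 34 and move only the second,
  so the exponents 6 and 10 each carry a sum over all powers of one 17th root of unity, which
  differs from 1 by the choice of \<open>e\<close>.\<close>

lemma coset_sum_bigo_17:
  assumes det: "[a * d - b * c = 1] (mod 34)" and c: "[c = 17] (mod 34)" and e: "e \<in> char_exps"
  shows "coset_sum e a b c d \<in> bigq (12 / 34)"
proof -
  obtain c' where c': "c = 17 + 34 * c'" using c by (metis cong_iff_lin cong_sym)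
  have main: "coset_sum e a b c d \<in> bigq (12 / 34)" if det: "[a * d - b * c = 1] (mod 34)" and a: "even a" for a b
  proof -
    obtain k where k: "a * d - b * c = 1 + 34 * k" using det by (metis cong_iff_lin cong_sym)
    obtain k' where ad: "a * d = 1 + 17 * k'"
    proof
      show "a * d = 1 + 17 * (2 * k + b * (1 + 2 * c'))" using k c' by (simp add: algebra_simps)
    qed
    have a17: "\<not> 17 dvd a"
    proof
      assume "17 dvd a"
      then obtain a' where "a = 17 * a'" by blast
      hence "17 * (a' * d - k') = 1" using ad by (simp add: algebra_simps)
      thus False by presburger
    qed
    have b: "odd b"
    proof
      assume "even b"
      hence "even (a * d - b * c)" using a by simp
      thus False unfolding k by simp
    qed
    define f where "f = (\<lambda>j \<tau>. ee (of_int (e * j) / 34) * kquot (a + j * c) (b + j * d) \<tau>)"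
    have nd: "\<not> 17 dvd a + j * c" for j
    proof -
      have "a + j * c = a + 17 * (j * (1 + 2 * c'))" by (simp add: c' algebra_simps)
      thus ?thesis using a17 by (metis dvd_add_times_triv_right_iff mult.commute)
    qed
    show ?thesis
    proof (cases "a mod 34 \<in> even_QR")
      case False
      have "f j \<in> bigq (12 / 34)" for j
        unfolding f_def
      proof (intro kquot_term_bigo nd)
        show "(a + j * c) mod 34 \<notin> even_QR"
        proof (cases "odd j")
          case True
          thus ?thesis using a c' by (intro odd_not_even_QR) auto
        next
          case even: False
          then obtain i where "j = 2 * i" by auto
          hence "[a + j * c = a] (mod 34)" using c' by (simp add: cong_iff_dvd_diff algebra_simps)
          thus ?thesis using False by (simp add: cong_def)
        qed
      qed
      moreover have "coset_sum e a b c d = (\<lambda>\<tau>. \<Sum>j\<in>{0..<34}. f j \<tau>)"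
        by (rule ext) (simp only: coset_sum_def f_def)
      ultimately show ?thesis by (simp only:) (rule bigq_sum)
    next
      case True
      define A where "A = {j \<in> {0..<34::int}. even j}"
      define h where "h = (\<lambda>j \<tau>. ee (of_int (e * j) / 34) * princ_part a (b + j * d) \<tau>)"
      have rest: "(\<lambda>\<tau>. f j \<tau> - (if j \<in> A then h j \<tau> else 0)) \<in> bigq (12 / 34)" if j: "j \<in> {0..<34}" for j
      proof (cases "j \<in> A")
        case False
        hence "f j \<in> bigq (12 / 34)"
          unfolding f_def using j a c' by (intro kquot_term_bigo nd odd_not_even_QR) (auto simp: A_def)
        thus ?thesis using False by simp
      next
        case jA: True
        then obtain i where i: "j = 2 * i" by (auto simp: A_def)
        have "odd (b + j * d)" using b i by simp
        from bigq_cmult[OF kquot_princ[OF True this], of "ee (of_int (e * j) / 34)"]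
        show ?thesis
        proof (rule bigq_cong)
          have "[a + j * c = a] (mod 34)" using c' i by (simp add: cong_iff_dvd_diff algebra_simps)
          thus "\<forall>\<^sub>F \<tau> in ioo. ee (of_int (e * j) / 34) * (kquot a (b + j * d) \<tau> - princ_part a (b + j * d) \<tau>) = 
              f j \<tau> - (if j \<in> A then h j \<tau> else 0)"
            using eventually_ioo[of 0] 
            by (auto elim!: eventually_mono simp: f_def h_def jA right_diff_distrib kquot_cong[OF _ _ cong_refl])
        qed
      qed
      have h0: "(\<Sum>j\<in>A. h j \<tau>) = 0" for \<tau>
      proof -
        have A: "A = (\<lambda>i. 2 * int i) ` {0..<17::nat}"
        proof -
          have "j \<in> A \<longleftrightarrow> j \<in> (\<lambda>i. 2 * int i) ` {0..<17::nat}" for j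
          proof
            assume "j \<in> A"
            then obtain i where i: "j = 2 * i" "0 \<le> i" "i < 17" by (auto simp: A_def)
            thus "j \<in> (\<lambda>i. 2 * int i) ` {0..<17::nat}" by (intro image_eqI[of _ _ "nat i"]) auto
          qed (auto simp: A_def)
          thus ?thesis by blast
        qed
        have root: "(\<Sum>j\<in>A. ee (of_int (e * j) / 34) * ee (of_int (r * two_div a * (b + j * d)) / 34)) = 0"
          if r: "r = 3 \<or> r = 5" for r
        proof -
          have "(\<Sum>j\<in>A. ee (of_int (e * j) / 34) * ee (of_int (r * two_div a * (b + j * d)) / 34)) = 
            (\<Sum>i\<in>{0..<17::nat}. ee (of_int (r * two_div a * b) / 34) * ee (of_int (int i * (e + r * two_div a * d)) / 17))"
            unfolding A by (subst sum.reindex) (auto simp: inj_on_def o_def ee_add[symmetric] field_simps intro!: sum.cong arg_cong[of _ _ ee])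
          also have "\<dots> = 0"
          proof -
            \<comment> \<open>Multiplication by \<open>a\<close> turns \<open>a * d\<close> into 1.
              Since \<open>a * two_div a\<close> is congruent to 2, divisibility would force
              \<open>e\<close> to be congruent to \<open>- 2 * r / a ^ 2\<close>, hence to 6, 7, 10
              or 11, and \<open>char_exps\<close> avoids these.\<close>
            have nd: "\<not> 17 dvd e + r * two_div a * d"
            proof
              assume "17 dvd e + r * two_div a * d"
              hence "17 dvd (e + r * two_div a * d) * a" by (rule dvd_mult2)
              also have "(e + r * two_div a * d) * a = e * a + r * two_div a * (a * d)"
                by (simp add: algebra_simps)
              also have "\<dots> = (e * a + r * two_div a) + 17 * (r * two_div a * k')"
                by (simp only: ad) (simp add: algebra_simps)
              finally have "17 dvd e * a + r * two_div a"
                using dvd_add_left_iff[OF dvd_triv_left] by blast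
              also have "e * a + r * two_div a = (e * (a mod 34) + r * two_div a) + 17 * (2 * e * (a div 34))"
              proof -
                have "e * a = e * (a mod 34) + 34 * (e * (a div 34))"
                  by (metis distrib_left mod_mult_div_eq mult.left_commute)
                thus ?thesis by simp
              qed
              finally have "17 dvd e * (a mod 34) + r * two_div a"
                using dvd_add_left_iff[OF dvd_triv_left] by blast
              thus False using True r e unfolding even_QR_def char_exps_def two_div_def by auto
            qed
            show ?thesis
              by (simp only: sum_distrib_left[symmetric] sum_roots_17[OF nd] mult_zero_right)
          qed
          finally show ?thesis .
        qed
        have "(\<Sum>j\<in>A. h j \<tau>) = two_div_sign a * (ee (6 * \<tau> / 34) * (\<Sum>j\<in>A. ee (of_int (e * j) / 34) * ee (of_int (3 * two_div a * (b + j * d)) / 34)) +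
            ee (10 * \<tau> / 34) * (\<Sum>j\<in>A. ee (of_int (e * j) / 34) * ee (of_int (5 * two_div a * (b + j * d)) / 34)))"
          unfolding h_def princ_part_def sum_distrib_left sum.distrib[symmetric] 
          by (intro sum.cong refl) (simp only: distrib_left mult_ac)
        thus ?thesis by (simp only: root[of 3, OF disjI1[OF refl]] root[of 5, OF disjI2[OF refl]] mult_zero_right add_0_right)
      qed
      have "(\<lambda>\<tau>. \<Sum>j\<in>{0..<34}. f j \<tau> - (if j \<in> A then h j \<tau> else 0)) \<in> bigq (12 / 34)"
        by (rule bigq_sum) (rule rest)
      moreover have "(\<Sum>j\<in>{0..<34}. f j \<tau> - (if j \<in> A then h j \<tau> else 0)) = coset_sum e a b c d \<tau>" for \<tau>
      proof -
        have "(\<Sum>j\<in>{0..<34}. if j \<in> A then h j \<tau> else 0) = (\<Sum>j\<in>A. h j \<tau>)"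
          by (subst sum.inter_restrict[symmetric]) (auto simp: A_def intro!: sum.cong)
        moreover have "coset_sum e a b c d \<tau> = (\<Sum>j\<in>{0..<34}. f j \<tau>)" by (simp only: coset_sum_def f_def)
        ultimately show ?thesis by (simp add: sum_subtractf h0)
      qed
      ultimately show ?thesis by simp
    qed
  qed
  show ?thesis
  proof (cases "even a")
    case True
    thus ?thesis by (intro main det)
  next
    case False
    have "(a + 1 * c) * d - (b + 1 * d) * c = a * d - b * c" by (simp add: algebra_simps)
    hence "coset_sum e (a + 1 * c) (b + 1 * d) c d \<in> bigq (12 / 34)" using det False c' by (intro main) auto
    thus ?thesis by (rule coset_sum_shift_bigo)
  qed
qed

lemma bigq_translate:
  assumes "f \<in> bigq t"
  shows "(\<lambda>\<tau>. f (\<tau> + of_int k)) \<in> bigq t"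
proof -
  obtain C where C: "eventually (\<lambda>\<tau>. norm (f \<tau>) \<le> C * exp (- (2 * pi * t * Im \<tau>))) ioo"
    using assms unfolding bigq_def by (auto simp: norm_ee_mult elim: landau_o.bigE)
  then obtain N where N: "\<And>\<tau>. Im \<tau> \<ge> N \<Longrightarrow> norm (f \<tau>) \<le> C * exp (- (2 * pi * t * Im \<tau>))"
    unfolding eventually_filtercomap_at_top_linorder by blast
  show ?thesis
  proof (rule bigq_I)
    show "\<forall>\<^sub>F \<tau> in ioo. norm (f (\<tau> + of_int k)) \<le> C * exp (- (2 * pi * t * Im \<tau>))"
      unfolding eventually_filtercomap_at_top_linorder
    proof (intro exI allI impI)
      fix \<tau> assume "N \<le> Im \<tau>"
      thus "norm (f (\<tau> + of_int k)) \<le> C * exp (- (2 * pi * t * Im \<tau>))"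
        using N[of "\<tau> + of_int k"] by simp
    qed
  qed
qed

text \<open>\<open>coset_sum e 0 n c 0\<close> for \<open>- c * n\<close> congruent to 1, with \<open>j * c\<close> as the summation variable.\<close>

definition full_sum :: "int \<Rightarrow> int \<Rightarrow> complex \<Rightarrow> complex" where
  "full_sum e n \<tau> = (\<Sum>m\<in>{0..<34}. ee (of_int (- e * m * n) / 34) * kquot m n \<tau>)"

text \<open>The indices 0 and 17 have coefficients 1 and -1 and the same constant term, so these
  constants cancel. The even residues contribute the exponents 6 and 10, whose coefficients cancel
  in pairs.\<close>

lemma full_sum_bigo:
  assumes n: "odd n" "\<not> 17 dvd n" and e: "e \<in> char_exps"
  shows "full_sum e n \<in> bigq (12 / 34)"
proof -
  define f where "f = (\<lambda>m \<tau>. ee (of_int (- e * m * n) / 34) * kquot m n \<tau>)"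
  define h where "h = (\<lambda>m \<tau>. ee (of_int (- e * m * n) / 34) * princ_part m n \<tau>)"
  have eQ: "even_QR \<subseteq> {0..<34}" "finite even_QR" "0 \<notin> even_QR" "17 \<notin> even_QR" by (auto simp: even_QR_def)
  have mod: "m mod 34 = m" if "m \<in> {0..<34::int}" for m using that by simp
  have rest: "f m \<in> bigq (12 / 34)" if m: "m \<in> {0..<34} - even_QR - {0, 17}" for m
    unfolding f_def
  proof (intro kquot_term_bigo)
    show "m mod 34 \<notin> even_QR" using m by (simp add: mod)
    show "\<not> 17 dvd m" using m by auto
  qed
  have qr: "(\<lambda>\<tau>. f m \<tau> - h m \<tau>) \<in> bigq (12 / 34)" if m: "m \<in> even_QR" for m
  proof -
    have "m mod 34 \<in> even_QR" using m eQ by (simp add: mod subset_iff)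
    from bigq_cmult[OF kquot_princ[OF this n(1)], of "ee (of_int (- e * m * n) / 34)"]
    show ?thesis by (simp only: f_def h_def right_diff_distrib)
  qed
  have "(\<lambda>\<tau>. kquot 0 n \<tau> - kquot 17 n \<tau>) \<in> bigq (12 / 34)"
    using bigq_diff[OF kquot_0_asymp[OF n] kquot_17_asymp[of n]] by simp
  moreover have "f 17 \<tau> = - kquot 17 n \<tau>" for \<tau>
  proof -
    have "odd (e * n)" using e n by (auto simp: char_exps_def)
    then obtain i where "e * n = 2 * i + 1" by (elim oddE)
    hence "- e * 17 * n = - 34 * i - 17" by (simp add: algebra_simps)
    hence "ee (of_int (- e * 17 * n) / 34) = ee (of_int (- 34 * i - 17) / 34)" by (simp only:)
    also have "\<dots> = ee (1 / 2)" by (rule ee_cong[of _ _ "- i - 1"]) (simp add: field_simps)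
    finally have "ee (of_int (- e * 17 * n) / 34) = ee (1 / 2)" .
    thus ?thesis by (simp add: f_def ee_half)
  qed
  ultimately have f017: "(\<lambda>\<tau>. f 0 \<tau> + f 17 \<tau>) \<in> bigq (12 / 34)" by (simp add: f_def)
  have h0: "(\<Sum>m\<in>even_QR. h m \<tau>) = 0" for \<tau>
  proof -
    define E where "E = (\<lambda>k. ee (of_int (k * n) / 34))"
    have Emod: "E k = E (k mod 34)" for k
      unfolding E_def by (intro ee_34_cong cong_mult cong_refl) (simp add: cong_def)
    \<comment> \<open>For each \<open>e\<close> and \<open>r\<close> the eight arguments of
      \<open>E\<close> coincide in pairs with opposite signs. For \<open>e = r = 3\<close>, for
      instance, \<open>m = 2\<close> and \<open>m = 16\<close> both give 31.\<close>
    have root: "(\<Sum>m\<in>even_QR. two_div_sign m * E ((r * two_div m - e * m) mod 34)) = 0" if "r = 3 \<or> r = 5" for r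
      using e that unfolding char_exps_def even_QR_def two_div_sign_def two_div_def by auto
    have "(\<Sum>m\<in>even_QR. h m \<tau>) = ee (6 * \<tau> / 34) * (\<Sum>m\<in>even_QR. two_div_sign m * E (3 * two_div m - e * m)) + 
       ee (10 * \<tau> / 34) * (\<Sum>m\<in>even_QR. two_div_sign m * E (5 * two_div m - e * m))"
      unfolding sum_distrib_left sum.distrib[symmetric]
    proof (intro sum.cong refl)
      fix m
      have "ee (of_int (- e * m * n) / 34) * ee (of_int (r * two_div m * n) / 34) = E (r * two_div m - e * m)" for r
        unfolding E_def ee_add[symmetric] by (intro arg_cong[of _ _ ee]) (simp add: field_simps)
      from this[of 3] this[of 5] show "h m \<tau> = ee (6 * \<tau> / 34) * (two_div_sign m * E (3 * two_div m - e * m)) + 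
         ee (10 * \<tau> / 34) * (two_div_sign m * E (5 * two_div m - e * m))"
        unfolding h_def princ_part_def by (simp only: distrib_left mult_ac)
    qed
    also have "\<dots> = 0" unfolding Emod[of "_ - _"] by (simp only: root[of 3, OF disjI1[OF refl]] root[of 5, OF disjI2[OF refl]] mult_zero_right add_0_right)
    finally show ?thesis .
  qed
  have split: "full_sum e n \<tau> = (\<Sum>m\<in>{0..<34} - even_QR - {0, 17}. f m \<tau>) + (\<Sum>m\<in>even_QR. f m \<tau> - h m \<tau>) + (f 0 \<tau> + f 17 \<tau>)" for \<tau>
  proof -
    have "full_sum e n \<tau> = (\<Sum>m\<in>{0..<34}. f m \<tau>)" by (simp only: full_sum_def f_def)
    also have "\<dots> = (\<Sum>m\<in>{0..<34} - even_QR. f m \<tau>) + (\<Sum>m\<in>even_QR. f m \<tau>)"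
      by (rule sum.subset_diff[OF eQ(1)]) simp
    also have "(\<Sum>m\<in>{0..<34} - even_QR. f m \<tau>) = (\<Sum>m\<in>{0..<34} - even_QR - {0, 17}. f m \<tau>) + (\<Sum>m\<in>{0, 17}. f m \<tau>)"
      by (rule sum.subset_diff) (use eQ in auto)
    finally show ?thesis by (simp add: sum_subtractf h0)
  qed
  have "(\<lambda>\<tau>. (\<Sum>m\<in>{0..<34} - even_QR - {0, 17}. f m \<tau>) + (\<Sum>m\<in>even_QR. f m \<tau> - h m \<tau>) + (f 0 \<tau> + f 17 \<tau>)) \<in> bigq (12 / 34)"
  proof (rule bigq_add[OF bigq_add f017])
    show "(\<lambda>\<tau>. \<Sum>m\<in>{0..<34} - even_QR - {0, 17}. f m \<tau>) \<in> bigq (12 / 34)"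
      by (rule bigq_sum) (rule rest)
    show "(\<lambda>\<tau>. \<Sum>m\<in>even_QR. f m \<tau> - h m \<tau>) \<in> bigq (12 / 34)"
      by (rule bigq_sum) (rule qr)
  qed
  thus ?thesis by (rule bigq_cong) (simp add: split)
qed

text \<open>As \<open>c\<close> is invertible, a row shift and a translation of
  \<open>\<tau>\<close> achieve that \<open>a\<close> and \<open>d\<close> are divisible by 34. Then
  \<open>- c * b\<close> is congruent to 1, \<open>m = j * c\<close> runs through all classes, and
  \<open>e * j\<close> becomes \<open>- e * m * b\<close>.\<close>

lemma coset_sum_bigo_unit:
  assumes det: "[a * d - b * c = 1] (mod 34)" and c: "coprime c 34" and e: "e \<in> char_exps"
  shows "coset_sum e a b c d \<in> bigq (12 / 34)"
proof -
  have main: "coset_sum e a b c d \<in> bigq (12 / 34)" if "[a = 0] (mod 34)" "[d = 0] (mod 34)" and det: "[a * d - b * c = 1] (mod 34)" for a b d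
  proof -
    have "[a * d - b * c = 0 * 0 - b * c] (mod 34)" using that by (intro cong_diff cong_mult cong_refl)
    hence bc: "[- c * b = 1] (mod 34)" using det by (simp add: mult.commute) (metis cong_sym cong_trans)
    then obtain k where k: "- c * b = 1 + 34 * k" by (metis cong_iff_lin cong_sym)
    have b: "odd b" 
    proof
      assume "even b" hence "even (- c * b)" by simp
      thus False unfolding k by simp
    qed
    have b17: "\<not> 17 dvd b"
    proof
      assume "17 dvd b"
      then obtain b' where "b = 17 * b'" by blast
      hence "17 * (- c * b' - 2 * k) = 1" using k by (simp add: algebra_simps)
      thus False by presburger
    qed
    have "full_sum e b \<in> bigq (12 / 34)" by (rule full_sum_bigo[OF b b17 e])
    thus ?thesis
    proof (rule bigq_cong)
      show "\<forall>\<^sub>F \<tau> in ioo. full_sum e b \<tau> = coset_sum e a b c d \<tau>"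
        using eventually_ioo[of 0]
      proof eventually_elim
        case (elim \<tau>)
        define f where "f = (\<lambda>m. ee (of_int (- e * m * b) / 34) * kquot m b \<tau>)"
        have per: "f j = f j'" if "[j = j'] (mod 34)" for j j'
          unfolding f_def using that
          by (intro arg_cong2[of _ _ _ _ "(*)"] kquot_cong elim ee_34_cong cong_mult cong_refl)
        have "full_sum e b \<tau> = (\<Sum>m\<in>{0..<34}. f m)" by (simp only: full_sum_def f_def)
        also have "\<dots> = (\<Sum>j\<in>{0..<34}. f (c * j + 0))"
          by (rule sum_periodic_reindex[OF per c, symmetric])
        also have "\<dots> = coset_sum e 0 b c 0 \<tau>"
          unfolding coset_sum_def
        proof (intro sum.cong refl)
          fix j :: int
          have "[e * j * (- c * b) = e * j * 1] (mod 34)" by (intro cong_mult bc cong_refl)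
          hence "ee (of_int (- e * (c * j + 0) * b) / 34) = ee (of_int (e * j) / 34)"
            by (intro ee_34_cong) (simp add: mult_ac)
          thus "f (c * j + 0) = ee (of_int (e * j) / 34) * kquot (0 + j * c) (b + j * 0) \<tau>"
            unfolding f_def by (simp only: mult.commute[of j c] mult_zero_right add_0 add_0_right)
        qed
        also have "\<dots> = coset_sum e a b c d \<tau>" using that by (intro coset_sum_cong elim) (auto intro: cong_sym)
        finally show ?case .
      qed
    qed
  qed
  obtain i where i: "[c * i = 1] (mod 34)" using c cong_solve_coprime_int by blast
  have ex: "\<exists>k. [x + k * c = 0] (mod 34)" for x
  proof
    have "[x + (- x) * (c * i) = x + (- x) * 1] (mod 34)" by (intro cong_add cong_mult i cong_refl)
    thus "[x + (- x * i) * c = 0] (mod 34)" by (simp add: mult_ac)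
  qed
  obtain k where k: "[d + k * c = 0] (mod 34)" using ex by blast
  obtain l where l: "[a + l * c = 0] (mod 34)" using ex by blast
  have "(a + l * c) * (d + k * c) - ((b + k * a) + l * (d + k * c)) * c = a * d - b * c" by (simp add: algebra_simps)
  hence "coset_sum e (a + l * c) ((b + k * a) + l * (d + k * c)) c (d + k * c) \<in> bigq (12 / 34)"
    using det by (intro main[OF l k]) simp
  hence "coset_sum e a (b + k * a) c (d + k * c) \<in> bigq (12 / 34)" by (rule coset_sum_shift_bigo)
  from bigq_translate[OF this, of "- k"]
  show ?thesis using coset_sum_T[of e a b c d _ k] by (simp flip: coset_sum_T)
qed

lemma coset_sum_bigo:
  assumes det: "[a * d - b * c = 1] (mod 34)" and e: "e \<in> char_exps"
  shows "coset_sum e a b c d \<in> bigq (12 / 34)"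
proof -
  consider "34 dvd c" | "even c" "\<not> 17 dvd c" | "[c = 17] (mod 34)" | "coprime c 34"
  proof -
    have "coprime c 34" if "odd c" "\<not> 17 dvd c"
    proof -
      have "coprime c 2" "coprime c 17"
        using that prime_imp_coprime[OF prime_17_int, of c] by (simp_all add: coprime_commute)
      hence "coprime c (2 * 17)" by (simp only: coprime_mult_right_iff)
      thus ?thesis by simp
    qed
    moreover have "34 dvd c" if "even c" "17 dvd c" using that by presburger
    moreover have "[c = 17] (mod 34)" if "odd c" "17 dvd c"
    proof -
      obtain k where k: "c = 17 * k" using \<open>17 dvd c\<close> by blast
      with \<open>odd c\<close> obtain l where "k = 2 * l + 1" by (auto elim: oddE)
      thus ?thesis by (simp add: k cong_iff_dvd_diff)
    qed
    ultimately show ?thesis using that by blast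
  qed
  thus ?thesis
  proof cases
    case 1 thus ?thesis by (intro coset_sum_bigo_34_dvd det)
  next
    case 2 
    have "odd e" using e by (auto simp: char_exps_def)
    with 2 show ?thesis by (intro coset_sum_bigo_even det)
  next
    case 3 thus ?thesis by (intro coset_sum_bigo_17 det e)
  next
    case 4 thus ?thesis by (intro coset_sum_bigo_unit det e)
  qed
qed

section \<open>Vanishing of the modular functions\<close>

text \<open>If both coordinates of a point are at most 1/2 in absolute value, its squared modulus is
  at most 1/2 and the inversion at least doubles the imaginary part. The height 1/2, lower than that
  of the usual fundamental domain, gives this uniform gain and so an induction on \<open>n\<close>.
  The index \<open>j\<close> may depend on the point, so no group action on \<open>I\<close> has to
  be set up.\<close>

lemma upper_half_plane_reduction:
  fixes f :: "'i \<Rightarrow> complex \<Rightarrow> complex"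
  assumes T: "\<And>i k \<tau>. i \<in> I \<Longrightarrow> Im \<tau> > 0 \<Longrightarrow> \<exists>j\<in>I. norm (f i (\<tau> + of_int k)) \<le> norm (f j \<tau>)"
  assumes S: "\<And>i \<tau>. i \<in> I \<Longrightarrow> Im \<tau> > 0 \<Longrightarrow> \<exists>j\<in>I. norm (f i (- 1 / \<tau>)) \<le> norm (f j \<tau>)"
  assumes "Im \<tau> > 0"
  shows "\<exists>\<tau>'. \<bar>Re \<tau>'\<bar> \<le> 1/2 \<and> Im \<tau>' \<ge> 1/2 \<and> (\<forall>i\<in>I. \<exists>j\<in>I. norm (f i \<tau>) \<le> norm (f j \<tau>'))"
proof -
  have tr: "\<exists>\<tau>'. \<bar>Re \<tau>'\<bar> \<le> 1/2 \<and> Im \<tau>' = Im \<tau> \<and> (\<forall>i\<in>I. \<exists>j\<in>I. norm (f i \<tau>) \<le> norm (f j \<tau>'))" if "Im \<tau> > 0" for \<tau>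
  proof (intro exI[of _ "\<tau> - of_int (round (Re \<tau>))"] conjI ballI)
    show "\<bar>Re (\<tau> - of_int (round (Re \<tau>)))\<bar> \<le> 1/2"
      using of_int_round_abs_le[of "Re \<tau>"] by (simp add: abs_minus_commute)
    fix i assume "i \<in> I"
    thus "\<exists>j\<in>I. norm (f i \<tau>) \<le> norm (f j (\<tau> - of_int (round (Re \<tau>))))"
      using T[of i "\<tau> - of_int (round (Re \<tau>))" "round (Re \<tau>)"] that by simp
  qed simp
  have "\<exists>\<tau>'. \<bar>Re \<tau>'\<bar> \<le> 1/2 \<and> Im \<tau>' \<ge> 1/2 \<and> (\<forall>i\<in>I. \<exists>j\<in>I. norm (f i \<tau>) \<le> norm (f j \<tau>'))"
    if "Im \<tau> \<ge> 1 / 2 / 2 ^ n" for n \<tau>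
    using that
  proof (induction n arbitrary: \<tau>)
    case 0
    thus ?case using tr[of \<tau>] by force
  next
    case (Suc n)
    have "Im \<tau> > 0" using Suc.prems by (rule less_le_trans[rotated]) simp
    then obtain \<sigma> where \<sigma>: "\<bar>Re \<sigma>\<bar> \<le> 1/2" "Im \<sigma> = Im \<tau>" "\<And>i. i \<in> I \<Longrightarrow> \<exists>j\<in>I. norm (f i \<tau>) \<le> norm (f j \<sigma>)"
      using tr by blast
    show ?case
    proof (cases "Im \<sigma> \<ge> 1/2")
      case True
      thus ?thesis using \<sigma> by blast
    next
      case False
      define \<rho> where "\<rho> = - 1 / \<sigma>"
      have pos: "Im \<sigma> > 0" using \<sigma>(2) \<open>Im \<tau> > 0\<close> by simp
      hence "\<sigma> \<noteq> 0" by auto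
      hence sig_eq: "\<sigma> = - 1 / \<rho>" by (simp add: \<rho>_def)
      have "(Re \<sigma>)\<^sup>2 \<le> (1/2)\<^sup>2" using \<sigma>(1) by (subst abs_le_square_iff[symmetric]) simp
      moreover have "(Im \<sigma>)\<^sup>2 \<le> (1/2)\<^sup>2" using False pos by (intro power_mono) auto
      ultimately have le: "(Re \<sigma>)\<^sup>2 + (Im \<sigma>)\<^sup>2 \<le> 1/2" by (simp add: power2_eq_square)
      have sq: "(Re \<sigma>)\<^sup>2 + (Im \<sigma>)\<^sup>2 > 0" using pos by (simp add: add_nonneg_pos)
      have "Im \<rho> = Im \<sigma> / ((Re \<sigma>)\<^sup>2 + (Im \<sigma>)\<^sup>2)" by (simp add: \<rho>_def Im_divide)
      also have "\<dots> \<ge> 2 * Im \<sigma>"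
        using mult_left_mono[OF le, of "2 * Im \<sigma>"] pos sq by (simp add: field_simps)
      finally have "Im \<rho> \<ge> 1 / 2 / 2 ^ n" using Suc.prems \<sigma>(2) by simp
      from Suc.IH[OF this] obtain \<tau>' where \<tau>': "\<bar>Re \<tau>'\<bar> \<le> 1/2" "Im \<tau>' \<ge> 1/2"
        "\<And>i. i \<in> I \<Longrightarrow> \<exists>j\<in>I. norm (f i \<rho>) \<le> norm (f j \<tau>')" by blast
      have "Im \<rho> > 0" using \<open>Im \<rho> \<ge> 1 / 2 / 2 ^ n\<close> by (rule less_le_trans[rotated]) simp
      hence "\<exists>j\<in>I. norm (f i \<sigma>) \<le> norm (f j \<rho>)" if "i \<in> I" for i
        using S[OF that, of \<rho>] sig_eq by simp
      hence "\<exists>j\<in>I. norm (f i \<tau>) \<le> norm (f j \<tau>')" if "i \<in> I" for i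
        using \<sigma>(3)[OF that] \<tau>'(3) by (meson order.trans)
      thus ?thesis using \<tau>'(1,2) by blast
    qed
  qed
  moreover have "\<exists>n. 1 / 2 / 2 ^ n \<le> Im \<tau>"
  proof -
    obtain n where "(1/2) ^ n < Im \<tau>" using real_arch_pow_inv[OF assms(3), of "1/2"] by auto
    moreover have "1 / 2 / 2 ^ n \<le> (1 / 2 ^ n :: real)" by (intro divide_right_mono) auto
    ultimately have "1 / 2 / 2 ^ n \<le> Im \<tau>" by (simp add: power_one_over)
    thus ?thesis ..
  qed
  ultimately show ?thesis by blast
qed

text \<open>If some value had absolute value \<open>\<epsilon> > 0\<close>, then, as all functions
  are below \<open>\<epsilon>\<close> high up, the reduction shows that the overall maximum is
  attained in the compact rectangle \<open>D\<close>, an interior point of the half plane. The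
  function attaining it is constant, which contradicts its smallness at infinity.\<close>

lemma modular_max_principle:
  fixes f :: "'i \<Rightarrow> complex \<Rightarrow> complex"
  assumes fin: "finite I"
  assumes hol: "\<And>i. i \<in> I \<Longrightarrow> f i holomorphic_on {\<tau>. Im \<tau> > 0}"
  assumes T: "\<And>i k \<tau>. i \<in> I \<Longrightarrow> Im \<tau> > 0 \<Longrightarrow> \<exists>j\<in>I. norm (f i (\<tau> + of_int k)) \<le> norm (f j \<tau>)"
  assumes S: "\<And>i \<tau>. i \<in> I \<Longrightarrow> Im \<tau> > 0 \<Longrightarrow> \<exists>j\<in>I. norm (f i (- 1 / \<tau>)) \<le> norm (f j \<tau>)"
  assumes lim: "\<And>i. i \<in> I \<Longrightarrow> (f i \<longlongrightarrow> 0) ioo"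
  assumes i0: "i0 \<in> I" and \<tau>0: "Im \<tau>0 > 0"
  shows "f i0 \<tau>0 = 0"
proof (rule ccontr)
  assume "f i0 \<tau>0 \<noteq> 0"
  define \<epsilon> where "\<epsilon> = norm (f i0 \<tau>0)"
  have eps: "\<epsilon> > 0" using \<open>f i0 \<tau>0 \<noteq> 0\<close> by (simp add: \<epsilon>_def)
  have red: "\<exists>\<tau>'. \<bar>Re \<tau>'\<bar> \<le> 1/2 \<and> Im \<tau>' \<ge> 1/2 \<and> (\<forall>i\<in>I. \<exists>j\<in>I. norm (f i \<tau>) \<le> norm (f j \<tau>'))" if "Im \<tau> > 0" for \<tau>
    using that by (rule upper_half_plane_reduction[of I f, rotated 2]) (blast intro: T S)+
  have "eventually (\<lambda>\<tau>. norm (f i \<tau>) < \<epsilon>) ioo" if "i \<in> I" for i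
    by (rule order_tendstoD(2)[OF tendsto_norm_zero[OF lim[OF that]] eps])
  hence "eventually (\<lambda>\<tau>. \<forall>i\<in>I. norm (f i \<tau>) < \<epsilon>) ioo" by (simp add: eventually_ball_finite fin)
  then obtain Y where Y: "\<And>\<tau> i. Im \<tau> \<ge> Y \<Longrightarrow> i \<in> I \<Longrightarrow> norm (f i \<tau>) < \<epsilon>"
    unfolding eventually_filtercomap_at_top_linorder by blast
  define D where "D = cbox (Complex (-1/2) (1/2)) (Complex (1/2) (max Y (1/2)))"
  have D_iff: "\<tau> \<in> D \<longleftrightarrow> \<bar>Re \<tau>\<bar> \<le> 1/2 \<and> 1/2 \<le> Im \<tau> \<and> Im \<tau> \<le> max Y (1/2)" for \<tau>
    by (auto simp: D_def in_cbox_complex_iff)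
  have DH: "D \<subseteq> {\<tau>. Im \<tau> > 0}" by (auto simp: D_iff)
  obtain \<tau>0' j0 where 0: "\<bar>Re \<tau>0'\<bar> \<le> 1/2" "Im \<tau>0' \<ge> 1/2" "j0 \<in> I" "\<epsilon> \<le> norm (f j0 \<tau>0')"
    using red[OF \<tau>0] i0 unfolding \<epsilon>_def by blast
  have "\<not> Im \<tau>0' \<ge> Y" using 0 Y[of \<tau>0' j0] by force
  hence "\<tau>0' \<in> D" using 0(1,2) by (simp add: D_iff max_def)
  have "\<exists>x\<in>D. \<forall>y\<in>D. norm (f i y) \<le> norm (f i x)" if "i \<in> I" for i
    using \<open>\<tau>0' \<in> D\<close> 
    by (intro continuous_attains_sup continuous_on_norm holomorphic_on_imp_continuous_on holomorphic_on_subset[OF hol[OF that] DH])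
       (auto simp: D_def)
  then obtain x where x: "\<And>i. i \<in> I \<Longrightarrow> x i \<in> D" "\<And>i y. i \<in> I \<Longrightarrow> y \<in> D \<Longrightarrow> norm (f i y) \<le> norm (f i (x i))"
    by metis
  have "finite ((\<lambda>i. norm (f i (x i))) ` I)" "(\<lambda>i. norm (f i (x i))) ` I \<noteq> {}" using fin i0 by auto
  from Max_in[OF this] obtain i1 where i1: "i1 \<in> I" "norm (f i1 (x i1)) = Max ((\<lambda>i. norm (f i (x i))) ` I)" by auto
  define B where "B = norm (f i1 (x i1))"
  have BD: "norm (f i y) \<le> B" if "i \<in> I" "y \<in> D" for i y
  proof -
    have "norm (f i (x i)) \<le> B" unfolding B_def i1(2) using fin that by (intro Max_ge) auto
    thus ?thesis using x(2)[OF that] by simp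
  qed
  have epsB: "\<epsilon> \<le> B" using BD[OF 0(3) \<open>\<tau>0' \<in> D\<close>] 0(4) by simp
  have BH: "norm (f i \<tau>) \<le> B" if i: "i \<in> I" and tau: "Im \<tau> > 0" for i \<tau>
  proof -
    obtain \<tau>' j where *: "\<bar>Re \<tau>'\<bar> \<le> 1/2" "Im \<tau>' \<ge> 1/2" "j \<in> I" "norm (f i \<tau>) \<le> norm (f j \<tau>')"
      using red[OF tau] i by blast
    show ?thesis
    proof (cases "Im \<tau>' \<ge> Y")
      case True
      thus ?thesis using Y[OF True *(3)] *(4) epsB by simp
    next
      case False
      hence "\<tau>' \<in> D" using * by (simp add: D_iff)
      thus ?thesis using BD[OF *(3)] *(4) by force
    qed
  qed
  have "f i1 constant_on {\<tau>. Im \<tau> > 0}"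
  proof (rule maximum_modulus_principle[OF hol[OF i1(1)]])
    show "open {\<tau>. Im \<tau> > 0}" "open {\<tau>. Im \<tau> > 0}" by (rule open_halfspace_Im_gt)+
    show "connected {\<tau>. Im \<tau> > 0}" by (rule convex_connected[OF convex_halfspace_Im_gt])
    show "x i1 \<in> {\<tau>. Im \<tau> > 0}" using x(1)[OF i1(1)] DH by blast
    show "norm (f i1 z) \<le> norm (f i1 (x i1))" if "z \<in> {\<tau>. Im \<tau> > 0}" for z
      using BH[OF i1(1), of z] that by (simp add: B_def)
  qed auto
  then obtain c where c: "\<And>\<tau>. Im \<tau> > 0 \<Longrightarrow> f i1 \<tau> = c" by (auto simp: constant_on_def)
  define \<tau>1 where "\<tau>1 = Complex 0 (max Y 1)"
  have "Im \<tau>1 > 0" "Im \<tau>1 \<ge> Y" by (auto simp: \<tau>1_def)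
  hence "norm c < \<epsilon>" using Y[of \<tau>1 i1] c[of \<tau>1] i1(1) by simp
  moreover have "norm c = B" using c[of "x i1"] x(1)[OF i1(1)] DH by (auto simp: B_def)
  ultimately show False using epsB by simp
qed

section \<open>Application of the maximum principle to the coset sums\<close>

lemma norm_ee_real [simp]: "norm (ee (of_real x)) = 1"
  by (simp add: norm_ee)

lemma norm_klein_shift:
  "Im \<tau> > 0 \<Longrightarrow> norm (klein (a + of_int j) (b + of_int l) \<tau>) = norm (klein a b \<tau>)"
  using norm_ee_real[of "(of_int (j + l + j * l) + of_int l * a - of_int j * b) / 2"]
  by (simp add: klein_shift norm_mult)

text \<open>The fourth power of this product transforms with the inverse of the factor of the third power of
  \<open>coset_sum\<close>, which makes the product of these powers invariant up to permutation and units.\<close>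

definition klein_half :: "complex \<Rightarrow> complex" where
  "klein_half \<tau> = klein 0 (1/2) \<tau> * klein (1/2) 0 \<tau> * klein (1/2) (1/2) \<tau>"

lemma klein_half_T: "Im \<tau> > 0 \<Longrightarrow> norm (klein_half (\<tau> + 1)) = norm (klein_half \<tau>)"
  using norm_klein_shift[of \<tau> "1/2" 0 0 1] by (simp add: klein_half_def klein_T norm_mult mult_ac)

lemma klein_half_T_int: "Im \<tau> > 0 \<Longrightarrow> norm (klein_half (\<tau> + of_int k)) = norm (klein_half \<tau>)"
proof (induction k rule: int_induct[of _ 0])
  case (step1 i)
  thus ?case using klein_half_T[of "\<tau> + of_int i"] by (simp add: add_ac)
next
  case (step2 i)
  thus ?case using klein_half_T[of "\<tau> + of_int (i - 1)"] by (simp add: add_ac)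
qed auto

lemma klein_half_S:
  assumes tau: "Im \<tau> > 0" and k: "\<And>a b. klein a b (- 1 / \<tau>) = k * klein b (- a) \<tau>"
  shows "norm (klein_half (- 1 / \<tau>)) = norm k ^ 3 * norm (klein_half \<tau>)"
proof -
  have "norm (klein 0 (- (1/2)) \<tau>) = norm (klein 0 (1/2) \<tau>)"
    using klein_minus[OF tau, of 0 "1/2"] by simp
  moreover have "norm (klein (1/2) (- (1/2)) \<tau>) = norm (klein (1/2) (1/2) \<tau>)"
    using norm_klein_shift[OF tau, of "1/2" 0 "1/2" "- 1"] by simp
  ultimately show ?thesis unfolding klein_half_def k by (simp add: norm_mult power3_eq_cube)
qed

lemma half_notin_Ints: "(1/2 :: real) \<notin> \<int>"
proof
  assume "(1/2 :: real) \<in> \<int>"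
  then obtain i :: int where "(1/2 :: real) = of_int i" by (auto elim: Ints_cases)
  hence "of_int (2 * i) = (1 :: real)" by simp
  hence "2 * i = 1" by (simp only: of_int_eq_1_iff)
  thus False by presburger
qed

lemma klein_half_bigo: "klein_half \<in> bigq (- (1/4))"
proof -
  have klein_ord: "klein_ord 0 = 0" "klein_ord (1/2) = 1/8" by (simp_all add: klein_ord_def frac_def)
  have "(\<lambda>\<tau>. klein 0 (1/2) \<tau> * klein (1/2) 0 \<tau> * klein (1/2) (1/2) \<tau>) \<in> bigq (- klein_ord 0 + - klein_ord (1/2) + - klein_ord (1/2))"
    by (intro bigq_mult klein_bigo) (use half_notin_Ints in auto)
  thus ?thesis unfolding klein_ord by (simp add: klein_half_def[abs_def])
qed

lemma klein_half_holomorphic: "klein_half holomorphic_on {\<tau>. Im \<tau> > 0}"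
  unfolding klein_half_def by (intro holomorphic_intros klein_holomorphic)

lemma klein_half_nonzero: "Im \<tau> > 0 \<Longrightarrow> klein_half \<tau> \<noteq> 0"
  using half_notin_Ints by (simp add: klein_half_def klein_eq_0_iff)

lemma coset_sum_holomorphic:
  assumes det: "[a * d - b * c = 1] (mod 34)"
  shows "coset_sum e a b c d holomorphic_on {\<tau>. Im \<tau> > 0}"
  unfolding coset_sum_def
proof (intro holomorphic_intros kquot_holomorphic)
  fix j
  obtain k where k: "a * d - b * c = 1 + 34 * k" using det by (metis cong_iff_lin cong_sym)
  show "\<not> (17 dvd a + j * c \<and> 17 dvd b + j * d)"
  proof
    assume "17 dvd a + j * c \<and> 17 dvd b + j * d"
    then obtain x y where "a + j * c = 17 * x" "b + j * d = 17 * y" by blast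
    moreover have "(a + j * c) * d - (b + j * d) * c = 1 + 34 * k" using k by (simp add: algebra_simps)
    ultimately have "17 * (x * d - y * c - 2 * k) = 1" by (simp add: algebra_simps)
    thus False by presburger
  qed
qed

lemma coset_sum_eq_0:
  assumes e: "e \<in> char_exps" and det0: "[a0 * d0 - b0 * c0 = 1] (mod 34)" and tau: "Im \<tau> > 0"
  shows "coset_sum e a0 b0 c0 d0 \<tau> = 0"
proof -
  \<comment> \<open>The group SL_2 over the integers modulo 34; by \<open>coset_sum_cong\<close> its
    finitely many elements represent all images of the sum.\<close>
  define I where "I = {(a, b, c, d) \<in> {0..<34} \<times> {0..<34} \<times> {0..<34} \<times> {0..<34::int}. [a * d - b * c = 1] (mod 34)}"
  define f where "f = (\<lambda>(a, b, c, d) \<tau>. coset_sum e a b c d \<tau> ^ 3 * klein_half \<tau> ^ 4)"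
  have red: "\<exists>j\<in>I. norm (coset_sum e a b c d \<tau> ^ 3 * klein_half \<tau> ^ 4) \<le> norm (f j \<tau>)"
    if "[a * d - b * c = 1] (mod 34)" "Im \<tau> > 0" for a b c d \<tau>
  proof (rule bexI)
    let ?j = "(a mod 34, b mod 34, c mod 34, d mod 34)"
    show "norm (coset_sum e a b c d \<tau> ^ 3 * klein_half \<tau> ^ 4) \<le> norm (f ?j \<tau>)"
      using coset_sum_cong[OF that(2), of a "a mod 34" b "b mod 34" c "c mod 34" d "d mod 34" e] by (simp add: f_def)
    have "[(a mod 34) * (d mod 34) - (b mod 34) * (c mod 34) = a * d - b * c] (mod 34)"
      by (intro cong_diff cong_mult) auto
    thus "?j \<in> I" using cong_trans[OF _ that(1)] by (auto simp: I_def)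
  qed
  have "f (a0 mod 34, b0 mod 34, c0 mod 34, d0 mod 34) \<tau> = 0"
  proof (rule modular_max_principle[where f = f and I = I])
    have "I \<subseteq> {0..<34} \<times> {0..<34} \<times> {0..<34} \<times> {0..<34::int}" by (auto simp: I_def)
    thus "finite I" by (rule finite_subset) auto
    have "[(a0 mod 34) * (d0 mod 34) - (b0 mod 34) * (c0 mod 34) = a0 * d0 - b0 * c0] (mod 34)"
      by (intro cong_diff cong_mult) auto
    thus "(a0 mod 34, b0 mod 34, c0 mod 34, d0 mod 34) \<in> I" using cong_trans[OF _ det0] by (auto simp: I_def)
  next
    fix i assume "i \<in> I"
    then obtain a b c d where i: "i = (a, b, c, d)" and det: "[a * d - b * c = 1] (mod 34)" by (auto simp: I_def)
    show "f i holomorphic_on {\<tau>. Im \<tau> > 0}"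
      unfolding f_def i by (auto intro!: holomorphic_intros coset_sum_holomorphic[OF det] klein_half_holomorphic)
    have V: "coset_sum e a b c d \<in> bigq (12/34)" by (rule coset_sum_bigo[OF det e])
    \<comment> \<open>The order is \<open>3 * 12 / 34 - 4 / 4 = 2 / 34\<close>, which is positive
      precisely because 12/34 exceeds 1/3.\<close>
    have "(\<lambda>\<tau>. (coset_sum e a b c d \<tau> * (coset_sum e a b c d \<tau> * coset_sum e a b c d \<tau>)) * (klein_half \<tau> * (klein_half \<tau> * (klein_half \<tau> * klein_half \<tau>)))) \<in> 
       bigq ((12/34 + (12/34 + 12/34)) + (- (1/4) + (- (1/4) + (- (1/4) + - (1/4)))))"
      by (intro bigq_mult V klein_half_bigo)
    hence "f i \<in> bigq (2/34)" unfolding f_def i by (simp add: power3_eq_cube power4_eq_xxxx mult.assoc)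
    thus "(f i \<longlongrightarrow> 0) ioo" by (rule bigq_tendsto[rotated]) simp
  next
    fix i k \<tau> assume "i \<in> I" and tau: "Im \<tau> > 0"
    then obtain a b c d where i: "i = (a, b, c, d)" and det: "[a * d - b * c = 1] (mod 34)" by (auto simp: I_def)
    have "a * (d + k * c) - (b + k * a) * c = a * d - b * c" by (simp add: algebra_simps)
    with red[of a "d + k * c" "b + k * a" c \<tau>] det tau
    show "\<exists>j\<in>I. norm (f i (\<tau> + of_int k)) \<le> norm (f j \<tau>)"
      by (simp add: f_def i coset_sum_T norm_mult norm_power klein_half_T_int)
  next
    fix i \<tau> assume "i \<in> I" and tau: "Im \<tau> > 0"
    then obtain a b c d where i: "i = (a, b, c, d)" and det: "[a * d - b * c = 1] (mod 34)" by (auto simp: I_def)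
    obtain k where k: "k \<noteq> 0" "\<And>a b. klein a b (- 1 / \<tau>) = k * klein b (- a) \<tau>"
      using klein_S[OF tau] by metis
    have "norm (f i (- 1 / \<tau>)) = norm (coset_sum e b (- a) d (- c) \<tau> ^ 3 * klein_half \<tau> ^ 4)"
      unfolding f_def i using k(1)
      by (simp only: coset_sum_S[OF k] norm_mult norm_power klein_half_S[OF tau k(2)] norm_divide prod.case)
         (simp add: power_divide power_mult_distrib flip: power_mult)
    moreover have "b * (- c) - (- a) * d = a * d - b * c" by simp
    ultimately show "\<exists>j\<in>I. norm (f i (- 1 / \<tau>)) \<le> norm (f j \<tau>)"
      using red[of b "- c" "- a" d \<tau>] det tau by simp
  qed (fact tau)
  hence "coset_sum e (a0 mod 34) (b0 mod 34) (c0 mod 34) (d0 mod 34) \<tau> = 0"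
    using klein_half_nonzero[OF tau] by (simp add: f_def)
  thus ?thesis
    using coset_sum_cong[OF tau, of a0 "a0 mod 34" b0 "b0 mod 34" c0 "c0 mod 34" d0 "d0 mod 34" e] by simp
qed

section \<open>Generating functions of signed partition numbers\<close>

definition parts_le :: "nat \<Rightarrow> nat \<Rightarrow> nat list set" where
  "parts_le M n = {xs. sorted_wrt (\<ge>) xs \<and> (\<forall>x\<in>set xs. 0 < x \<and> x \<le> M) \<and> sum_list xs = n}"

lemma parts_le_subset: "parts_le M n \<subseteq> insert [] (partitions_of n)"
  by (auto simp: parts_le_def partitions_of_def)

lemma finite_parts_le: "finite (parts_le M n)"
  using finite_subset[OF parts_le_subset] finite_partitions_of by simp

lemma parts_le_eq_partitions:
  assumes "n > 0" "n \<le> M"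
  shows "parts_le M n = partitions_of n"
proof -
  have "x \<le> M" if "x \<in> set xs" "sum_list xs = n" for x xs
    using member_le_sum_list[of x xs] that assms(2) by simp
  thus ?thesis using assms(1) by (auto simp: parts_le_def partitions_of_def)
qed

lemma parts_le_0: "parts_le M 0 = {[]}"
proof -
  have "xs = []" if "xs \<in> parts_le M 0" for xs
    using that by (cases xs) (auto simp: parts_le_def)
  thus ?thesis by (auto simp: parts_le_def)
qed

text \<open>The lists are weakly decreasing, so \<open>Suc M\<close> stands at the head if it occurs
  at all. What follows may contain it again, hence the bound \<open>Suc M\<close> on the
  right.\<close>

lemma parts_le_Suc:
  "parts_le (Suc M) n = parts_le M n \<union> (if Suc M \<le> n then (#) (Suc M) ` parts_le (Suc M) (n - Suc M) else {})"
proof (intro equalityI subsetI)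
  fix xs assume xs: "xs \<in> parts_le (Suc M) n"
  show "xs \<in> parts_le M n \<union> (if Suc M \<le> n then (#) (Suc M) ` parts_le (Suc M) (n - Suc M) else {})"
  proof (cases "Suc M \<in> set xs")
    case False
    hence "x \<le> M" if "x \<in> set xs" for x
      using xs that by (auto simp: parts_le_def le_Suc_eq)
    thus ?thesis using xs by (auto simp: parts_le_def)
  next
    case True
    then obtain y ys where ys: "xs = y # ys" by (cases xs) auto
    have "y = Suc M" using xs True unfolding ys by (fastforce simp: parts_le_def)
    thus ?thesis using xs unfolding ys by (auto simp: parts_le_def)
  qed
next
  fix xs assume "xs \<in> parts_le M n \<union> (if Suc M \<le> n then (#) (Suc M) ` parts_le (Suc M) (n - Suc M) else {})"
  thus "xs \<in> parts_le (Suc M) n" by (auto simp: parts_le_def split: if_splits)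
qed

definition parts_weight :: "(nat \<Rightarrow> int) \<Rightarrow> nat \<Rightarrow> nat \<Rightarrow> int" where
  "parts_weight f M n = (\<Sum>xs\<in>parts_le M n. prod_list (map f xs))"

lemma parts_weight_Suc:
  "parts_weight f (Suc M) n = parts_weight f M n + (if Suc M \<le> n then f (Suc M) * parts_weight f (Suc M) (n - Suc M) else 0)"
proof (cases "Suc M \<le> n")
  case True
  have "Suc M \<notin> set xs" if "xs \<in> parts_le M n" for xs
    using that unfolding parts_le_def by fastforce
  hence disj: "parts_le M n \<inter> (#) (Suc M) ` parts_le (Suc M) (n - Suc M) = {}" by fastforce
  have "parts_weight f (Suc M) n = (\<Sum>xs\<in>parts_le M n \<union> (#) (Suc M) ` parts_le (Suc M) (n - Suc M). prod_list (map f xs))"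
    unfolding parts_weight_def parts_le_Suc[of M n] using True by (simp only: if_True)
  also have "\<dots> = parts_weight f M n + (\<Sum>xs\<in>(#) (Suc M) ` parts_le (Suc M) (n - Suc M). prod_list (map f xs))"
    unfolding parts_weight_def by (rule sum.union_disjoint[OF finite_parts_le finite_imageI[OF finite_parts_le] disj])
  also have "(\<Sum>xs\<in>(#) (Suc M) ` parts_le (Suc M) (n - Suc M). prod_list (map f xs)) = f (Suc M) * parts_weight f (Suc M) (n - Suc M)"
    by (subst sum.reindex) (auto simp: parts_weight_def sum_distrib_left)
  finally show ?thesis using True by simp
next
  case False
  thus ?thesis unfolding parts_weight_def parts_le_Suc[of M n] by simp
qed

lemma parts_weight_0: "parts_weight f 0 n = (if n = 0 then 1 else 0)"
proof -
  have "parts_le 0 n = (if n = 0 then {[]} else {})"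
  proof -
    have "xs = []" if "xs \<in> parts_le 0 n" for xs using that by (cases xs) (auto simp: parts_le_def)
    hence "parts_le 0 n \<subseteq> {[]}" by blast
    moreover have "[] \<in> parts_le 0 n \<longleftrightarrow> n = 0" by (auto simp: parts_le_def)
    ultimately show ?thesis by auto
  qed
  thus ?thesis by (simp add: parts_weight_def)
qed

lemma parts_weight_fps:
  "(\<Prod>m\<in>{1..M}. 1 - fps_const (of_int (f m) :: complex) * fps_X ^ m) * Abs_fps (\<lambda>n. of_int (parts_weight f M n)) = 1"
proof (induction M)
  case 0
  show ?case by (simp add: fps_eq_iff parts_weight_0)
next
  case (Suc M)
  have eq: "(1 - fps_const (of_int (f (Suc M)) :: complex) * fps_X ^ Suc M) * Abs_fps (\<lambda>n. of_int (parts_weight f (Suc M) n)) =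
      Abs_fps (\<lambda>n. of_int (parts_weight f M n))"
  proof (rule fps_ext)
    fix n
    show "((1 - fps_const (of_int (f (Suc M)) :: complex) * fps_X ^ Suc M) * Abs_fps (\<lambda>n. of_int (parts_weight f (Suc M) n))) $ n =
      Abs_fps (\<lambda>n. of_int (parts_weight f M n)) $ n"
      unfolding left_diff_distrib mult.assoc fps_sub_nth fps_mult_left_const_nth fps_X_power_mult_nth mult_1_left fps_nth_Abs_fps
      by (subst parts_weight_Suc) simp
  qed
  have "(\<Prod>m\<in>{1..Suc M}. 1 - fps_const (of_int (f m) :: complex) * fps_X ^ m) = 
     (\<Prod>m\<in>{1..M}. 1 - fps_const (of_int (f m) :: complex) * fps_X ^ m) * (1 - fps_const (of_int (f (Suc M)) :: complex) * fps_X ^ Suc M)"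
    by (rule prod.cl_ivl_Suc[THEN trans]) simp
  thus ?case by (simp only: mult.assoc eq Suc)
qed

text \<open>\<open>partitions_of 0\<close> is empty, so the constant term 1 has to be set
  separately.\<close>

definition signed_pgf :: "(nat \<Rightarrow> int) \<Rightarrow> complex fps" where
  "signed_pgf f = Abs_fps (\<lambda>n. if n = 0 then 1 else of_int (signed_partition_number n f))"

lemma signed_pgf_nth: "n \<le> M \<Longrightarrow> signed_pgf f $ n = of_int (parts_weight f M n)"
  by (cases "n = 0") (simp_all add: signed_pgf_def parts_weight_def signed_partition_number_def parts_le_0 parts_le_eq_partitions)

text \<open>Parts larger than \<open>M\<close> do not affect the coefficients up to
  \<open>M\<close>.\<close>

lemma prod_signed_pgf_nth:
  assumes "n \<le> M"
  shows "((\<Prod>m\<in>{1..M}. 1 - fps_const (of_int (f m) :: complex) * fps_X ^ m) * signed_pgf f) $ n = (if n = 0 then 1 else 0)"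
proof -
  have "((\<Prod>m\<in>{1..M}. 1 - fps_const (of_int (f m) :: complex) * fps_X ^ m) * signed_pgf f) $ n = 
     ((\<Prod>m\<in>{1..M}. 1 - fps_const (of_int (f m) :: complex) * fps_X ^ m) * Abs_fps (\<lambda>n. of_int (parts_weight f M n))) $ n"
    unfolding fps_mult_nth
  proof (intro sum.cong refl arg_cong2[of _ _ _ _ "(*)"])
    fix k
    show "signed_pgf f $ (n - k) = Abs_fps (\<lambda>n. of_int (parts_weight f M n)) $ (n - k)"
      using signed_pgf_nth[of "n - k" M f] assms by simp
  qed
  thus ?thesis unfolding parts_weight_fps by simp
qed

text \<open>Near 0 the partial products converge uniformly, so a limit along the multiples of
  \<open>L\<close> determines the full limit. Their coefficients become stationary, hence
  \<open>G\<close> expands into the formal Euler product, whose inverse is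
  \<open>signed_pgf f\<close>. The multiples of \<open>L\<close> allow a product to be grouped by
  periods.\<close>

lemma signed_euler_product:
  fixes f :: "nat \<Rightarrow> int"
  assumes f: "\<And>m. \<bar>f m\<bar> \<le> 1"
    and lim: "\<And>x. norm x < 1 \<Longrightarrow> (\<lambda>N. \<Prod>m\<in>{1..L * N}. 1 - of_int (f m) * x ^ m) \<longlonglongrightarrow> G x"
    and L: "L > 0" and GR: "\<And>x. norm x < 1 \<Longrightarrow> G x * R x = 1"
  shows "R has_fps_expansion signed_pgf f"
proof -
  define P :: "nat \<Rightarrow> complex \<Rightarrow> complex" where "P = (\<lambda>N x. \<Prod>m<N. 1 - of_int (f (Suc m)) * x ^ Suc m)"
  define Q :: "nat \<Rightarrow> complex fps" where "Q = (\<lambda>N. \<Prod>m<N. 1 - fps_const (of_int (f (Suc m))) * fps_X ^ Suc m)"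
  have PQ: "P N has_fps_expansion Q N" for N
    unfolding P_def Q_def
    by (intro has_fps_expansion_prod has_fps_expansion_diff has_fps_expansion_1 has_fps_expansion_mult
        has_fps_expansion_const has_fps_expansion_fps_X_power)
  have "uniformly_convergent_on (cball 0 (1/2)) P"
    unfolding P_def
  proof (rule uniformly_convergent_on_prod')
    show "uniformly_convergent_on (cball 0 (1/2)) (\<lambda>N x::complex. \<Sum>n<N. norm (1 - of_int (f (Suc n)) * x ^ Suc n - 1))"
    proof (rule Weierstrass_m_test')
      fix n and x :: complex assume x: "x \<in> cball 0 (1/2)"
      have "norm (of_int (f (Suc n)) :: complex) * norm x ^ Suc n \<le> 1 * (1/2) ^ Suc n"
        using f[of "Suc n"] x by (intro mult_mono power_mono) (auto simp flip: of_int_abs)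
      thus "norm (norm (1 - of_int (f (Suc n)) * x ^ Suc n - 1)) \<le> (1/2) ^ Suc n"
        by (simp add: norm_mult norm_power del: power_Suc)
    next
      show "summable (\<lambda>n. (1/2 :: real) ^ Suc n)" by (subst summable_Suc_iff) (simp add: summable_geometric)
    qed
  qed (auto intro!: continuous_intros)
  then obtain G' where ul: "uniform_limit (cball 0 (1/2)) P G' sequentially"
    by (auto simp: uniformly_convergent_on_def)
  have G': "G' x = G x" if "x \<in> cball 0 (1/2)" for x
  proof -
    have "(\<lambda>N. P N x) \<longlonglongrightarrow> G' x" by (rule tendsto_uniform_limitI[OF ul that])
    hence "(\<lambda>N. P (L * N) x) \<longlonglongrightarrow> G' x"
      by (rule filterlim_compose) (use L in \<open>auto intro!: filterlim_subseq simp: strict_mono_def\<close>)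
    moreover have "P M x = (\<Prod>m\<in>{1..M}. 1 - of_int (f m) * x ^ m)" for M
      unfolding P_def by (rule prod.reindex_bij_witness[of _ "\<lambda>m. m - 1" Suc]) auto
    moreover have "norm x < 1" using that by simp
    ultimately show ?thesis using LIMSEQ_unique[OF _ lim] by simp
  qed
  have ul': "uniform_limit (ball 0 (1/2)) P G sequentially"
  proof -
    have "uniform_limit (ball 0 (1/2)) P G' sequentially" by (rule uniform_limit_on_subset[OF ul]) auto
    also have "?this \<longleftrightarrow> ?thesis" by (intro uniform_limit_cong) (auto simp: G')
    finally show ?thesis .
  qed
  have P_hol: "P N holomorphic_on A" for N A unfolding P_def by (intro holomorphic_intros)
  have G_hol: "G holomorphic_on ball 0 (1/2)"
  proof (rule holomorphic_uniform_sequence[of _ P])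
    fix x :: complex assume "x \<in> ball 0 (1/2)"
    then obtain d where "d > 0" "cball x d \<subseteq> ball 0 (1/2)" by (metis open_ball open_contains_cball)
    thus "\<exists>d>0. cball x d \<subseteq> ball 0 (1/2) \<and> uniform_limit (cball x d) P G sequentially"
      using uniform_limit_on_subset[OF ul'] by blast
  qed (auto intro: P_hol)
  have "G analytic_on {0}" using G_hol analytic_at by (metis centre_in_ball half_gt_zero open_ball zero_less_one)
  then obtain F where F: "G has_fps_expansion F" using analytic_at_imp_has_fps_expansion_0 by blast
  have Q_stable: "Q (M + k) $ n = Q M $ n" if "n \<le> M" for M k n
  proof (induction k)
    case (Suc k)
    have "Q (M + Suc k) = Q (M + k) - fps_const (of_int (f (Suc (M + k)))) * (fps_X ^ Suc (M + k) * Q (M + k))"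
      by (simp add: Q_def algebra_simps del: power_Suc)
    hence "Q (M + Suc k) $ n = Q (M + k) $ n" using that by (simp add: fps_X_power_mult_nth del: power_Suc)
    thus ?case using Suc by simp
  qed simp
  have FQ: "F $ n = Q n $ n" for n
  proof -
    have "(\<lambda>N. (deriv ^^ n) (P N) 0) \<longlonglongrightarrow> (deriv ^^ n) G 0"
      by (rule higher_deriv_complex_uniform_limit[OF ul' always_eventually[OF allI[OF P_hol]]]) auto
    hence "(\<lambda>N. Q N $ n) \<longlonglongrightarrow> F $ n"
      unfolding fps_nth_fps_expansion[OF PQ] fps_nth_fps_expansion[OF F] by (intro tendsto_intros) auto
    moreover have "eventually (\<lambda>N. Q N $ n = Q n $ n) sequentially"
      using eventually_ge_at_top[of n]
      by eventually_elim (use Q_stable in \<open>metis le_refl le_Suc_ex\<close>)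
    ultimately show ?thesis by (rule LIMSEQ_unique[OF _ tendsto_eventually])
  qed
  have "F * signed_pgf f = 1"
  proof (rule fps_ext)
    fix n
    have "(F * signed_pgf f) $ n = (Q n * signed_pgf f) $ n"
    proof -
      have "F $ k = Q n $ k" if "k \<le> n" for k 
        using FQ[of k] Q_stable[of k k "n - k"] that by simp
      thus ?thesis unfolding fps_mult_nth by (intro sum.cong refl) auto
    qed
    also have "Q n = (\<Prod>m\<in>{1..n}. 1 - fps_const (of_int (f m)) * fps_X ^ m)"
      unfolding Q_def by (rule prod.reindex_bij_witness[of _ "\<lambda>m. m - 1" Suc]) auto
    also have "(\<dots> * signed_pgf f) $ n = (if n = 0 then 1 else 0)" by (rule prod_signed_pgf_nth) simp
    finally show "(F * signed_pgf f) $ n = 1 $ n" by simp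
  qed
  note Fgen = this
  have F0: "F $ 0 \<noteq> 0"
  proof
    assume "F $ 0 = 0"
    hence "(F * signed_pgf f) $ 0 = 0" by simp
    thus False unfolding Fgen by simp
  qed
  have "inverse F = signed_pgf f" using Fgen by (rule fps_inverse_unique)
  hence inv: "(\<lambda>x. inverse (G x)) has_fps_expansion signed_pgf f"
    using has_fps_expansion_inverse[OF F F0] by simp
  have "eventually (\<lambda>x::complex. x \<in> ball 0 1) (nhds 0)" by (rule eventually_nhds_in_open) auto
  hence ev: "eventually (\<lambda>x. inverse (G x) = R x) (nhds 0)"
    by eventually_elim (rule inverse_unique, use GR in simp)
  show ?thesis using inv has_fps_expansion_cong[OF ev refl] by blast
qed

text \<open>Both sides depend only on \<open>n\<close> modulo 34, since
  \<open>24 * 34 = 48 * 17\<close>; the 34 cases are then compared.\<close>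

lemma residue_classes_iff:
  "(\<exists>r\<in>{17, 19, 25, 27}. [n = r] (mod 34)) \<longleftrightarrow> odd n \<and> quartic_residue 17 (1 - 24 * int n)"
proof -
  define r where "r = n mod 34"
  have rset: "r \<in> {0,1,2,3,4,5,6,7,8,9,10,11,12,13,14,15,16,17,18,19,20,21,22,23,24,25,26,27,28,29,30,31,32,33}"
  proof -
    have "int r \<in> set [0..33]" by (simp add: r_def)
    hence "int r \<in> {0,1,2,3,4,5,6,7,8,9,10,11,12,13,14,15,16,17,18,19,20,21,22,23,24,25,26,27,28,29,30,31,32,33}"
      by (simp add: upto.simps)
    thus ?thesis by (elim insertE; simp)
  qed
  have odd: "odd n \<longleftrightarrow> odd r" by (simp add: r_def dvd_mod_iff)
  define c where "c = (1 - 24 * int r) mod 17"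
  have c: "(1 - 24 * int n) mod 17 = c"
  proof -
    have "int n = int (34 * (n div 34) + r)" by (simp add: r_def)
    hence "int n = 34 * int (n div 34) + int r" by (simp only: of_nat_add of_nat_mult of_nat_numeral)
    hence "1 - 24 * int n = (1 - 24 * int r) + (- 48 * int (n div 34)) * 17" by linarith
    thus ?thesis unfolding c_def by (simp only: mod_mult_self1)
  qed
  have quart: "quartic_residue 17 (1 - 24 * int n) \<longleftrightarrow> c \<in> {1, 4, 13, 16}"
  proof
    assume *: "quartic_residue 17 (1 - 24 * int n)"
    then obtain y where "(y ^ 4) mod 17 = c" "c \<noteq> 0" using c by (auto simp: quartic_residue_def cong_def)
    hence "(y mod 17) ^ 4 mod 17 = c" by (simp add: power_mod)
    moreover have "y mod 17 \<in> set [0..16]" by simp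
    hence "y mod 17 \<in> {0,1,2,3,4,5,6,7,8,9,10,11,12,13,14,15,16}" by (simp add: upto.simps)
    ultimately show "c \<in> {1, 4, 13, 16}" using \<open>c \<noteq> 0\<close> by auto
  next
    assume "c \<in> {1, 4, 13, 16}"
    \<comment> \<open>The fourth powers of 1, 2, 3, 6 modulo 17 are 1, 16, 13, 4.\<close>
    hence "c \<noteq> 0" and "\<exists>y\<in>{1, 2, 3, 6}. y ^ 4 mod 17 = c" by auto
    then obtain y where "y ^ 4 mod 17 = c" by blast
    hence "[y ^ 4 = 1 - 24 * int n] (mod 17)" using c by (simp add: cong_def)
    moreover have "\<not> [1 - 24 * int n = 0] (mod 17)" using c \<open>c \<noteq> 0\<close> by (simp add: cong_def)
    ultimately show "quartic_residue 17 (1 - 24 * int n)" unfolding quartic_residue_def by blast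
  qed
  have "(\<exists>r\<in>{17, 19, 25, 27}. [n = r] (mod 34)) \<longleftrightarrow> r \<in> {17, 19, 25, 27}" by (auto simp: cong_def r_def)
  also have "\<dots> \<longleftrightarrow> odd r \<and> c \<in> {1, 4, 13, 16}"
    using rset unfolding c_def by (elim insertE; simp)
  finally show ?thesis unfolding odd quart .
qed

section \<open>The Legendre symbol modulo 17\<close>

definition chi :: "nat \<Rightarrow> int" where "chi a = Legendre (int a) 17"

definition QR17 :: "nat set" where "QR17 = {1, 2, 4, 8, 9, 13, 15, 16}"
definition QN17 :: "nat set" where "QN17 = {3, 5, 6, 7, 10, 11, 12, 14}"

lemma chi_eq: "chi m = (if m mod 17 \<in> QR17 then 1 else if m mod 17 = 0 then 0 else -1)"
proof -
  define r where "r = int m mod 17"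
  have r: "r \<in> {0,1,2,3,4,5,6,7,8,9,10,11,12,13,14,15,16}"
  proof -
    have "r \<in> set [0..16]" by (simp add: r_def)
    thus ?thesis by (simp add: upto.simps)
  qed
  have m: "m mod 17 = nat r" by (simp add: r_def nat_mod_distrib)
  have zero: "[int m = 0] (mod 17) \<longleftrightarrow> r = 0" by (simp add: cong_def r_def)
  have "QuadRes 17 (int m) \<longleftrightarrow> r \<in> {0,1,2,4,8,9,13,15,16}"
  proof
    assume "QuadRes 17 (int m)"
    then obtain y where "[y\<^sup>2 = int m] (mod 17)" by (auto simp: QuadRes_def)
    hence "(y mod 17)\<^sup>2 mod 17 = r" by (simp add: cong_def r_def power_mod)
    moreover have "y mod 17 \<in> set [0..16]" by simp
    hence "y mod 17 \<in> {0,1,2,3,4,5,6,7,8,9,10,11,12,13,14,15,16}" by (simp add: upto.simps)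
    ultimately show "r \<in> {0,1,2,4,8,9,13,15,16}" by auto
  next
    assume "r \<in> {0,1,2,4,8,9,13,15,16}"
    \<comment> \<open>Square roots modulo 17 of 0, 1, 2, 4, 8, 9, 13, 15, 16, in this order.\<close>
    hence "\<exists>y\<in>{0,1,6,2,5,3,8,7,4}. y\<^sup>2 mod 17 = r" by auto
    then obtain y where "y\<^sup>2 mod 17 = r" by blast
    hence "[y\<^sup>2 = int m] (mod 17)" by (simp add: cong_def r_def)
    thus "QuadRes 17 (int m)" unfolding QuadRes_def by blast
  qed
  note QR = this
  show ?thesis unfolding chi_def Legendre_def m zero QR using r by (elim insertE; simp add: QR17_def)
qed

text \<open>With \<open>s\<close> also \<open>34 - s\<close> occurs in a theta factor: the numerator
  covers the odd nonresidues below 34 and the denominator all residues below 34.\<close>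

definition chi_product :: "complex \<Rightarrow> complex" where
  "chi_product x = (\<Prod>s\<in>{3, 5, 7, 11::nat}. theta (x ^ s) (x ^ 34)) / (\<Prod>r\<in>{1, 9, 13, 15, 2, 4, 8, 16::nat}. theta (x ^ r) (x ^ 34))"

definition chi_euler :: "complex \<Rightarrow> complex" where
  "chi_euler x = (\<Prod>r\<in>QR17. qpoch (x ^ r) (x ^ 17)) * (\<Prod>r\<in>QN17. qpoch (- (x ^ r)) (x ^ 17))"

lemma chi_product_inverse:
  assumes x: "norm x < 1"
  shows "chi_euler x * chi_product x = 1"
proof -
  have lt: "norm (x ^ k) < 1" if "k > 0" for k using x that by (simp add: norm_power power_less_one_iff)
  define P where "P = (\<lambda>k::nat. qpoch (x ^ k) (x ^ 34))"
  have P0: "P k \<noteq> 0" if "k > 0" for k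
  proof -
    have "x ^ k * (x ^ 34) ^ n = x ^ (k + 34 * n)" for n by (simp add: power_add power_mult)
    moreover have "norm (x ^ (k + 34 * n)) < 1" for n using that by (intro lt) simp
    ultimately have "x ^ k * (x ^ 34) ^ n \<noteq> 1" for n by (metis norm_one less_irrefl)
    thus ?thesis by (simp add: P_def qpoch_eq_0_iff lt)
  qed
  have th: "theta (x ^ s) (x ^ 34) = P s * P (34 - s)" if "s < 34" "s > 0" for s
  proof -
    \<comment> \<open>At \<open>x = 0\<close> the convention \<open>0 / 0 = 0\<close> agrees with
      the power on the right.\<close>
    have "x ^ 34 / x ^ s = x ^ (34 - s)" using that by (cases "x = 0") (simp_all add: power_diff)
    thus ?thesis by (simp add: theta_def P_def)
  qed
  have sq: "(x ^ 17)\<^sup>2 = x ^ 34" by (simp flip: power_mult)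
  have q1: "qpoch (x ^ r) (x ^ 17) = P r * P (r + 17)" for r
    using qpoch_double[OF lt[of 17], of "x ^ r"] unfolding sq by (simp add: P_def power_add)
  have q2: "qpoch (- (x ^ r)) (x ^ 17) = P (2 * r) / (P r * P (r + 17))" if "r > 0" for r
  proof -
    have "P r * P (r + 17) * qpoch (- (x ^ r)) (x ^ 17) = P (2 * r)"
      using qpoch_mult_minus[OF lt[of 17], of "x ^ r"] unfolding sq q1 
      by (simp add: P_def power_mult[symmetric] mult.commute)
    thus ?thesis using P0[of r] P0[of "r + 17"] that by (simp add: field_simps)
  qed
  have n0: "P 1 \<noteq> 0" "P 2 \<noteq> 0" "P 3 \<noteq> 0" "P 4 \<noteq> 0" "P 5 \<noteq> 0" "P 6 \<noteq> 0" "P 7 \<noteq> 0" "P 8 \<noteq> 0" "P 9 \<noteq> 0" "P 10 \<noteq> 0"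
    "P 11 \<noteq> 0" "P 12 \<noteq> 0" "P 13 \<noteq> 0" "P 14 \<noteq> 0" "P 15 \<noteq> 0" "P 16 \<noteq> 0" "P 18 \<noteq> 0" "P 19 \<noteq> 0" "P 20 \<noteq> 0" "P 21 \<noteq> 0"
    "P 22 \<noteq> 0" "P 23 \<noteq> 0" "P 24 \<noteq> 0" "P 25 \<noteq> 0" "P 26 \<noteq> 0" "P 27 \<noteq> 0" "P 28 \<noteq> 0" "P 29 \<noteq> 0" "P 30 \<noteq> 0" "P 31 \<noteq> 0"
    "P 32 \<noteq> 0" "P 33 \<noteq> 0"
    by (rule P0; simp)+
  define A where "A = (\<Prod>r\<in>{1, 9, 13, 15, 2, 4, 8, 16::nat}. P r * P (34 - r))"
  define B where "B = (\<Prod>s\<in>{3, 5, 7, 11::nat}. P s * P (34 - s))"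
  have A0: "A \<noteq> 0" and B0: "B \<noteq> 0" using n0 by (simp_all add: A_def B_def)
  have 1: "(\<Prod>r\<in>QR17. qpoch (x ^ r) (x ^ 17)) = A"
    unfolding q1 A_def QR17_def by (simp add: mult_ac)
  have "(\<Prod>r\<in>QN17. qpoch (- (x ^ r)) (x ^ 17)) = (\<Prod>r\<in>QN17. P (2 * r) / (P r * P (r + 17)))"
    by (intro prod.cong refl q2) (auto simp: QN17_def)
  also have "\<dots> = (\<Prod>r\<in>QN17. P (2 * r)) / (\<Prod>r\<in>QN17. P r * P (r + 17))" by (rule prod_dividef)
  \<comment> \<open>The nonresidues below 34 are sorted by parity: the odd ones make up
    \<open>B\<close>, and the even ones are the doubles of \<open>QN17\<close>.\<close>
  also have "(\<Prod>r\<in>QN17. P r * P (r + 17)) = B * (\<Prod>r\<in>QN17. P (2 * r))"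
    unfolding B_def QN17_def by (simp add: mult_ac)
  also have "(\<Prod>r\<in>QN17. P (2 * r)) / \<dots> = 1 / B"
  proof -
    have "(\<Prod>r\<in>QN17. P (2 * r)) \<noteq> 0" using n0 by (simp add: QN17_def)
    thus ?thesis by simp
  qed
  finally have 2: "(\<Prod>r\<in>QN17. qpoch (- (x ^ r)) (x ^ 17)) = 1 / B" .
  have 3: "chi_product x = B / A"
    unfolding chi_product_def A_def B_def by (intro arg_cong2[of _ _ _ _ "(/)"] prod.cong refl th) auto
  show ?thesis unfolding chi_euler_def 1 2 3 using A0 B0 by simp
qed

lemma chi_prod_LIMSEQ:
  assumes x: "norm x < 1"
  shows "(\<lambda>N. \<Prod>m\<in>{1..17 * N}. 1 - of_int (chi m) * x ^ m) \<longlonglongrightarrow> chi_euler x"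
proof -
  have xp: "x ^ (17 * N + r) = x ^ r * (x ^ 17) ^ N" for N r
    unfolding power_add power_mult by (rule mult.commute)
  have lt: "norm (x ^ 17) < 1" using x by (simp add: norm_power power_less_one_iff)
  have "(\<lambda>N. (\<Prod>r\<in>QR17. \<Prod>n<N. 1 - x ^ r * (x ^ 17) ^ n) * (\<Prod>r\<in>QN17. \<Prod>n<N. 1 - (- (x ^ r)) * (x ^ 17) ^ n)) \<longlonglongrightarrow> chi_euler x"
    unfolding chi_euler_def by (intro tendsto_mult tendsto_prod qpoch_LIMSEQ lt)
  moreover have "(\<Prod>m\<in>{1..17 * N}. 1 - of_int (chi m) * x ^ m) = 
     (\<Prod>r\<in>QR17. \<Prod>n<N. 1 - x ^ r * (x ^ 17) ^ n) * (\<Prod>r\<in>QN17. \<Prod>n<N. 1 - (- (x ^ r)) * (x ^ 17) ^ n)" for N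
  proof (induction N)
    case (Suc N)
    have "{1..17 * Suc N} = {1..17 * N} \<union> {17 * N + 1..17 * N + 17}" by auto
    moreover have "{1..17 * N} \<inter> {17 * N + 1..17 * N + 17} = {}" by auto
    ultimately have "(\<Prod>m\<in>{1..17 * Suc N}. 1 - of_int (chi m) * x ^ m) = 
      (\<Prod>m\<in>{1..17 * N}. 1 - of_int (chi m) * x ^ m) * (\<Prod>m\<in>{17 * N + 1..17 * N + 17}. 1 - of_int (chi m) * x ^ m)"
      by (simp add: prod.union_disjoint)
    also have "(\<Prod>m\<in>{17 * N + 1..17 * N + 17}. 1 - of_int (chi m) * x ^ m) = 
       (\<Prod>r\<in>{1..17}. 1 - of_int (chi (17 * N + r)) * x ^ (17 * N + r))"
      by (rule prod.reindex_bij_witness[of _ "\<lambda>r. 17 * N + r" "\<lambda>m. m - 17 * N"]) auto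
    also have "\<dots> = (\<Prod>r\<in>insert 17 (QR17 \<union> QN17). 1 - of_int (chi (17 * N + r)) * x ^ (17 * N + r))"
    proof (rule prod.cong)
      have "{1..17::nat} = set [1..<18]" by auto
      also have "\<dots> = insert 17 (QR17 \<union> QN17)" unfolding QR17_def QN17_def by (simp add: upt_rec) auto
      finally show "{1..17::nat} = insert 17 (QR17 \<union> QN17)" .
    qed simp
    also have "\<dots> = (\<Prod>r\<in>QR17 \<union> QN17. 1 - of_int (chi (17 * N + r)) * x ^ (17 * N + r))"
    proof -
      have "17 \<notin> QR17 \<union> QN17" "finite (QR17 \<union> QN17)" by (auto simp: QR17_def QN17_def)
      moreover have "chi (17 * N + 17) = 0" by (simp add: chi_eq QR17_def)
      ultimately show ?thesis by (subst prod.insert) auto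
    qed
    also have "\<dots> = (\<Prod>r\<in>QR17. 1 - of_int (chi (17 * N + r)) * x ^ (17 * N + r)) * (\<Prod>r\<in>QN17. 1 - of_int (chi (17 * N + r)) * x ^ (17 * N + r))"
      by (rule prod.union_disjoint) (auto simp: QR17_def QN17_def)
    also have "(\<Prod>r\<in>QR17. 1 - of_int (chi (17 * N + r)) * x ^ (17 * N + r)) = (\<Prod>r\<in>QR17. 1 - x ^ r * (x ^ 17) ^ N)"
    proof (intro prod.cong refl)
      fix r assume r: "r \<in> QR17"
      hence "chi (17 * N + r) = 1" by (auto simp: chi_eq QR17_def)
      thus "1 - of_int (chi (17 * N + r)) * x ^ (17 * N + r) = 1 - x ^ r * (x ^ 17) ^ N"
        by (simp add: xp)
    qed
    also have "(\<Prod>r\<in>QN17. 1 - of_int (chi (17 * N + r)) * x ^ (17 * N + r)) = (\<Prod>r\<in>QN17. 1 - (- (x ^ r)) * (x ^ 17) ^ N)"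
    proof (intro prod.cong refl)
      fix r assume r: "r \<in> QN17"
      hence "chi (17 * N + r) = -1" by (auto simp: chi_eq QR17_def QN17_def)
      thus "1 - of_int (chi (17 * N + r)) * x ^ (17 * N + r) = 1 - (- (x ^ r)) * (x ^ 17) ^ N"
        by (simp add: xp)
    qed
    finally have step: "(\<Prod>m\<in>{1..17 * Suc N}. 1 - of_int (chi m) * x ^ m) = 
       (\<Prod>m\<in>{1..17 * N}. 1 - of_int (chi m) * x ^ m) *
       ((\<Prod>r\<in>QR17. 1 - x ^ r * (x ^ 17) ^ N) * (\<Prod>r\<in>QN17. 1 - (- (x ^ r)) * (x ^ 17) ^ N))" .
    show ?case unfolding step Suc prod.lessThan_Suc prod.distrib
    proof -
      have "(a * b) * (c * d) = (a * c) * (b * d)" for a b c d :: complex by (simp add: mult_ac)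
      thus "(\<Prod>r\<in>QR17. \<Prod>n<N. 1 - x ^ r * (x ^ 17) ^ n) * (\<Prod>r\<in>QN17. \<Prod>n<N. 1 - (- (x ^ r)) * (x ^ 17) ^ n) *
         ((\<Prod>r\<in>QR17. 1 - x ^ r * (x ^ 17) ^ N) * (\<Prod>r\<in>QN17. 1 - (- (x ^ r)) * (x ^ 17) ^ N)) =
         (\<Prod>r\<in>QR17. \<Prod>n<N. 1 - x ^ r * (x ^ 17) ^ n) * (\<Prod>r\<in>QR17. 1 - x ^ r * (x ^ 17) ^ N) *
         ((\<Prod>r\<in>QN17. \<Prod>n<N. 1 - (- (x ^ r)) * (x ^ 17) ^ n) * (\<Prod>r\<in>QN17. 1 - (- (x ^ r)) * (x ^ 17) ^ N))" .
    qed
  qed simp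
  ultimately show ?thesis by simp
qed

lemma chi_product_expansion: "chi_product has_fps_expansion signed_pgf chi"
  by (rule signed_euler_product[OF _ chi_prod_LIMSEQ _ chi_product_inverse]) (auto simp: chi_eq)

text \<open>The exponent 12 is \<open>21 - 9\<close> from \<open>kquot_theta\<close>. It shifts the
  index selected by the coset sum: \<open>e + 12 + n\<close> has to be divisible by 34.\<close>

lemma kquot_1_eq:
  "kquot 1 j \<tau> = ee ((\<tau> + of_int j) / 34) ^ 12 * chi_product (ee ((\<tau> + of_int j) / 34))"
proof -
  define z where "z = (\<tau> + of_int j) / 34"
  have z: "(of_int 1 * \<tau> + of_int j) / 34 = z" by (simp add: z_def)
  have q: "ee z ^ 34 = ee \<tau>" unfolding ee_power by (rule ee_cong[of _ _ j]) (simp add: z_def field_simps)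
  have s: "ee (of_int (int s) * z) = ee z ^ s" for s by (simp add: ee_power)
  have 12: "ee (of_int (21 - 9 * 1) * z) = ee z ^ 12" by (simp add: ee_power)
  have "(\<Prod>s\<in>num_set. theta (ee (of_int s * z)) (ee \<tau>)) = (\<Prod>s\<in>{3, 5, 7, 11::nat}. theta (ee z ^ s) (ee z ^ 34))"
    unfolding q num_set_def using s[of 3] s[of 5] s[of 7] s[of 11] by simp
  moreover have "(\<Prod>s\<in>den_set. theta (ee (of_int s * z)) (ee \<tau>)) = (\<Prod>r\<in>{1, 9, 13, 15, 2, 4, 8, 16::nat}. theta (ee z ^ r) (ee z ^ 34))"
    unfolding q den_set_def using s[of 9] s[of 13] s[of 15] s[of 2] s[of 4] s[of 8] s[of 16] by simp
  ultimately show ?thesis unfolding kquot_theta z 12 chi_product_def z_def[symmetric] by simp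
qed

lemma chi_product_sum_eq_0:
  assumes e: "e \<in> char_exps" and x: "norm x < 1" "x \<noteq> 0"
  shows "(\<Sum>j\<in>{0..<34::int}. ee (of_int ((e + 12) * j) / 34) * chi_product (ee (of_int j / 34) * x)) = 0"
proof -
  obtain z where z: "ee z = x"
  proof
    show "ee (Ln x / (2 * pi * \<i>)) = x" using x(2) by (simp add: ee_def)
  qed
  define \<tau> where "\<tau> = 34 * z"
  have "Im \<tau> > 0" using x(1) unfolding z[symmetric] by (simp add: norm_ee \<tau>_def zero_less_mult_iff)
  have X: "ee ((\<tau> + of_int j) / 34) = ee (of_int j / 34) * x" for j
    unfolding z[symmetric] ee_add[symmetric] by (simp add: \<tau>_def add_divide_distrib add.commute)
  have "0 = coset_sum e 1 0 0 1 \<tau>" using coset_sum_eq_0[OF e _ \<open>Im \<tau> > 0\<close>, of 1 1 0 0] by simp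
  also have "\<dots> = (\<Sum>j\<in>{0..<34::int}. x ^ 12 * (ee (of_int ((e + 12) * j) / 34) * chi_product (ee (of_int j / 34) * x)))"
    unfolding coset_sum_def
  proof (intro sum.cong refl)
    fix j :: int
    have "ee (of_int (e * j) / 34) * ee (of_int j / 34) ^ 12 = ee (of_int ((e + 12) * j) / 34)"
      unfolding ee_power ee_add[symmetric] by (intro arg_cong[of _ _ ee]) (simp add: field_simps)
    thus "ee (of_int (e * j) / 34) * kquot (1 + j * 0) (0 + j * 1) \<tau> = x ^ 12 * (ee (of_int ((e + 12) * j) / 34) * chi_product (ee (of_int j / 34) * x))"
      by (simp add: kquot_1_eq X power_mult_distrib mult_ac)
  qed
  also have "\<dots> = x ^ 12 * (\<Sum>j\<in>{0..<34::int}. ee (of_int ((e + 12) * j) / 34) * chi_product (ee (of_int j / 34) * x))"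
    by (rule sum_distrib_left[symmetric])
  finally show ?thesis using x(2) by simp
qed

lemma signed_partition_number_eq_0:
  assumes e: "e \<in> char_exps" and n: "34 dvd e + 12 + int n" "n > 0"
  shows "signed_partition_number n chi = 0"
proof -
  define S where "S = (\<lambda>x. \<Sum>j\<in>{0..<34::int}. ee (of_int ((e + 12) * j) / 34) * chi_product (ee (of_int j / 34) * x))"
  have RRj: "(\<lambda>x. chi_product (c * x)) has_fps_expansion Abs_fps (\<lambda>n. c ^ n * signed_pgf chi $ n)" for c
  proof -
    have "(chi_product \<circ> (\<lambda>x. c * x)) has_fps_expansion fps_compose (signed_pgf chi) (fps_const c * fps_X)"
      by (intro has_fps_expansion_compose chi_product_expansion has_fps_expansion_cmult_left has_fps_expansion_fps_X) simp
    thus ?thesis by (simp add: o_def fps_compose_linear)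
  qed
  define F where "F = (\<Sum>j\<in>{0..<34::int}. fps_const (ee (of_int ((e + 12) * j) / 34)) * Abs_fps (\<lambda>n. ee (of_int j / 34) ^ n * signed_pgf chi $ n))"
  have S: "S has_fps_expansion F"
    unfolding S_def F_def by (intro has_fps_expansion_sum has_fps_expansion_cmult_left RRj)
  \<comment> \<open>The vanishing of \<open>S\<close> is known only away from 0; the factor
    \<open>x\<close> covers the point 0.\<close>
  have "(\<lambda>x. x * S x) has_fps_expansion fps_X * F"
    by (intro has_fps_expansion_mult has_fps_expansion_fps_X S)
  moreover have "(\<lambda>x. x * S x) has_fps_expansion 0"
    unfolding has_fps_expansion_0_iff
  proof -
    have "eventually (\<lambda>x::complex. x \<in> ball 0 1) (nhds 0)" by (rule eventually_nhds_in_open) auto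
    thus "\<forall>\<^sub>F z in nhds 0. z * S z = 0"
      by eventually_elim (use chi_product_sum_eq_0[OF e] in \<open>auto simp: S_def\<close>)
  qed
  ultimately have "fps_X * F = 0" by (rule fps_expansion_unique_complex)
  hence "F = 0" by simp
  hence "0 = F $ n" by simp
  also have "\<dots> = (\<Sum>j\<in>{0..<34::int}. signed_pgf chi $ n)"
    unfolding F_def fps_sum_nth fps_mult_left_const_nth fps_nth_Abs_fps
  proof (intro sum.cong refl)
    fix j :: int
    obtain k where k: "e + 12 + int n = 34 * k" using n(1) by blast
    have "ee (of_int ((e + 12) * j) / 34) * ee (of_int j / 34) ^ n = ee (of_int ((e + 12 + int n) * j) / 34)"
      unfolding ee_power ee_add[symmetric] by (intro arg_cong[of _ _ ee]) (simp add: field_simps)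
    also have "\<dots> = ee (of_int (k * j))" unfolding k by (intro arg_cong[of _ _ ee]) simp
    also have "\<dots> = 1" by (rule ee_of_int)
    finally show "ee (of_int ((e + 12) * j) / 34) * (ee (of_int j / 34) ^ n * signed_pgf chi $ n) = signed_pgf chi $ n"
      by (simp only: mult.assoc[symmetric] mult_1)
  qed
  finally have "signed_pgf chi $ n = 0" by simp
  thus ?thesis using n(2) by (simp add: signed_pgf_def)
qed



theorem theorem1p1:
  fixes \<chi> :: "nat \<Rightarrow> int"
  defines "\<chi> \<equiv> (\<lambda>a. Legendre (int a) 17)"
  shows "(\<forall>n::nat. n > 0 \<and> (\<exists>r\<in>{17, 19, 25, 27}. [n = r] (mod 34)) \<longrightarrow>
            signed_partition_number n \<chi> = 0) \<and>
         (\<forall>n::nat. n > 0 \<and> odd n \<and> quartic_residue 17 (1 - 24 * int n) \<longrightarrow>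
            signed_partition_number n \<chi> = 0) \<and>
         (\<forall>n::nat. n > 0 \<longrightarrow>
            (\<exists>r\<in>{17, 19, 25, 27}. [n = r] (mod 34)) \<longleftrightarrow>
              odd n \<and> quartic_residue 17 (1 - 24 * int n))"
proof -
  have "signed_partition_number n \<chi> = 0" if n: "n > 0" and r: "\<exists>r\<in>{17, 19, 25, 27}. [n = r] (mod 34)" for n
  proof -
    have "\<exists>e\<in>char_exps. 34 dvd e + 12 + int n"
    proof -
      obtain r where r: "r \<in> {17, 19, 25, 27}" "[n = r] (mod 34)" using r by blast
      have "34 dvd int n - int r" using r(2) by (metis cong_iff_dvd_diff cong_int_iff of_nat_numeral)
      \<comment> \<open>Here \<open>22 = 34 - 12\<close>; the classes 17, 19, 25, 27 give 5, 3, -3,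
        -5.\<close>
      moreover have "22 - int r \<in> char_exps" using r(1) by (auto simp: char_exps_def)
      moreover have "22 - int r + 12 + int n = 34 + (int n - int r)" by simp
      ultimately show ?thesis by (metis dvd_add dvd_refl)
    qed
    then obtain e where "e \<in> char_exps" "34 dvd e + 12 + int n" by blast
    moreover have "\<chi> = chi" by (simp add: \<chi>_def chi_def fun_eq_iff)
    ultimately show ?thesis using signed_partition_number_eq_0 n by simp
  qed
  thus ?thesis unfolding residue_classes_iff by blast
qed

end
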